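(* Let $\mathcal{A}_{tor}(\mathcal{S})$ be a toroidal cluster algebra. The toroidal exchange graph of $\mathcal{A}_{tor}(\mathcal{S})$ identifies with the exchange graph of its classical specialization: the natural map sending the toroidal seed obtained from $\mathcal{S}$ by a sequence of mutations to the classical seed obtained from the initial classical seed by the same sequence of mutations is a well-defined isomorphism of graphs.
   Context: Let $1\le m\le n$ and $r\ge1$ be integers, $t_1,\dots,t_r$ formal variables, and $\mathbf{R}=\mathbb{Z}[t_1^{\pm1/2},\dots,t_r^{\pm1/2}]$. **Ambient field.** For skew-symmetric maps $\Lambda_a:\{1,\dots,n\}^2\to\mathbb{Z}$ ($1\le a\le r$), $\mathcal{T}$ is the quantum torus over $\mathbf{R}$ with invertible generators $X_1,\dots,X_n$ and relations $X_i*X_j=\big(\prod_at_a^{\Lambda_a(i,j)}\big)X_j*X_i$, and $\mathcal{F}$ is its skew field of fractions. If elements $Y_1,\dots,Y_n\in\mathcal{F}$ quasi-commute, i.e. $Y_i*Y_j=\big(\prod_at_a^{\Lambda_{a,\mathcal{S}}(i,j)}\big)Y_j*Y_i$, the commutative monomial with integer exponents $u_i$ is $\prod_iY_i^{u_i}=\Big(\prod_at_a^{\frac12\sum_{i<j}u_iu_j\Lambda_{a,\mathcal{S}}(j,i)}\Big)Y_1^{u_1}*\cdots*Y_n^{u_n}$. **Toroidal seed.** A collection $\mathcal{S}=(Y_1,\dots,Y_n;\widetilde B)$ with $Y_i\in\mathcal{F}$ and $\widetilde B=(b_{i,j})$ an integer $n\times m$ matrix whose principal part $(b_{i,j})_{1\le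 i,j\le m}$ is skew-symmetric, such that: (i) the $Y_i$ are algebraically independent, generate $\mathcal{F}$, and quasi-commute, with matrices $\Lambda_{a,\mathcal{S}}$; (ii) for each $a$, the $m\times n$ matrix $\widetilde B^T\Lambda_{a,\mathcal{S}}$ has left $m\times m$ block diagonal with (nonzero) diagonal entries of constant sign, and right $m\times(n-m)$ block zero. **Mutation.** For $1\le k\le m$, $\mu_k(\mathcal{S})$ is obtained by replacing $\widetilde B$ by its usual (Fomin--Zelevinsky) matrix mutation in direction $k$ and $Y_k$ by $Y_k'$ with $$Y_k'*Y_k=u\prod_{b_{i,k}>0}Y_i^{b_{i,k}}+v\prod_{b_{i,k}<0}Y_i^{-b_{i,k}},$$ where the products are commutative monomials and $u,v$ are the Laurent monomials in the $t_a^{1/2}$ with $u^2Y_k*\prod_{b_{i,k}>0}Y_i^{b_{i,k}}=\prod_{b_{i,k}>0}Y_i^{b_{i,k}}*Y_k$ and $v^2Y_k*\prod_{b_{i,k}<0}Y_i^{-b_{i,k}}=\prod_{b_{i,k}<0}Y_i^{-b_{i,k}}*Y_k$. Mutations of toroidal seeds are toroidal seeds. $\mathcal{A}_{tor}(\mathcal{S})\subset\mathcal{F}$ is the $\mathbf{R}$-subalgebra generated by all elements $Y_i$ (toroidal cluster variables) of all toroidal seeds obtained from $\mathcal{S}$ by iterated mutations. **Exchange graphs.** The exchange graph of a cluster algebra has the seeds as vertices and the seed mutations as edges; the toroidal exchange graph of a toroidal cluster algebra is defined in the same way from its toroidal seeds. In both cases seeds are considered up to simultaneous relabelling of the variables and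 of the rows and columns of the exchange matrix. The classical specialization of $\mathcal{A}_{tor}(\mathcal{S})$ is the (commutative) cluster algebra with initial exchange matrix $\widetilde B$ of the toroidal seed $\mathcal{S}$. *)

theory Defs
  imports
    Complex_Main
    "HOL-Library.Poly_Mapping"
    "HOL-Combinatorics.Permutations"
    "HOL-Computational_Algebra.Fraction_Field"
begin

section \<open>Monomials, linear independence, quantum tori\<close>

text \<open>
  Families indexed by 1,...,n are functions on the naturals; only their values on that range
  matter. The sequence \<open>s\<close> stands for the square roots of the formal variables, so that the
  variable \<open>t a\<close> is the square of \<open>s a\<close>.
\<close>

text \<open>The product is taken in increasing order of the index; it is \<^emph>\<open>not\<close> normalised.\<close>
definition ordered_monomial :: "nat \<Rightarrow> (nat \<Rightarrow> 'f::division_ring) \<Rightarrow> (nat \<Rightarrow> int) \<Rightarrow> 'f" where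
  "ordered_monomial n Y u = prod_list (map (\<lambda>i. Y i powi u i) [1..<Suc n])"

definition t_monomial :: "nat \<Rightarrow> (nat \<Rightarrow> 'f::division_ring) \<Rightarrow> (nat \<Rightarrow> int) \<Rightarrow> 'f" where
  "t_monomial r s e = ordered_monomial r (\<lambda>a. (s a)\<^sup>2) e"

definition exponents :: "nat \<Rightarrow> (nat \<Rightarrow> int) set" where
  "exponents n = {u. \<forall>i. i \<notin> {1..n} \<longrightarrow> u i = 0}"

definition span_over :: "'f::ring_1 set \<Rightarrow> ('i \<Rightarrow> 'f) \<Rightarrow> 'i set \<Rightarrow> 'f set" where
  "span_over K b I = {\<Sum>i\<in>A. c i * b i | A c. finite A \<and> A \<subseteq> I \<and> (\<forall>i\<in>A. c i \<in> K)}"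

definition lin_indep_over :: "'f::ring_1 set \<Rightarrow> ('i \<Rightarrow> 'f) \<Rightarrow> 'i set \<Rightarrow> bool" where
  "lin_indep_over K b I \<longleftrightarrow>
     (\<forall>A c. finite A \<and> A \<subseteq> I \<and> (\<forall>i\<in>A. c i \<in> K) \<and> (\<Sum>i\<in>A. c i * b i) = 0 \<longrightarrow> (\<forall>i\<in>A. c i = 0))"

text \<open>The image of the base ring of Laurent polynomials, and the quantum torus it generates
  together with \<open>X\<close> (once the commutation relations hold).\<close>
definition base_ring :: "nat \<Rightarrow> (nat \<Rightarrow> 'f::division_ring) \<Rightarrow> 'f set" where
  "base_ring r s = span_over \<int> (ordered_monomial r s) (exponents r)"

definition quantum_torus ::
  "nat \<Rightarrow> nat \<Rightarrow> (nat \<Rightarrow> 'f::division_ring) \<Rightarrow> (nat \<Rightarrow> 'f) \<Rightarrow> 'f set" where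
  "quantum_torus r n s X = span_over (base_ring r s) (ordered_monomial n X) (exponents n)"

definition quasi_commute ::
  "nat \<Rightarrow> nat \<Rightarrow> (nat \<Rightarrow> 'f::division_ring) \<Rightarrow> (nat \<Rightarrow> nat \<Rightarrow> nat \<Rightarrow> int) \<Rightarrow> (nat \<Rightarrow> 'f) \<Rightarrow> bool" where
  "quasi_commute r n s L Y \<longleftrightarrow>
     (\<forall>i\<in>{1..n}. \<forall>j\<in>{1..n}. Y i * Y j = t_monomial r s (\<lambda>a. L a i j) * (Y j * Y i))"

text \<open>
  The type \<open>'f\<close> is a skew field of fractions of the quantum torus with generators \<open>X\<close>:
  the \<open>s a\<close> are central and generate a Laurent polynomial ring over the integers, the
  \<open>X i\<close> satisfy the commutation relations and no others (that is, the ordered Laurent monomials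
  form a basis over the base ring), and every element is a fraction of elements of the torus.
  The sort constraint \<open>ring_char_0\<close> makes \<open>\<int>\<close> a faithful copy of the integers.
\<close>
definition torus_fraction_field ::
  "nat \<Rightarrow> nat \<Rightarrow> (nat \<Rightarrow> nat \<Rightarrow> nat \<Rightarrow> int) \<Rightarrow> (nat \<Rightarrow> 'f::{division_ring, ring_char_0}) \<Rightarrow>
     (nat \<Rightarrow> 'f) \<Rightarrow> bool" where
  "torus_fraction_field r n \<Lambda> s X \<longleftrightarrow>
     (\<forall>a\<in>{1..r}. s a \<noteq> 0 \<and> (\<forall>f. s a * f = f * s a)) \<and>
     lin_indep_over \<int> (ordered_monomial r s) (exponents r) \<and>
     (\<forall>i\<in>{1..n}. X i \<noteq> 0) \<and>
     quasi_commute r n s \<Lambda> X \<and>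
     lin_indep_over (base_ring r s) (ordered_monomial n X) (exponents n) \<and>
     (\<forall>f. \<exists>p\<in>quantum_torus r n s X. \<exists>q\<in>quantum_torus r n s X. q \<noteq> 0 \<and> f = p * inverse q)"

inductive_set skew_subfield_generated :: "'f::division_ring set \<Rightarrow> 'f set"
  for G :: "'f set" where
  gen: "x \<in> G \<Longrightarrow> x \<in> skew_subfield_generated G"
| one: "1 \<in> skew_subfield_generated G"
| diff: "x \<in> skew_subfield_generated G \<Longrightarrow> y \<in> skew_subfield_generated G \<Longrightarrow>
         x - y \<in> skew_subfield_generated G"
| mult: "x \<in> skew_subfield_generated G \<Longrightarrow> y \<in> skew_subfield_generated G \<Longrightarrow>
         x * y \<in> skew_subfield_generated G"
| inverse: "x \<in> skew_subfield_generated G \<Longrightarrow> inverse x \<in> skew_subfield_generated G"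

section \<open>Toroidal seeds\<close>

text \<open>
  A seed is a pair of a family of variables and an extended exchange matrix; with parameters
  \<open>m \<le> n\<close> the relevant indices are 1,...,n for variables and rows and 1,...,m for columns.
\<close>
type_synonym 'f seed = "(nat \<Rightarrow> 'f) \<times> (nat \<Rightarrow> nat \<Rightarrow> int)"

text \<open>The commutation exponents of a quasi-commuting family of nonzero elements; they are uniquely
  determined on the relevant index range when the \<open>s a\<close> are algebraically independent.\<close>
definition commutation_matrices ::
  "nat \<Rightarrow> nat \<Rightarrow> (nat \<Rightarrow> 'f::division_ring) \<Rightarrow> (nat \<Rightarrow> 'f) \<Rightarrow> (nat \<Rightarrow> nat \<Rightarrow> nat \<Rightarrow> int)" where
  "commutation_matrices r n s Y = (SOME L. quasi_commute r n s L Y)"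

text \<open>Algebraic independence of a quasi-commuting family: there is no nontrivial polynomial
  relation (with non-negative exponents) with coefficients in the base ring.\<close>
definition quantum_alg_independent ::
  "nat \<Rightarrow> nat \<Rightarrow> (nat \<Rightarrow> 'f::division_ring) \<Rightarrow> (nat \<Rightarrow> 'f) \<Rightarrow> bool" where
  "quantum_alg_independent r n s Y \<longleftrightarrow>
     lin_indep_over (base_ring r s) (ordered_monomial n Y) {u \<in> exponents n. \<forall>i. 0 \<le> u i}"

text \<open>The sign of the diagonal is allowed to depend on \<open>a\<close>.\<close>
definition toroidal_compatible ::
  "nat \<Rightarrow> nat \<Rightarrow> nat \<Rightarrow> (nat \<Rightarrow> nat \<Rightarrow> int) \<Rightarrow> (nat \<Rightarrow> nat \<Rightarrow> nat \<Rightarrow> int) \<Rightarrow> bool" where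
  "toroidal_compatible r m n B L \<longleftrightarrow>
     (\<forall>a\<in>{1..r}.
        let D = (\<lambda>j i. \<Sum>k\<in>{1..n}. B k j * L a k i) in
          (\<forall>j\<in>{1..m}. \<forall>i\<in>{1..n}. i \<noteq> j \<longrightarrow> D j i = 0) \<and>
          ((\<forall>j\<in>{1..m}. D j j > 0) \<or> (\<forall>j\<in>{1..m}. D j j < 0)))"

fun toroidal_seed ::
  "nat \<Rightarrow> nat \<Rightarrow> nat \<Rightarrow> (nat \<Rightarrow> 'f::division_ring) \<Rightarrow> 'f seed \<Rightarrow> bool" where
  "toroidal_seed r m n s (Y, B) \<longleftrightarrow>
     (\<forall>i\<in>{1..m}. \<forall>j\<in>{1..m}. B i j = - B j i) \<and>
     quantum_alg_independent r n s Y \<and>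
     skew_subfield_generated (base_ring r s \<union> Y ` {1..n}) = UNIV \<and>
     (\<exists>L. quasi_commute r n s L Y) \<and>
     toroidal_compatible r m n B (commutation_matrices r n s Y)"

section \<open>Mutation\<close>

definition matrix_mutation :: "nat \<Rightarrow> (nat \<Rightarrow> nat \<Rightarrow> int) \<Rightarrow> (nat \<Rightarrow> nat \<Rightarrow> int)" where
  "matrix_mutation k B = (\<lambda>i j.
     if i = k \<or> j = k then - B i j
     else B i j + sgn (B i k) * max 0 (B i k * B k j))"

text \<open>The prefactor has exponent one half in \<open>t a\<close>, hence the monomial in the \<open>s a\<close>; note the
  order of the indices \<open>j i\<close> in the commutation matrix.\<close>
definition commutative_monomial ::
  "nat \<Rightarrow> nat \<Rightarrow> (nat \<Rightarrow> 'f::division_ring) \<Rightarrow> (nat \<Rightarrow> 'f) \<Rightarrow> (nat \<Rightarrow> int) \<Rightarrow> 'f" where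
  "commutative_monomial r n s Y u =
     ordered_monomial r s
       (\<lambda>a. \<Sum>j\<in>{1..n}. \<Sum>i\<in>{1..<j}. u i * u j * commutation_matrices r n s Y a j i) *
     ordered_monomial n Y u"

definition positive_column :: "nat \<Rightarrow> (nat \<Rightarrow> nat \<Rightarrow> int) \<Rightarrow> nat \<Rightarrow> int" where
  "positive_column k B = (\<lambda>i. if B i k > 0 then B i k else 0)"

definition negative_column :: "nat \<Rightarrow> (nat \<Rightarrow> nat \<Rightarrow> int) \<Rightarrow> nat \<Rightarrow> int" where
  "negative_column k B = (\<lambda>i. if B i k < 0 then - B i k else 0)"

text \<open>The unique Laurent monomial \<open>u\<close> in the \<open>s a\<close> with \<open>u\<^sup>2 * y * M = M * y\<close>.\<close>
definition half_commutator ::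
  "nat \<Rightarrow> (nat \<Rightarrow> 'f::division_ring) \<Rightarrow> 'f \<Rightarrow> 'f \<Rightarrow> 'f" where
  "half_commutator r s y M = (THE u. u \<in> range (ordered_monomial r s) \<and> u\<^sup>2 * y * M = M * y)"

fun toroidal_mutation ::
  "nat \<Rightarrow> nat \<Rightarrow> (nat \<Rightarrow> 'f::division_ring) \<Rightarrow> nat \<Rightarrow> 'f seed \<Rightarrow> 'f seed" where
  "toroidal_mutation r n s k (Y, B) =
     (let P = commutative_monomial r n s Y (positive_column k B);
          N = commutative_monomial r n s Y (negative_column k B);
          u = half_commutator r s (Y k) P;
          v = half_commutator r s (Y k) N
      in (Y(k := (u * P + v * N) * inverse (Y k)), matrix_mutation k B))"

fun classical_mutation :: "nat \<Rightarrow> nat \<Rightarrow> 'c::field seed \<Rightarrow> 'c seed" where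
  "classical_mutation n k (x, B) =
     (x(k := ((\<Prod>i\<in>{1..n}. x i powi positive_column k B i) +
              (\<Prod>i\<in>{1..n}. x i powi negative_column k B i)) / x k),
      matrix_mutation k B)"

text \<open>Rational functions over the rationals in countably many variables. All seeds mutation
  equivalent to \<open>classical_initial_seed B\<close> involve only the variables 1,...,n.\<close>
type_synonym rational_function = "((nat \<Rightarrow>\<^sub>0 nat) \<Rightarrow>\<^sub>0 int) fract"

definition variable :: "nat \<Rightarrow> rational_function" where
  "variable i = Fract (Poly_Mapping.single (Poly_Mapping.single i 1) 1) 1"

definition classical_initial_seed :: "(nat \<Rightarrow> nat \<Rightarrow> int) \<Rightarrow> rational_function seed" where
  "classical_initial_seed B = (variable, B)"

section \<open>Exchange graphs\<close>

text \<open>Simultaneous relabelling; mutable indices must go to mutable indices, since only these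
  index columns.\<close>
fun seed_equiv :: "nat \<Rightarrow> nat \<Rightarrow> 'f seed \<Rightarrow> 'f seed \<Rightarrow> bool" where
  "seed_equiv m n (Y, B) (Y', B') \<longleftrightarrow>
     (\<exists>\<sigma>. \<sigma> permutes {1..n} \<and> \<sigma> ` {1..m} = {1..m} \<and>
        (\<forall>i\<in>{1..n}. Y' (\<sigma> i) = Y i) \<and>
        (\<forall>i\<in>{1..n}. \<forall>j\<in>{1..m}. B' (\<sigma> i) (\<sigma> j) = B i j))"

definition unlabelled_seed :: "nat \<Rightarrow> nat \<Rightarrow> 'f seed \<Rightarrow> 'f seed set" where
  "unlabelled_seed m n S = {S'. seed_equiv m n S S'}"

text \<open>The directions are applied from left to right.\<close>
definition mutate_along :: "(nat \<Rightarrow> 'f seed \<Rightarrow> 'f seed) \<Rightarrow> nat list \<Rightarrow> 'f seed \<Rightarrow> 'f seed" where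
  "mutate_along \<mu> ks S = fold \<mu> ks S"

definition mutation_class ::
  "nat \<Rightarrow> (nat \<Rightarrow> 'f seed \<Rightarrow> 'f seed) \<Rightarrow> 'f seed \<Rightarrow> 'f seed set" where
  "mutation_class m \<mu> S = {mutate_along \<mu> ks S | ks. set ks \<subseteq> {1..m}}"

text \<open>An undirected graph is a set of vertices with a set of edges, each edge being the set of its
  end points.\<close>
type_synonym 'v ugraph = "'v set \<times> 'v set set"

definition exchange_graph ::
  "nat \<Rightarrow> nat \<Rightarrow> (nat \<Rightarrow> 'f seed \<Rightarrow> 'f seed) \<Rightarrow> 'f seed \<Rightarrow> 'f seed set ugraph" where
  "exchange_graph m n \<mu> S =
     (unlabelled_seed m n ` mutation_class m \<mu> S,
      {{unlabelled_seed m n P, unlabelled_seed m n (\<mu> k P)} | P k.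
         P \<in> mutation_class m \<mu> S \<and> k \<in> {1..m}})"

definition graph_isomorphism :: "('v \<Rightarrow> 'w) \<Rightarrow> 'v ugraph \<Rightarrow> 'w ugraph \<Rightarrow> bool" where
  "graph_isomorphism \<phi> G H \<longleftrightarrow>
     bij_betw \<phi> (fst G) (fst H) \<and>
     (\<forall>v\<in>fst G. \<forall>w\<in>fst G. {v, w} \<in> snd G \<longleftrightarrow> {\<phi> v, \<phi> w} \<in> snd H)"

end

theory Submission
  imports Defs "HOL-Library.Function_Algebras"
begin

text \<open>
  Every toroidal cluster variable is a Laurent polynomial in any other toroidal cluster. This is
  proved with upper bounds: if \<open>f\<close> is Laurent in a seed and in its mutations in directions \<open>j\<close> and
  \<open>k\<close>, one divides the coefficient of the lowest power of \<open>Y j\<close>, in the seed mutated in direction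
  \<open>k\<close>, by a power of the new exchange binomial. The remainder is narrow for the grading given by
  commutation with \<open>Y j\<close>, and the same grading shows that a narrow remainder vanishes. Compatibility
  of the exchange matrix with the commutation exponents makes this grading non-constant on the
  exchange binomial.

  On the quantum torus of a cluster there are then three maps: specialization to the classical torus,
  the bar involution, and the sum of all integer coefficients. By induction along exchange relations,
  a cluster variable specializes to the classical one, is bar invariant, and for every
  grading its top component has positive coefficient sum. Hence specialization preserves the extreme
  degrees, so a toroidal variable that specializes to a variable of the base cluster is a
  scalar multiple of it. The scalar is a bar invariant unit of the base ring that specializes to one,
  hence equal to one. So toroidal and classical seeds coincide along the same mutation sequences.
  The classical side is the case \<open>r = 0\<close> of the same construction.
\<close>

section \<open>Integer spans and ordered monomials\<close>

text \<open>Specialization can shrink supports: on one monomial the coefficients of different powers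
  of the \<open>s a\<close> may cancel once the \<open>s a\<close> become 1, so a toroidal variable
  might be larger than its classical image. A positive coefficient sum of the top component excludes
  this at the extreme degrees. Such a sum also passes through the division by \<open>Y k\<close> in
  an exchange relation: tops multiply without cancellation and the sum is multiplicative, so it is
  positive for a quotient when it is positive for divisor and product. The division by an exchange
  binomial in the Laurent argument leaves a remainder in general. It can be bounded in any grading
  that separates the two terms of the binomial; commutation with \<open>Y j\<close>, read in one
  formal variable, is such a grading, and this is where \<open>1 \<le> r\<close> enters. Mutation is
  involutive, so any seed of a sequence may serve as base. Viewing two seeds from both ends is what
  makes the unknown scalar a unit.\<close>

inductive_set additive_span :: "'a::ring_1 set \<Rightarrow> 'a set" for X where
  base: "x \<in> X \<Longrightarrow> x \<in> additive_span X"
| zero: "0 \<in> additive_span X"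
| diff: "x \<in> additive_span X \<Longrightarrow> y \<in> additive_span X \<Longrightarrow> x - y \<in> additive_span X"

lemma additive_span_uminus: "x \<in> additive_span X \<Longrightarrow> - x \<in> additive_span X"
  using additive_span.diff[OF additive_span.zero] by fastforce

lemma additive_span_add: "x \<in> additive_span X \<Longrightarrow> y \<in> additive_span X \<Longrightarrow> x + y \<in> additive_span X"
  using additive_span.diff[OF _ additive_span_uminus, of x X y] by simp

lemma additive_span_sum: "(\<And>i. i \<in> A \<Longrightarrow> f i \<in> additive_span X) \<Longrightarrow> sum f A \<in> additive_span X"
  by (induction A rule: infinite_finite_induct)
    (auto intro: additive_span.zero additive_span_add)

lemma additive_span_of_int_mult:
  assumes "x \<in> additive_span X"
  shows "of_int c * x \<in> additive_span X"
proof (induction c rule: int_induct[where k = 0])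
  case base
  show ?case by (simp add: additive_span.zero)
next
  case (step1 i)
  thus ?case using additive_span_add[OF step1(2) assms] by (simp add: distrib_right)
next
  case (step2 i)
  thus ?case using additive_span.diff[OF step2(2) assms] by (simp add: left_diff_distrib)
qed

lemma additive_span_subset: "X \<subseteq> additive_span Y \<Longrightarrow> additive_span X \<subseteq> additive_span Y"
proof
  fix x assume "X \<subseteq> additive_span Y" "x \<in> additive_span X"
  from this(2,1) show "x \<in> additive_span Y"
    by induction (auto intro: additive_span.intros)
qed

lemma additive_span_mono: "X \<subseteq> Y \<Longrightarrow> additive_span X \<subseteq> additive_span Y"
  by (rule additive_span_subset) (auto intro: additive_span.base)

lemma sum_int_pad:
  assumes "finite C" "A \<subseteq> C"
  shows "(\<Sum>i\<in>A. of_int (c i) * g i) = (\<Sum>i\<in>C. of_int (if i \<in> A then c i else 0) * (g i :: 'a::ring_1))"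
  by (rule sum.mono_neutral_cong_left) (use assms in auto)

lemma additive_span_as_sum:
  assumes "x \<in> additive_span (b ` I)"
  obtains A c where "finite A" "A \<subseteq> I" "x = (\<Sum>i\<in>A. of_int (c i :: int) * b i)"
proof -
  have "\<exists>A c. finite A \<and> A \<subseteq> I \<and> x = (\<Sum>i\<in>A. of_int (c i :: int) * b i)" using assms
  proof induction
    case (base x)
    then obtain i where "i \<in> I" "x = b i" by auto
    thus ?case by (intro exI[of _ "{i}"] exI[of _ "\<lambda>_. 1"]) auto
  next
    case zero
    show ?case by (intro exI[of _ "{}"]) auto
  next
    case (diff x y)
    then obtain A c A' c' where A: "finite A" "A \<subseteq> I" "x = (\<Sum>i\<in>A. of_int (c i :: int) * b i)"
      and A': "finite A'" "A' \<subseteq> I" "y = (\<Sum>i\<in>A'. of_int (c' i :: int) * b i)" by blast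
    let ?c = "\<lambda>i. if i \<in> A then c i else 0" and ?c' = "\<lambda>i. if i \<in> A' then c' i else 0"
    have "x = (\<Sum>i\<in>A \<union> A'. of_int (?c i) * b i)"
      unfolding A by (rule sum_int_pad) (use A A' in auto)
    moreover have "y = (\<Sum>i\<in>A \<union> A'. of_int (?c' i) * b i)"
      unfolding A' by (rule sum_int_pad) (use A A' in auto)
    ultimately have "x - y = (\<Sum>i\<in>A \<union> A'. of_int (?c i - ?c' i) * b i)"
      by (simp only: of_int_diff left_diff_distrib sum_subtractf)
    thus ?case using A(1,2) A'(1,2)
      by (intro exI[of _ "A \<union> A'"] exI[of _ "\<lambda>i. ?c i - ?c' i"]) auto
  qed
  thus ?thesis using that by blast
qed

text \<open>The coefficients that must vanish are integers and not their images in the ring. So the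
  notion also records characteristic zero, which the locales below do not get from a type
  class.\<close>

definition int_independent :: "('i \<Rightarrow> 'a::ring_1) \<Rightarrow> 'i set \<Rightarrow> bool" where
  "int_independent b I \<longleftrightarrow> (\<forall>A c. finite A \<and> A \<subseteq> I \<and> (\<Sum>i\<in>A. of_int (c i) * b i) = 0 \<longrightarrow>
     (\<forall>i\<in>A. c i = (0::int)))"

lemma int_independentI:
  assumes "\<And>A c. finite A \<Longrightarrow> A \<subseteq> I \<Longrightarrow> (\<Sum>i\<in>A. of_int (c i) * b i) = 0 \<Longrightarrow> \<forall>i\<in>A. c i = 0"
  shows "int_independent b I"
  using assms unfolding int_independent_def by blast

lemma int_independentD:
  assumes "int_independent b I" "finite A" "A \<subseteq> I" "(\<Sum>i\<in>A. of_int (c i) * b i) = 0" "i \<in> A"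
  shows "c i = 0"
  using assms unfolding int_independent_def by blast

lemma lin_indep_over_Ints_imp_int_independent:
  fixes b :: "'i \<Rightarrow> 'a::ring_char_0"
  assumes *: "lin_indep_over \<int> b I"
  shows "int_independent b I"
proof (rule int_independentI)
  fix A c assume A: "finite A" "A \<subseteq> I" "(\<Sum>i\<in>A. of_int (c i) * b i) = 0"
  from *[unfolded lin_indep_over_def, rule_format, of A "\<lambda>i. of_int (c i)"] A
  have "\<forall>i\<in>A. of_int (c i) = (0::'a)" by auto
  thus "\<forall>i\<in>A. c i = 0" by simp
qed

text \<open>The universal property of a basis, for additive maps: two representations of one element
  are padded with zeros to a common index set, where independence identifies the coefficients.
  Projections, specialization, bar involution and coefficient sum all come from it.\<close>

lemma int_independent_ext:
  fixes b :: "'i \<Rightarrow> 'a::ring_1" and h :: "'i \<Rightarrow> 'b::ring_1"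
  assumes ind: "int_independent b I"
  obtains F where "\<And>i. i \<in> I \<Longrightarrow> F (b i) = h i"
    "\<And>x y. x \<in> additive_span (b ` I) \<Longrightarrow> y \<in> additive_span (b ` I) \<Longrightarrow> F (x - y) = F x - F y"
proof -
  define P where "P = (\<lambda>x (A, c). finite A \<and> A \<subseteq> I \<and> x = (\<Sum>i\<in>A. of_int (c i :: int) * b i))"
  define F where "F x = (let (A, c) = SOME p. P x p in \<Sum>i\<in>A. of_int (c i) * h i)" for x
  have uniq: "(\<Sum>i\<in>A. of_int (c i) * h i) = (\<Sum>i\<in>A'. of_int (c' i) * h i)"
    if "P x (A, c)" "P x (A', c')" for x A c A' c'
  proof -
    let ?c = "\<lambda>i. if i \<in> A then c i else 0" and ?c' = "\<lambda>i. if i \<in> A' then c' i else 0"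
    have fin: "finite (A \<union> A')" "A \<union> A' \<subseteq> I" using that by (auto simp: P_def)
    have e: "(\<Sum>i\<in>A. of_int (c i) * g i) = (\<Sum>i\<in>A \<union> A'. of_int (?c i) * g i)"
      "(\<Sum>i\<in>A'. of_int (c' i) * g i) = (\<Sum>i\<in>A \<union> A'. of_int (?c' i) * g i)"
      for g :: "'i \<Rightarrow> 'c::ring_1"
      by (rule sum_int_pad; use fin in blast)+
    have "(\<Sum>i\<in>A \<union> A'. of_int (?c i - ?c' i) * b i) =
        (\<Sum>i\<in>A. of_int (c i) * b i) - (\<Sum>i\<in>A'. of_int (c' i) * b i)"
      by (simp only: e of_int_diff left_diff_distrib sum_subtractf)
    also have "\<dots> = 0" using that by (simp add: P_def)
    finally have "?c i - ?c' i = 0" if "i \<in> A \<union> A'" for i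
      using int_independentD[OF ind fin _ that, of "\<lambda>i. ?c i - ?c' i"] by blast
    hence "(\<Sum>i\<in>A \<union> A'. of_int (?c i) * h i) = (\<Sum>i\<in>A \<union> A'. of_int (?c' i) * h i)"
      by (intro sum.cong) auto
    thus ?thesis by (simp only: e)
  qed
  have F: "F x = (\<Sum>i\<in>A. of_int (c i) * h i)" if "P x (A, c)" for x A c
  proof -
    have "P x (SOME p. P x p)" using that by (rule someI)
    thus ?thesis using uniq[OF _ that] unfolding F_def by (auto split: prod.splits)
  qed
  have "F (b i) = h i" if "i \<in> I" for i
    using F[of "b i" "{i}" "\<lambda>_. 1"] that by (simp add: P_def)
  moreover have "F (x - y) = F x - F y"
    if xy: "x \<in> additive_span (b ` I)" "y \<in> additive_span (b ` I)" for x y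
  proof -
    obtain A c where "finite A" "A \<subseteq> I" "x = (\<Sum>i\<in>A. of_int (c i :: int) * b i)"
      using additive_span_as_sum[OF xy(1)] .
    moreover obtain A' c' where "finite A'" "A' \<subseteq> I" "y = (\<Sum>i\<in>A'. of_int (c' i :: int) * b i)"
      using additive_span_as_sum[OF xy(2)] .
    ultimately have A: "P x (A, c)" and A': "P y (A', c')" unfolding P_def by simp_all
    let ?c = "\<lambda>i. if i \<in> A then c i else 0" and ?c' = "\<lambda>i. if i \<in> A' then c' i else 0"
    have fin: "finite (A \<union> A')" "A \<union> A' \<subseteq> I" using A A' by (auto simp: P_def)
    have e: "(\<Sum>i\<in>A. of_int (c i) * g i) = (\<Sum>i\<in>A \<union> A'. of_int (?c i) * g i)"
      "(\<Sum>i\<in>A'. of_int (c' i) * g i) = (\<Sum>i\<in>A \<union> A'. of_int (?c' i) * g i)"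
      for g :: "'i \<Rightarrow> 'c::ring_1"
      by (rule sum_int_pad; use fin in blast)+
    have "x = (\<Sum>i\<in>A. of_int (c i) * b i)" "y = (\<Sum>i\<in>A'. of_int (c' i) * b i)"
      using A A' by (simp_all add: P_def)
    hence "x - y = (\<Sum>i\<in>A \<union> A'. of_int (?c i - ?c' i) * b i)"
      by (simp only: e of_int_diff left_diff_distrib sum_subtractf)
    with fin have "P (x - y) (A \<union> A', \<lambda>i. ?c i - ?c' i)" unfolding P_def by blast
    from F[OF this] F[OF A] F[OF A'] show ?thesis
      by (simp only: e of_int_diff left_diff_distrib sum_subtractf)
  qed
  ultimately show ?thesis using that by blast
qed

section \<open>Ordered monomials and powers of quasi-commuting elements\<close>

lemma ordered_monomial_Suc:
  "ordered_monomial (Suc N) Y u = ordered_monomial N Y u * Y (Suc N) powi u (Suc N)"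
  by (simp add: ordered_monomial_def)

lemma ordered_monomial_0 [simp]: "ordered_monomial 0 Y u = 1"
  by (simp add: ordered_monomial_def)

lemma ordered_monomial_cong:
  "(\<And>i. i \<in> {1..N} \<Longrightarrow> Y i powi u i = Y' i powi u' i) \<Longrightarrow>
    ordered_monomial N Y u = ordered_monomial N Y' u'"
  unfolding ordered_monomial_def by (intro arg_cong[where f = prod_list] map_cong) auto

lemma ordered_monomial_nonzero:
  "(\<And>i. i \<in> {1..N} \<Longrightarrow> Y i \<noteq> 0) \<Longrightarrow> ordered_monomial N Y u \<noteq> 0"
  by (induction N) (auto simp: ordered_monomial_Suc)

lemma ordered_monomial_zero_exp:
  "(\<And>i. i \<in> {1..N} \<Longrightarrow> u i = 0) \<Longrightarrow> ordered_monomial N Y u = 1"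
  by (induction N) (auto simp: ordered_monomial_Suc)

lemma quasi_commute_power:
  fixes x y q :: "'f::division_ring"
  assumes "x * y = q * (y * x)" "\<And>f. q * f = f * q"
  shows "x * y ^ c = q ^ c * (y ^ c * x)"
proof (induction c)
  case (Suc c)
  have cq: "q ^ k * f = f * q ^ k" for k f
    by (rule power_commuting_commutes[of q f k, symmetric, THEN sym]) (rule assms(2))
  have "x * y ^ Suc c = (x * y) * y ^ c" by (simp add: mult.assoc)
  also have "\<dots> = q * (y * (x * y ^ c))" by (simp add: assms mult.assoc)
  also have "\<dots> = q * (y * q ^ c) * (y ^ c * x)" by (simp add: Suc mult.assoc)
  also have "\<dots> = q ^ Suc c * (y ^ Suc c * x)" by (simp add: cq[of c y, symmetric] mult.assoc)
  finally show ?case .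
qed simp

lemma quasi_commute_powi:
  fixes x y q :: "'f::division_ring"
  assumes xy: "x * y = q * (y * x)" and q: "\<And>f. q * f = f * q" and nz: "q \<noteq> 0" "y \<noteq> 0"
  shows "x * y powi c = q powi c * (y powi c * x)"
proof (cases "c \<ge> 0")
  case True
  thus ?thesis using quasi_commute_power[OF xy q, of "nat c"] by (simp add: power_int_def)
next
  case False
  have iq: "inverse q * f = f * inverse q" for f
  proof -
    have "q * (f * inverse q) = f" using nz by (simp add: q[of "f * inverse q"] mult.assoc)
    hence "inverse q * (q * (f * inverse q)) = inverse q * f" by simp
    thus ?thesis using nz by (simp add: mult.assoc[symmetric])
  qed
  have "inverse y * x = inverse y * (x * y) * inverse y" using nz by (simp add: mult.assoc)
  also have "\<dots> = inverse y * q * (y * x) * inverse y" by (simp add: xy mult.assoc)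
  also have "\<dots> = q * (inverse y * (y * x) * inverse y)" by (simp only: q[of "inverse y", symmetric] mult.assoc)
  also have "\<dots> = q * (x * inverse y)" using nz by (simp add: mult.assoc[symmetric])
  finally have "x * inverse y = inverse q * (inverse y * x)" using nz by (simp add: mult.assoc[symmetric])
  thus ?thesis using False quasi_commute_power[OF _ iq, of x "inverse y" "nat (-c)"]
    by (simp add: power_int_def)
qed

lemma quasi_commute_powi_powi:
  fixes x y q :: "'f::division_ring"
  assumes xy: "x * y = q * (y * x)" and q: "\<And>f. q * f = f * q" and nz: "q \<noteq> 0" "x \<noteq> 0" "y \<noteq> 0"
  shows "x powi b * y powi c = q powi (b * c) * (y powi c * x powi b)"
proof -
  let ?p = "q powi c"
  have pn: "p powi k * f = f * p powi k" if "\<And>f. p * f = f * p" "p \<noteq> 0" for p f :: 'f and k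
    using quasi_commute_powi[of f p 1 k] that by simp
  have p: "?p * f = f * ?p" for f using pn[OF q nz(1)] .
  have ip: "inverse ?p * f = f * inverse ?p" for f
    using pn[OF q nz(1), of "-c"] by (simp add: power_int_minus)
  have "x * y powi c = ?p * (y powi c * x)" by (rule quasi_commute_powi[OF xy q nz(1,3)])
  \<comment> \<open>The relation is turned around so that the one-sided rule can raise the other
    factor to a power.\<close>
  hence "y powi c * x = inverse ?p * (x * y powi c)" using nz by (simp add: mult.assoc[symmetric])
  from quasi_commute_powi[OF this ip, of b]
  have "y powi c * x powi b = inverse ?p powi b * (x powi b * y powi c)" using nz by simp
  hence "?p powi b * (y powi c * x powi b) = x powi b * y powi c"
    using nz by (simp add: power_int_inverse mult.assoc[symmetric])
  thus ?thesis by (simp add: power_int_mult[symmetric] mult.commute)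
qed

section \<open>Quantum tori\<close>

text \<open>Brings a bilinear form into the triangular shape in which the normalising prefactor of a
  monomial is written.\<close>

lemma sum_square_eq_triangle:
  fixes f :: "nat \<Rightarrow> nat \<Rightarrow> 'a::comm_monoid_add"
  shows "(\<Sum>j\<in>{1..N}. \<Sum>i\<in>{1..N}. f j i) = (\<Sum>j\<in>{1..N}. (\<Sum>i\<in>{1..<j}. f j i + f i j) + f j j)"
proof (induction N)
  case (Suc N)
  have "{1..<Suc N} = {1..N}" by auto
  thus ?case using Suc by (simp add: sum.distrib ac_simps)
qed simp

definition unit_exp :: "nat \<Rightarrow> nat \<Rightarrow> int" where
  "unit_exp i = (\<lambda>l. if l = i then 1 else 0)"

lemma unit_exp_simps [simp]: "unit_exp i i = 1" "l \<noteq> i \<Longrightarrow> unit_exp i l = 0"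
  by (auto simp: unit_exp_def)

lemma sum_unit_exp:
  assumes "finite A" "k \<in> A"
  shows "(\<Sum>i\<in>A. unit_exp k i * f i) = f k"
proof -
  have "(\<Sum>i\<in>A. unit_exp k i * f i) = (\<Sum>i\<in>A. if i = k then f i else 0)"
    by (rule sum.cong) (auto simp: unit_exp_def)
  thus ?thesis using assms by (simp add: sum.delta)
qed

section \<open>Central Laurent monomials in the square roots of the formal variables\<close>

locale scalars =
  fixes r :: nat and s :: "nat \<Rightarrow> 'f::division_ring"
  assumes s_nonzero: "a \<in> {1..r} \<Longrightarrow> s a \<noteq> 0"
    and s_central: "a \<in> {1..r} \<Longrightarrow> s a * f = f * s a"
    and s_independent: "int_independent (ordered_monomial r s) (exponents r)"
begin

definition S :: "(nat \<Rightarrow> int) \<Rightarrow> 'f" where "S e = ordered_monomial r s e"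

lemma S_cong: "(\<And>a. a \<in> {1..r} \<Longrightarrow> e a = f a) \<Longrightarrow> S e = S f"
  unfolding S_def by (rule ordered_monomial_cong) simp

lemma S_nonzero [simp]: "S e \<noteq> 0"
  unfolding S_def by (rule ordered_monomial_nonzero) (use s_nonzero in auto)

lemma s_powi_central: "a \<in> {1..r} \<Longrightarrow> s a powi c * f = f * s a powi c"
  using quasi_commute_powi[of f "s a" 1 c] s_central s_nonzero by simp

lemma S_central: "S e * f = f * S e"
proof -
  have "N \<le> r \<Longrightarrow> ordered_monomial N s e * f = f * ordered_monomial N s e" for N
  proof (induction N)
    case (Suc N)
    hence "ordered_monomial N s e * f = f * ordered_monomial N s e"
      "s (Suc N) powi e (Suc N) * f = f * s (Suc N) powi e (Suc N)"
      by (auto intro!: s_powi_central)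
    thus ?case by (metis ordered_monomial_Suc mult.assoc)
  qed simp
  thus ?thesis unfolding S_def by simp
qed

lemma S_left_commute: "x * (S e * y) = S e * (x * y)"
  by (metis S_central mult.assoc)

lemma S_add: "S (e + f) = S e * S f"
proof -
  have "N \<le> r \<Longrightarrow> ordered_monomial N s (e + f) = ordered_monomial N s e * ordered_monomial N s f" for N
  proof (induction N)
    case (Suc N)
    let ?x = "s (Suc N) powi e (Suc N)" and ?y = "s (Suc N) powi f (Suc N)"
    have c: "g * ?x = ?x * g" for g using s_powi_central[of "Suc N" "e (Suc N)" g] Suc.prems by simp
    have "ordered_monomial N s e * ?x * (ordered_monomial N s f * ?y) =
       ordered_monomial N s e * ordered_monomial N s f * (?x * ?y)"
      by (simp add: mult.assoc) (metis c mult.assoc)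
    also have "?x * ?y = s (Suc N) powi (e (Suc N) + f (Suc N))"
      using s_nonzero[of "Suc N"] Suc.prems by (simp add: power_int_add)
    finally show ?case using Suc by (simp add: ordered_monomial_Suc)
  qed simp
  thus ?thesis by (simp add: S_def)
qed

lemma S_0 [simp]: "S 0 = 1"
  unfolding S_def by (rule ordered_monomial_zero_exp) simp

lemma S_minus: "S (- e) = inverse (S e)"
  using S_add[of e "- e"] by (simp add: inverse_unique)

lemma S_mult_S: "S e * (S f * x) = S (e + f) * x"
  by (simp add: S_add mult.assoc)

lemma S_scale: "S (\<lambda>a. z * e a) = S e powi z"
proof -
  have *: "S (\<lambda>a. int k * e a) = S e ^ k" for k
  proof (induction k)
    case 0
    show ?case using S_0 by (simp add: zero_fun_def)
  next
    case (Suc k)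
    have "(\<lambda>a. int (Suc k) * e a) = e + (\<lambda>a. int k * e a)" by (auto simp: algebra_simps)
    thus ?case using Suc by (simp add: S_add)
  qed
  show ?thesis
  proof (cases "z \<ge> 0")
    case True
    thus ?thesis using *[of "nat z"] by (simp add: power_int_def)
  next
    case False
    have "(\<lambda>a. z * e a) = - (\<lambda>a. int (nat (- z)) * e a)" using False by (auto simp: fun_eq_iff)
    thus ?thesis using *[of "nat (- z)"] False by (simp add: power_int_def S_minus power_inverse)
  qed
qed

lemma t_monomial_eq_S: "t_monomial r s e = S (e + e)"
proof -
  have "t_monomial r s e = ordered_monomial r s (e + e)"
    unfolding t_monomial_def
    by (rule ordered_monomial_cong)
       (simp only: power_int_power plus_fun_apply of_nat_numeral mult_2)
  thus ?thesis by (simp add: S_def)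
qed

text \<open>Exponents are total functions of which only finitely many coordinates matter, while
  independence is indexed by functions that vanish elsewhere; this is the canonical
  representative.\<close>

definition trim :: "nat \<Rightarrow> (nat \<Rightarrow> int) \<Rightarrow> nat \<Rightarrow> int" where
  "trim N u = (\<lambda>i. if i \<in> {1..N} then u i else 0)"

lemma trim_in_exponents: "trim N u \<in> exponents N"
  by (simp add: trim_def exponents_def)

lemma S_trim: "S (trim r e) = S e"
  by (rule S_cong) (simp add: trim_def)

lemma S_inj:
  assumes "S e = S f" "a \<in> {1..r}"
  shows "e a = f a"
proof (rule ccontr)
  assume "e a \<noteq> f a"
  hence ne: "trim r e \<noteq> trim r f" using assms(2) by (auto simp: trim_def dest!: fun_cong[of _ _ a])
  let ?c = "\<lambda>g. if g = trim r e then 1 else -1 :: int"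
  have "(\<Sum>g\<in>{trim r e, trim r f}. of_int (?c g) * ordered_monomial r s g) = 0"
    using ne assms(1) S_trim[of e] S_trim[of f] by (auto simp: S_def)
  from int_independentD[OF s_independent _ _ this, of "trim r e"] show False
    by (auto simp: trim_in_exponents)
qed

end

section \<open>Normalised monomials of a quasi-commuting family\<close>

locale quasi_torus = scalars r s for r and s :: "nat \<Rightarrow> 'f::division_ring" +
  fixes n :: nat and Y :: "nat \<Rightarrow> 'f" and L :: "nat \<Rightarrow> nat \<Rightarrow> nat \<Rightarrow> int"
  assumes Y_nonzero: "i \<in> {1..n} \<Longrightarrow> Y i \<noteq> 0"
    and Y_quasi_commute: "quasi_commute r n s L Y"
    and L_skew: "a \<in> {1..r} \<Longrightarrow> i \<in> {1..n} \<Longrightarrow> j \<in> {1..n} \<Longrightarrow> L a i j = - L a j i"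
begin

text \<open>The commutation form on exponent vectors. As \<open>t a\<close> is the square of
  \<open>s a\<close>, it gives the exponent of \<open>s a\<close> in the product of two normalised
  monomials; their commutator shows twice that exponent.\<close>

definition lam :: "nat \<Rightarrow> (nat \<Rightarrow> int) \<Rightarrow> (nat \<Rightarrow> int) \<Rightarrow> int" where
  "lam a u v = (\<Sum>i\<in>{1..n}. \<Sum>j\<in>{1..n}. u i * v j * L a i j)"

definition Q :: "(nat \<Rightarrow> int) \<Rightarrow> (nat \<Rightarrow> int) \<Rightarrow> 'f" where
  "Q u v = S (\<lambda>a. lam a u v)"

definition half_exponent :: "(nat \<Rightarrow> int) \<Rightarrow> nat \<Rightarrow> int" where
  "half_exponent u a = (\<Sum>j\<in>{1..n}. \<Sum>i\<in>{1..<j}. u i * u j * L a j i)"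

definition M :: "(nat \<Rightarrow> int) \<Rightarrow> 'f" where
  "M u = S (half_exponent u) * ordered_monomial n Y u"

lemma lam_add_left: "lam a (u + u') v = lam a u v + lam a u' v"
  by (simp add: lam_def algebra_simps sum.distrib)

lemma lam_add_right: "lam a u (v + v') = lam a u v + lam a u v'"
  by (simp add: lam_def algebra_simps sum.distrib)

lemma lam_scale_left: "lam a (\<lambda>i. c * u i) v = c * lam a u v"
  by (simp add: lam_def sum_distrib_left mult.assoc)

lemma lam_scale_right: "lam a u (\<lambda>i. c * v i) = c * lam a u v"
  by (simp add: lam_def sum_distrib_left algebra_simps)

lemma lam_minus_left: "lam a (- u) v = - lam a u v"
  using lam_scale_left[of a "-1" u v] by (simp add: fun_Compl_def)

lemma lam_minus_right: "lam a u (- v) = - lam a u v"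
  using lam_scale_right[of a u "-1" v] by (simp add: fun_Compl_def)

lemma lam_diff_left: "lam a (u - u') v = lam a u v - lam a u' v"
  using lam_add_left[of a u "- u'"] by (simp add: lam_minus_left)

lemma lam_diff_right: "lam a u (v - v') = lam a u v - lam a u v'"
  using lam_add_right[of a u v "- v'"] by (simp add: lam_minus_right)

lemma lam_cong: "(\<And>i. i \<in> {1..n} \<Longrightarrow> u i = u' i) \<Longrightarrow> (\<And>i. i \<in> {1..n} \<Longrightarrow> v i = v' i) \<Longrightarrow>
   lam a u v = lam a u' v'"
  unfolding lam_def by (intro sum.cong) auto

lemma lam_0 [simp]: "lam a 0 v = 0" "lam a u 0 = 0"
  by (simp_all add: lam_def)

lemma lam_skew:
  assumes a: "a \<in> {1..r}"
  shows "lam a v u = - lam a u v"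
proof -
  have "lam a v u = (\<Sum>j\<in>{1..n}. \<Sum>i\<in>{1..n}. v i * u j * L a i j)"
    unfolding lam_def by (rule sum.swap)
  also have "\<dots> = (\<Sum>j\<in>{1..n}. \<Sum>i\<in>{1..n}. - (u j * v i * L a j i))"
  proof (intro sum.cong refl)
    fix i j assume "i \<in> {1..n}" "j \<in> {1..n}"
    from L_skew[OF a this] show "v i * u j * L a i j = - (u j * v i * L a j i)" by simp
  qed
  finally show ?thesis by (simp add: lam_def sum_negf)
qed

lemma lam_self: "a \<in> {1..r} \<Longrightarrow> lam a u u = 0"
  using lam_skew[of a u u] by simp

lemma lam_unit_right:
  assumes "j \<in> {1..n}"
  shows "lam a u (unit_exp j) = (\<Sum>i\<in>{1..n}. u i * L a i j)"
  unfolding lam_def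
proof (rule sum.cong[OF refl])
  fix i
  show "(\<Sum>k\<in>{1..n}. u i * unit_exp j k * L a i k) = u i * L a i j"
    using sum_unit_exp[of "{1..n}" j "\<lambda>k. u i * L a i k"] assms by (simp add: mult_ac)
qed

lemma lam_unit: "i \<in> {1..n} \<Longrightarrow> j \<in> {1..n} \<Longrightarrow> lam a (unit_exp i) (unit_exp j) = L a i j"
  by (simp add: lam_unit_right sum_unit_exp)

lemma lam_expand_right: "lam a u v = (\<Sum>j\<in>{1..n}. v j * lam a u (unit_exp j))"
proof -
  have "(\<Sum>j\<in>{1..n}. v j * lam a u (unit_exp j)) = (\<Sum>j\<in>{1..n}. \<Sum>i\<in>{1..n}. u i * v j * L a i j)"
  proof (rule sum.cong[OF refl])
    fix j assume "j \<in> {1..n}"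
    thus "v j * lam a u (unit_exp j) = (\<Sum>i\<in>{1..n}. u i * v j * L a i j)"
      by (simp only: lam_unit_right sum_distrib_left) (rule sum.cong[OF refl], simp)
  qed
  also have "\<dots> = lam a u v" unfolding lam_def by (rule sum.swap)
  finally show ?thesis ..
qed

lemma Q_nonzero [simp]: "Q u v \<noteq> 0" by (simp add: Q_def)
lemma Q_cong: "(\<And>a. a \<in> {1..r} \<Longrightarrow> lam a u v = lam a u' v') \<Longrightarrow> Q u v = Q u' v'"
  unfolding Q_def by (rule S_cong)

lemma Q_0 [simp]: "Q 0 v = 1" "Q u 0 = 1"
  unfolding Q_def S_0[symmetric] by (rule S_cong, simp)+

lemma Q_minus_right: "Q u (- v) = inverse (Q u v)"
  unfolding Q_def S_minus[symmetric] by (rule S_cong) (simp add: lam_minus_right)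

lemma Q_self [simp]: "Q u u = 1"
  unfolding Q_def S_0[symmetric] by (rule S_cong) (simp add: lam_self)

lemma Y_powi_quasi_commute:
  assumes "i \<in> {1..n}" "j \<in> {1..n}"
  shows "Y i powi b * Y j powi c = S (\<lambda>a. 2 * b * c * L a i j) * (Y j powi c * Y i powi b)"
proof -
  let ?q = "S (\<lambda>a. 2 * L a i j)"
  have "t_monomial r s (\<lambda>a. L a i j) = ?q" unfolding t_monomial_eq_S by (rule S_cong) simp
  moreover have "Y i * Y j = t_monomial r s (\<lambda>a. L a i j) * (Y j * Y i)"
    using Y_quasi_commute assms unfolding quasi_commute_def by blast
  ultimately have "Y i * Y j = ?q * (Y j * Y i)" by simp
  from quasi_commute_powi_powi[OF this S_central S_nonzero] Y_nonzero assms
  have "Y i powi b * Y j powi c = ?q powi (b * c) * (Y j powi c * Y i powi b)" by blast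
  also have "?q powi (b * c) = S (\<lambda>a. 2 * b * c * L a i j)"
    unfolding S_scale[symmetric] by (rule S_cong) simp
  finally show ?thesis .
qed

lemma Y_powi_ordered_monomial:
  assumes "j \<in> {1..n}" "N \<le> n"
  shows "Y j powi b * ordered_monomial N Y v =
    S (\<lambda>a. 2 * b * (\<Sum>i\<in>{1..N}. v i * L a j i)) * (ordered_monomial N Y v * Y j powi b)"
  using assms(2)
proof (induction N)
  case 0
  show ?case using S_0 by (simp add: zero_fun_def)
next
  case (Suc N)
  let ?o = "ordered_monomial N Y v" and ?y = "Y (Suc N) powi v (Suc N)" and ?b = "Y j powi b"
  let ?e = "\<lambda>a. 2 * b * (\<Sum>i\<in>{1..N}. v i * L a j i)" and ?f = "\<lambda>a. 2 * b * v (Suc N) * L a j (Suc N)"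
  have "?b * (?o * ?y) = S ?e * (?o * (?b * ?y))" using Suc by (simp add: mult.assoc[symmetric])
  also have "?b * ?y = S ?f * (?y * ?b)" using Y_powi_quasi_commute[OF assms(1), of "Suc N"] Suc.prems by simp
  also have "S ?e * (?o * (S ?f * (?y * ?b))) = S (?e + ?f) * ((?o * ?y) * ?b)"
    by (simp add: S_left_commute[of ?o] S_mult_S mult.assoc)
  also have "?e + ?f = (\<lambda>a. 2 * b * (\<Sum>i\<in>{1..Suc N}. v i * L a j i))" by (auto simp: algebra_simps)
  finally show ?case by (simp add: ordered_monomial_Suc)
qed

text \<open>Only pairs \<open>i < j\<close> contribute: the last power of the left factor has to
  pass all earlier powers of the right factor.\<close>

lemma ordered_monomial_mult:
  assumes "N \<le> n"
  shows "ordered_monomial N Y u * ordered_monomial N Y v =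
    S (\<lambda>a. 2 * (\<Sum>j\<in>{1..N}. \<Sum>i\<in>{1..<j}. u j * v i * L a j i)) * ordered_monomial N Y (u + v)"
  using assms
proof (induction N)
  case 0
  show ?case using S_0 by (simp add: zero_fun_def)
next
  case (Suc N)
  let ?u = "ordered_monomial N Y u" and ?v = "ordered_monomial N Y v"
  let ?b = "Y (Suc N) powi u (Suc N)" and ?c = "Y (Suc N) powi v (Suc N)"
  let ?e = "\<lambda>a. 2 * (\<Sum>j\<in>{1..N}. \<Sum>i\<in>{1..<j}. u j * v i * L a j i)"
  let ?f = "\<lambda>a. 2 * u (Suc N) * (\<Sum>i\<in>{1..N}. v i * L a (Suc N) i)"
  have "?u * ?b * (?v * ?c) = ?u * (?b * ?v) * ?c" by (simp add: mult.assoc)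
  also have "?b * ?v = S ?f * (?v * ?b)" by (rule Y_powi_ordered_monomial) (use Suc in auto)
  also have "?u * (S ?f * (?v * ?b)) * ?c = S ?f * ((?u * ?v) * (?b * ?c))"
    by (simp add: S_left_commute[of ?u] mult.assoc)
  also have "?u * ?v = S ?e * ordered_monomial N Y (u + v)"
    by (rule Suc.IH) (use Suc.prems in simp)
  also have "?b * ?c = Y (Suc N) powi ((u + v) (Suc N))"
    using Y_nonzero[of "Suc N"] Suc.prems by (simp add: power_int_add)
  also have "S ?f * (S ?e * ordered_monomial N Y (u + v) * Y (Suc N) powi ((u + v) (Suc N))) =
     S (?f + ?e) * ordered_monomial (Suc N) Y (u + v)"
    by (simp add: S_mult_S mult.assoc ordered_monomial_Suc)
  also have "?f + ?e = (\<lambda>a. 2 * (\<Sum>j\<in>{1..Suc N}. \<Sum>i\<in>{1..<j}. u j * v i * L a j i))"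
    by (auto simp: sum_distrib_left algebra_simps atLeastLessThanSuc_atLeastAtMost)
  finally show ?case by (simp add: ordered_monomial_Suc mult.assoc)
qed

text \<open>Reordering costs twice the lower triangle of \<open>u j * v i * L a j i\<close>. Passing
  from the prefactors of \<open>u\<close> and \<open>v\<close> to that of \<open>u + v\<close>
  absorbs the symmetrised triangle, and the skew form \<open>lam a u v\<close> remains.\<close>

lemma M_mult: "M u * M v = Q u v * M (u + v)"
proof -
  let ?e = "\<lambda>a. 2 * (\<Sum>j\<in>{1..n}. \<Sum>i\<in>{1..<j}. u j * v i * L a j i)"
  have "M u * M v = S (half_exponent u) * (S (half_exponent v) * (ordered_monomial n Y u * ordered_monomial n Y v))"
    by (simp add: M_def mult.assoc S_left_commute[of "ordered_monomial n Y u"])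
  also have "\<dots> = S (half_exponent u + half_exponent v + ?e) * ordered_monomial n Y (u + v)"
    by (simp add: ordered_monomial_mult S_mult_S ac_simps)
  also have "S (half_exponent u + half_exponent v + ?e) = S ((\<lambda>a. lam a u v) + half_exponent (u + v))"
  proof (rule S_cong)
    fix a assume a: "a \<in> {1..r}"
    have "lam a u v = (\<Sum>j\<in>{1..n}. (\<Sum>i\<in>{1..<j}. u j * v i * L a j i + u i * v j * L a i j) + u j * v j * L a j j)"
      unfolding lam_def by (rule sum_square_eq_triangle)
    also have "\<dots> = (\<Sum>j\<in>{1..n}. (\<Sum>i\<in>{1..<j}. u j * v i * L a j i - u i * v j * L a j i))"
    proof (rule sum.cong[OF refl])
      fix j assume j: "j \<in> {1..n}"
      hence "L a j j = 0" using L_skew[OF a j j] by simp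
      moreover have "L a i j = - L a j i" if "i \<in> {1..<j}" for i
        using L_skew[OF a _ j, of i] that j by simp
      ultimately show "(\<Sum>i\<in>{1..<j}. u j * v i * L a j i + u i * v j * L a i j) + u j * v j * L a j j =
         (\<Sum>i\<in>{1..<j}. u j * v i * L a j i - u i * v j * L a j i)"
        by (auto intro!: sum.cong)
    qed
    finally show "(half_exponent u + half_exponent v + ?e) a = ((\<lambda>a. lam a u v) + half_exponent (u + v)) a"
      by (simp add: half_exponent_def sum_distrib_left sum.distrib[symmetric] algebra_simps)
  qed
  finally show ?thesis by (simp only: Q_def M_def S_add mult.assoc)
qed

lemma M_cong: "(\<And>i. i \<in> {1..n} \<Longrightarrow> u i = v i) \<Longrightarrow> M u = M v"
  unfolding M_def half_exponent_def
  by (intro arg_cong2[where f = times] S_cong ordered_monomial_cong sum.cong) auto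

lemma M_nonzero [simp]: "M u \<noteq> 0"
  unfolding M_def using ordered_monomial_nonzero[of n Y u] Y_nonzero by simp

lemma M_0 [simp]: "M 0 = 1"
  using S_0 by (simp add: M_def half_exponent_def[abs_def] ordered_monomial_zero_exp zero_fun_def)

lemma M_minus: "M (- u) = inverse (M u)"
  using M_mult[of u "- u"] by (simp add: Q_minus_right inverse_unique)

lemma M_trim: "M (trim n u) = M u"
  by (rule M_cong) (simp add: trim_def)

lemma M_unit: "i \<in> {1..n} \<Longrightarrow> M (unit_exp i) = Y i"
proof -
  assume i: "i \<in> {1..n}"
  have "half_exponent (unit_exp i) = 0"
    unfolding half_exponent_def zero_fun_def
    by (intro ext sum.neutral ballI) (auto simp: unit_exp_def)
  moreover have "ordered_monomial N Y (unit_exp i) = (if i \<in> {1..N} then Y i else 1)" if "1 \<le> i" for N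
    using that by (induction N) (auto simp: ordered_monomial_Suc unit_exp_def le_Suc_eq)
  ultimately show ?thesis using i by (simp add: M_def)
qed

text \<open>The elements of the torus supported on exponents in \<open>U\<close>. Degree conditions
  of every kind become set inclusions, and a product is controlled by sums of supports. Scalars are
  spanned along with the monomials, so the span is over the integers.\<close>

definition V :: "(nat \<Rightarrow> int) set \<Rightarrow> 'f set" where
  "V U = additive_span {S e * M u | e u. u \<in> U}"

lemma V_monomial: "u \<in> U \<Longrightarrow> S e * M u \<in> V U"
  unfolding V_def by (rule additive_span.base) auto

lemma V_M: "u \<in> U \<Longrightarrow> M u \<in> V U"
  using V_monomial[of u U 0] by simp

lemma V_0 [simp]: "0 \<in> V U" unfolding V_def by (rule additive_span.zero)
lemma V_diff: "x \<in> V U \<Longrightarrow> y \<in> V U \<Longrightarrow> x - y \<in> V U" unfolding V_def by (rule additive_span.diff)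
lemma V_add: "x \<in> V U \<Longrightarrow> y \<in> V U \<Longrightarrow> x + y \<in> V U" unfolding V_def by (rule additive_span_add)
lemma V_uminus: "x \<in> V U \<Longrightarrow> - x \<in> V U" unfolding V_def by (rule additive_span_uminus)
lemma V_sum: "(\<And>i. i \<in> A \<Longrightarrow> f i \<in> V U) \<Longrightarrow> sum f A \<in> V U" unfolding V_def by (rule additive_span_sum)
lemma V_mono: "U \<subseteq> W \<Longrightarrow> V U \<subseteq> V W" unfolding V_def by (rule additive_span_mono) auto
lemma V_mono': "x \<in> V U \<Longrightarrow> U \<subseteq> W \<Longrightarrow> x \<in> V W" using V_mono by blast

lemma V_UNIV: "x \<in> V U \<Longrightarrow> x \<in> V UNIV" using V_mono[of U UNIV] by blast

lemma V_induct [consumes 1, case_names zero monomial diff]: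
  assumes "x \<in> V U" "P 0" "\<And>e u. u \<in> U \<Longrightarrow> P (S e * M u)"
    "\<And>x y. x \<in> V U \<Longrightarrow> y \<in> V U \<Longrightarrow> P x \<Longrightarrow> P y \<Longrightarrow> P (x - y)"
  shows "P x"
  using assms(1) unfolding V_def
  by (induction rule: additive_span.induct) (use assms(2-4)[unfolded V_def] in auto)

lemma V_mult:
  assumes x: "x \<in> V U" and y: "y \<in> V W" and UW: "\<And>u w. u \<in> U \<Longrightarrow> w \<in> W \<Longrightarrow> u + w \<in> Z"
  shows "x * y \<in> V Z"
  using x
proof (induction rule: V_induct)
  case (monomial e u)
  from y show ?case
  proof (induction rule: V_induct)
    case (monomial f w)
    have "S e * M u * (S f * M w) = S e * (S f * (M u * M w))" by (simp add: S_left_commute[of "M u"] mult.assoc)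
    also have "\<dots> = S (e + f + (\<lambda>a. lam a u w)) * M (u + w)"
      by (simp add: M_mult Q_def S_mult_S add.assoc)
    finally show ?case using UW monomial \<open>u \<in> U\<close> by (simp add: V_monomial)
  qed (auto simp: right_diff_distrib intro: V_diff)
qed (auto simp: left_diff_distrib intro: V_diff)

lemma V_S_mult: "x \<in> V U \<Longrightarrow> S e * x \<in> V U"
  by (induction rule: V_induct) (auto simp: S_mult_S right_diff_distrib intro: V_diff V_monomial)

lemma V_1: "0 \<in> U \<Longrightarrow> 1 \<in> V U" using V_M[of 0 U] by simp

lemma V_split:
  assumes "x \<in> V U"
  obtains y z where "y \<in> V (U \<inter> W)" "z \<in> V (U - W)" "x = y + z"
proof -
  have "\<exists>y\<in>V (U \<inter> W). \<exists>z\<in>V (U - W). x = y + z" using assms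
  proof (induction rule: V_induct)
    case zero
    show ?case by (intro bexI[of _ 0]) auto
  next
    case (monomial e u)
    show ?case
    proof (cases "u \<in> W")
      case True
      thus ?thesis using monomial by (intro bexI[of _ "S e * M u"] bexI[of _ 0]) (auto intro: V_monomial)
    next
      case False
      thus ?thesis using monomial by (intro bexI[of _ 0] bexI[of _ "S e * M u"]) (auto intro: V_monomial)
    qed
  next
    case (diff x y)
    then obtain a b c d where "a \<in> V (U \<inter> W)" "b \<in> V (U - W)" "x = a + b"
      "c \<in> V (U \<inter> W)" "d \<in> V (U - W)" "y = c + d" by blast
    thus ?case by (intro bexI[of _ "a - c"] bexI[of _ "b - d"]) (auto intro: V_diff)
  qed
  thus ?thesis using that by blast
qed

lemma V_empty [simp]: "V {} = {0}"
proof -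
  have "x = 0" if "x \<in> V {}" for x using that by (induction rule: V_induct) auto
  thus ?thesis by auto
qed

text \<open>\<open>M\<close> sees only the coordinates from 1 to \<open>n\<close>, so cutting an
  element down to the exponents in \<open>U\<close> is meaningful only for such
  \<open>U\<close>.\<close>

definition determined :: "(nat \<Rightarrow> int) set \<Rightarrow> bool" where
  "determined U \<longleftrightarrow> (\<forall>u v. (\<forall>i\<in>{1..n}. u i = v i) \<longrightarrow> u \<in> U \<longrightarrow> v \<in> U)"

lemma determinedD: "determined U \<Longrightarrow> u \<in> U \<Longrightarrow> (\<And>i. i \<in> {1..n} \<Longrightarrow> u i = v i) \<Longrightarrow> v \<in> U"
  unfolding determined_def by blast

lemma determined_trim: "determined U \<Longrightarrow> trim n u \<in> U \<longleftrightarrow> u \<in> U"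
  using determinedD[of U "trim n u" u] determinedD[of U u "trim n u"] by (auto simp: trim_def)

end

section \<open>Additive maps prescribed on the monomial basis\<close>

locale quantum_frame = quasi_torus +
  assumes independent: "int_independent (\<lambda>(e, u). S e * M u) (exponents r \<times> exponents n)"
begin

lemma V_ext:
  fixes h :: "(nat \<Rightarrow> int) \<Rightarrow> (nat \<Rightarrow> int) \<Rightarrow> 'b::ring_1"
  assumes "\<And>e u. h (trim r e) (trim n u) = h e u"
  obtains F where "\<And>e u. F (S e * M u) = h e u" "F 0 = 0"
    "\<And>x y. x \<in> V UNIV \<Longrightarrow> y \<in> V UNIV \<Longrightarrow> F (x - y) = F x - F y"
    "\<And>x y. x \<in> V UNIV \<Longrightarrow> y \<in> V UNIV \<Longrightarrow> F (x + y) = F x + F y"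
proof -
  let ?b = "\<lambda>(e, u). S e * M u" and ?I = "exponents r \<times> exponents n"
  obtain F where F: "\<And>i. i \<in> ?I \<Longrightarrow> F (?b i) = case_prod h i"
    and add: "\<And>x y. x \<in> additive_span (?b ` ?I) \<Longrightarrow> y \<in> additive_span (?b ` ?I) \<Longrightarrow> F (x - y) = F x - F y"
    by (rule int_independent_ext[OF independent, of "case_prod h"]) blast
  have sub: "V UNIV \<subseteq> additive_span (?b ` ?I)" unfolding V_def
  proof (rule additive_span_mono, clarify)
    fix e u
    show "S e * M u \<in> ?b ` ?I"
      by (rule image_eqI[of _ _ "(trim r e, trim n u)"]) (simp_all add: S_trim M_trim trim_in_exponents)
  qed
  have 1: "F (S e * M u) = h e u" for e u
    using F[of "(trim r e, trim n u)"] assms by (simp add: S_trim M_trim trim_in_exponents)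
  have 2: "F (x - y) = F x - F y" if "x \<in> V UNIV" "y \<in> V UNIV" for x y
    using add that sub by blast
  have 3: "F 0 = 0" using 2[of 0 0] by simp
  have "F (x + y) = F x + F y" if "x \<in> V UNIV" "y \<in> V UNIV" for x y
    using 2[of x "- y"] 2[of 0 y] 3 that by (simp add: V_uminus)
  with 1 2 3 show ?thesis using that by blast
qed

text \<open>Meaningful only on \<open>V UNIV\<close>, and only if \<open>h\<close> respects
  \<open>trim\<close>, since different exponent functions may give the same monomial.\<close>

definition ext :: "((nat \<Rightarrow> int) \<Rightarrow> (nat \<Rightarrow> int) \<Rightarrow> 'b::ring_1) \<Rightarrow> 'a \<Rightarrow> 'b" where
  "ext h = (SOME F. (\<forall>e u. F (S e * M u) = h e u) \<and> F 0 = 0 \<and>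
     (\<forall>x\<in>V UNIV. \<forall>y\<in>V UNIV. F (x - y) = F x - F y \<and> F (x + y) = F x + F y))"

lemma ext_props:
  fixes h :: "(nat \<Rightarrow> int) \<Rightarrow> (nat \<Rightarrow> int) \<Rightarrow> 'b::ring_1"
  assumes h: "\<And>e u. h (trim r e) (trim n u) = h e u"
  shows "ext h (S e * M u) = h e u" "ext h 0 = 0"
    "x \<in> V UNIV \<Longrightarrow> y \<in> V UNIV \<Longrightarrow> ext h (x - y) = ext h x - ext h y"
    "x \<in> V UNIV \<Longrightarrow> y \<in> V UNIV \<Longrightarrow> ext h (x + y) = ext h x + ext h y"
proof -
  have "\<exists>F. (\<forall>e u. F (S e * M u) = h e u) \<and> F 0 = 0 \<and>
     (\<forall>x\<in>V UNIV. \<forall>y\<in>V UNIV. F (x - y) = F x - F y \<and> F (x + y) = F x + F y)"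
    by (rule V_ext[of h, OF h]) blast
  from someI_ex[OF this, folded ext_def]
  show "ext h (S e * M u) = h e u" "ext h 0 = 0"
    "x \<in> V UNIV \<Longrightarrow> y \<in> V UNIV \<Longrightarrow> ext h (x - y) = ext h x - ext h y"
    "x \<in> V UNIV \<Longrightarrow> y \<in> V UNIV \<Longrightarrow> ext h (x + y) = ext h x + ext h y" by auto
qed

text \<open>The projection to exponents in \<open>W\<close>, built with \<open>ext\<close>, maps
  \<open>V U\<close> into the span of the intersection and fixes every element of
  \<open>V W\<close>.\<close>

lemma V_Int:
  assumes "x \<in> V U" "x \<in> V W" "determined W"
  shows "x \<in> V (U \<inter> W)"
proof -
  let ?h = "\<lambda>e u. if u \<in> W then S e * M u else 0"
  have h: "?h (trim r e) (trim n u) = ?h e u" for e u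
    using determined_trim[OF assms(3)] by (simp add: S_trim M_trim)
  let ?F = "ext ?h"
  note F = ext_props(1,2)[of ?h, OF h] and add = ext_props(3)[of ?h, OF h]
  have "?F x \<in> V (U \<inter> W)" using assms(1)
  proof (induction rule: V_induct)
    case (diff x y)
    thus ?case by (simp add: add[OF V_UNIV V_UNIV] V_diff)
  qed (auto simp: F intro: V_monomial)
  moreover have "?F x = x" using assms(2)
  proof (induction rule: V_induct)
    case (diff x y)
    thus ?case by (simp add: add[OF V_UNIV V_UNIV])
  qed (auto simp: F)
  ultimately show ?thesis by simp
qed

lemma V_disjoint: "x \<in> V U \<Longrightarrow> x \<in> V W \<Longrightarrow> determined W \<Longrightarrow> U \<inter> W = {} \<Longrightarrow> x = 0"
  using V_Int[of x U W] by simp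

end

section \<open>Gradings and mutation\<close>

context quasi_torus
begin

definition grading :: "((nat \<Rightarrow> int) \<Rightarrow> int) \<Rightarrow> bool" where
  "grading l \<longleftrightarrow> (\<forall>u v. l (u + v) = l u + l v) \<and> (\<forall>u v. (\<forall>i\<in>{1..n}. u i = v i) \<longrightarrow> l u = l v)"

lemma grading_add: "grading l \<Longrightarrow> l (u + v) = l u + l v" by (simp add: grading_def)
lemma grading_0: "grading l \<Longrightarrow> l 0 = 0" using grading_add[of l 0 0] by simp
lemma grading_diff: "grading l \<Longrightarrow> l (u - v) = l u - l v" using grading_add[of l "u - v" v] by simp
lemma grading_minus: "grading l \<Longrightarrow> grading (\<lambda>u. - l u)" by (auto simp: grading_def)
lemma grading_coordinate: "j \<in> {1..n} \<Longrightarrow> grading (\<lambda>u. u j)" by (auto simp: grading_def)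
lemma grading_lam: "grading (\<lambda>u. lam a u v)"
  unfolding grading_def by (auto simp: lam_add_left intro: lam_cong)

lemma determined_Collect: "grading l \<Longrightarrow> determined {u. P (l u)}"
  unfolding determined_def grading_def by (metis (mono_tags, lifting) mem_Collect_eq)

lemma V_bounded:
  assumes "x \<in> V U"
  obtains N :: int where "N \<ge> 0" "x \<in> V (U \<inter> {u. - N \<le> l u \<and> l u \<le> N})"
proof -
  have "\<exists>N::int. N \<ge> 0 \<and> x \<in> V (U \<inter> {u. - N \<le> l u \<and> l u \<le> N})" using assms
  proof (induction rule: V_induct)
    case (monomial e u)
    thus ?case by (intro exI[of _ "\<bar>l u\<bar>"]) (auto intro!: V_monomial)
  next
    case (diff x y)
    then obtain N N' where "N \<ge> 0" "x \<in> V (U \<inter> {u. - N \<le> l u \<and> l u \<le> N})"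
      "N' \<ge> 0" "y \<in> V (U \<inter> {u. - N' \<le> l u \<and> l u \<le> N'})" by blast
    thus ?case
      by (intro exI[of _ "max N N'"] conjI V_diff) (auto elim!: V_mono')
  qed (auto intro: exI[of _ 0])
  thus ?thesis using that by blast
qed

lemma V_top:
  assumes "x \<in> V U" "x \<noteq> 0"
  obtains d y z where "y \<in> V (U \<inter> {u. l u = d})" "y \<noteq> 0" "z \<in> V (U \<inter> {u. l u < (d::int)})" "x = y + z"
proof -
  obtain N where N: "N \<ge> 0" "x \<in> V (U \<inter> {u. - N \<le> l u \<and> l u \<le> N})" using V_bounded[OF assms(1)] .
  \<comment> \<open>Induction on the number \<open>K\<close> of levels that the support may occupy
    from \<open>- N\<close> upwards; an empty top level shortens the window.\<close>
  have "\<exists>d y z. y \<in> V (U \<inter> {u. l u = d}) \<and> y \<noteq> 0 \<and> z \<in> V (U \<inter> {u. l u < d}) \<and> x = y + z"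
    if "x \<in> V (U \<inter> {u. - N \<le> l u \<and> l u < int K - N})" "x \<noteq> 0" for K
    using that
  proof (induction K)
    case 0
    have "U \<inter> {u. - N \<le> l u \<and> l u < int 0 - N} = {}" by auto
    with 0 have "x \<in> V {}" by metis
    thus ?case using 0 by simp
  next
    case (Suc K)
    obtain y z where yz: "y \<in> V ((U \<inter> {u. - N \<le> l u \<and> l u < int (Suc K) - N}) \<inter> {u. l u = int K - N})"
      "z \<in> V ((U \<inter> {u. - N \<le> l u \<and> l u < int (Suc K) - N}) - {u. l u = int K - N})" "x = y + z"
      using V_split[OF Suc.prems(1)] .
    have z: "z \<in> V (U \<inter> {u. - N \<le> l u \<and> l u < int K - N})" using yz(2) by (rule V_mono') auto
    show ?case
    proof (cases "y = 0")
      case True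
      thus ?thesis using Suc.IH z yz(3) Suc.prems(2) by simp
    next
      case False
      thus ?thesis using yz z
        by (intro exI[of _ "int K - N"] exI[of _ y] exI[of _ z]) (auto elim!: V_mono')
    qed
  qed
  moreover have "x \<in> V (U \<inter> {u. - N \<le> l u \<and> l u < int (nat (2 * N + 1)) - N})"
    using N(2) by (rule V_mono') (use N(1) in auto)
  ultimately show ?thesis using assms(2) that by blast
qed

lemma V_mult_level:
  "grading l \<Longrightarrow> x \<in> V {u. l u = d} \<Longrightarrow> y \<in> V {u. l u = e} \<Longrightarrow> x * y \<in> V {u. l u = d + e}"
  by (erule (1) V_mult) (auto simp: grading_add)

lemma V_power_level:
  assumes "grading l" "x \<in> V {u. l u = d}"
  shows "x ^ q \<in> V {u. l u = int q * d}"
proof (induction q)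
  case 0
  show ?case using V_1[of "{u. l u = 0}"] grading_0[OF assms(1)] by simp
next
  case (Suc q)
  show ?case using V_mult_level[OF assms Suc] by (simp add: algebra_simps)
qed

text \<open>The form is alternating, so powers of one monomial need no correcting scalar.\<close>

lemma M_scale: "M (\<lambda>i. c * u i) = M u powi c"
proof -
  have *: "M (\<lambda>i. int q * u i) = M u ^ q" for q
  proof (induction q)
    case 0
    show ?case using M_0 by (simp add: zero_fun_def)
  next
    case (Suc q)
    let ?w = "\<lambda>i. int q * u i"
    have "Q u ?w = Q u u" by (rule Q_cong) (simp add: lam_scale_right lam_self)
    hence "M (u + ?w) = M u * M ?w" by (simp only: M_mult Q_self mult_1_left)
    moreover have "(\<lambda>i. int (Suc q) * u i) = u + ?w" by (auto simp: algebra_simps)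
    ultimately show ?case using Suc by (simp only: power_Suc)
  qed
  show ?thesis
  proof (cases "c \<ge> 0")
    case True
    thus ?thesis using *[of "nat c"] by (simp add: power_int_def)
  next
    case False
    have "(\<lambda>i. c * u i) = - (\<lambda>i. int (nat (- c)) * u i)" using False by (auto simp: fun_eq_iff)
    thus ?thesis using *[of "nat (- c)"] False by (simp add: power_int_def M_minus power_inverse)
  qed
qed

lemma M_quasi_commute: "M u * M v = S (\<lambda>a. 2 * lam a u v) * (M v * M u)"
proof -
  have "S (\<lambda>a. 2 * lam a u v) * (M v * M u) = S (\<lambda>a. 2 * lam a u v) * Q v u * M (u + v)"
    by (simp only: M_mult mult.assoc add.commute)
  also have "S (\<lambda>a. 2 * lam a u v) * Q v u = Q u v"
    unfolding Q_def S_add[symmetric] by (rule S_cong) (simp add: lam_skew[of _ u v])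
  finally show ?thesis by (simp only: M_mult)
qed

end

context quantum_frame
begin

lemma V_level_disjoint:
  assumes "grading l" "x \<in> V {u. l u = d}" "x \<in> V U" "\<And>u. u \<in> U \<Longrightarrow> l u \<noteq> d"
  shows "x = 0"
  using V_disjoint[OF assms(3,2)] determined_Collect[OF assms(1), of "\<lambda>x. x = d"] assms(4) by blast

text \<open>Otherwise the higher of the two tops would equal an element of strictly lower
  degree.\<close>

lemma V_top_unique:
  assumes l: "grading l" and eq: "y + z = y' + z'"
    and "y \<in> V {u. l u = d}" "z \<in> V {u. l u < d}" "y' \<in> V {u. l u = d'}" "z' \<in> V {u. l u < d'}"
    and "y \<noteq> 0" "y' \<noteq> 0"
  shows "d = d'" "y = y'"
proof -
  have *: "d \<ge> d'" if "y + z = y' + z'"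
    "y \<in> V {u. l u = d}" "z \<in> V {u. l u < d}" "y' \<in> V {u. l u = d'}" "z' \<in> V {u. l u < d'}" "y' \<noteq> 0"
    for y z y' z' d d'
  proof (rule ccontr)
    assume "\<not> d \<ge> d'"
    hence "y + z - z' \<in> V {u. l u < d'}"
      using that by (intro V_diff V_add) (auto elim!: V_mono')
    moreover have "y + z - z' = y'" using that by simp
    ultimately have "y' = 0"
      using V_level_disjoint[OF l that(4), of "{u. l u < d'}"] by auto
    thus False using that by simp
  qed
  show d: "d = d'" using *[OF assms(2-6,8)] *[OF assms(2)[symmetric] assms(5,6,3,4,7)] by simp
  have 1: "y - y' \<in> V {u. l u = d}" using assms d by (auto intro: V_diff)
  have "y - y' = z' - z" using eq by (simp add: algebra_simps)
  moreover have "z' - z \<in> V {u. l u < d}" using assms d by (auto intro: V_diff)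
  ultimately have "y - y' = 0"
    using V_level_disjoint[OF l 1, of "{u. l u < d}"] by auto
  thus "y = y'" by simp
qed

lemma V_homogeneous_sum_zero:
  assumes l: "grading l" and "finite A" and x: "\<And>d. d \<in> A \<Longrightarrow> x d \<in> V {u. l u = d}"
    and "(\<Sum>d\<in>A. x d) = 0" "d \<in> A"
  shows "x d = 0"
proof -
  have "(\<Sum>d\<in>A. x d) = x d + (\<Sum>c\<in>A-{d}. x c)" using assms by (simp add: sum.remove)
  hence "x d = - (\<Sum>c\<in>A-{d}. x c)" using assms(4) by (simp add: eq_neg_iff_add_eq_0)
  also have "\<dots> \<in> V {u. l u \<noteq> d}"
    by (intro V_uminus V_sum) (rule V_mono'[OF x], auto)
  finally have "x d \<in> V {u. l u \<noteq> d}" .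
  thus ?thesis by (rule V_level_disjoint[OF l x[OF assms(5)]]) simp
qed

text \<open>The additive map sending every basis element to 1 takes the value 2 here, also when both
  monomials coincide.\<close>

lemma M_add_M_nonzero: "M u + M v \<noteq> 0"
proof -
  obtain F :: "'a \<Rightarrow> int" where F: "\<And>e u. F (S e * M u) = 1" "F 0 = 0"
    "\<And>x y. x \<in> V UNIV \<Longrightarrow> y \<in> V UNIV \<Longrightarrow> F (x + y) = F x + F y"
    by (rule V_ext[of "\<lambda>_ _. 1"]) auto
  have "F (M u + M v) = F (S 0 * M u) + F (S 0 * M v)" using F(3)[of "M u" "M v"] by (simp add: V_M)
  thus ?thesis unfolding F(1) using F(2) by auto
qed

end

section \<open>Seeds with a compatible exchange matrix\<close>

locale seed_frame = quantum_frame +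
  fixes m :: nat and B :: "nat \<Rightarrow> nat \<Rightarrow> int" and D :: "nat \<Rightarrow> nat \<Rightarrow> int"
  assumes m_le_n: "m \<le> n"
    and B_skew: "i \<in> {1..m} \<Longrightarrow> j \<in> {1..m} \<Longrightarrow> B i j = - B j i"
    and compatible: "a \<in> {1..r} \<Longrightarrow> j \<in> {1..m} \<Longrightarrow> i \<in> {1..n} \<Longrightarrow>
      (\<Sum>l\<in>{1..n}. B l j * L a l i) = (if i = j then D a j else 0)"
    and D_nonzero: "a \<in> {1..r} \<Longrightarrow> j \<in> {1..m} \<Longrightarrow> D a j \<noteq> 0"
begin

definition col :: "nat \<Rightarrow> nat \<Rightarrow> int" where "col j = (\<lambda>i. B i j)"

text \<open>\<open>gp k\<close> and \<open>gn k\<close> are the exponents of the two terms of the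
  exchange relation after division by \<open>Y k\<close>. They differ by the column
  \<open>k\<close>, so compatibility controls their difference.\<close>

definition gp :: "nat \<Rightarrow> nat \<Rightarrow> int" where "gp k = positive_column k B - unit_exp k"
definition gn :: "nat \<Rightarrow> nat \<Rightarrow> int" where "gn k = negative_column k B - unit_exp k"

lemma col_pos_neg: "col k = positive_column k B - negative_column k B"
  by (auto simp: col_def positive_column_def negative_column_def)

lemma gp_diff_gn: "gp k - gn k = col k"
  by (simp add: gp_def gn_def col_pos_neg)

lemma B_diag: "j \<in> {1..m} \<Longrightarrow> B j j = 0"
  using B_skew[of j j] by simp

text \<open>Compatibility extended by linearity: the monomial of column \<open>j\<close> commutes
  with every variable except \<open>Y j\<close>.\<close>

lemma lam_col:
  assumes "a \<in> {1..r}" "j \<in> {1..m}"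
  shows "lam a (col j) v = D a j * v j"
proof -
  have "lam a (col j) v = (\<Sum>i\<in>{1..n}. v i * lam a (col j) (unit_exp i))" by (rule lam_expand_right)
  also have "\<dots> = (\<Sum>i\<in>{1..n}. unit_exp j i * (D a i * v i))"
  proof (rule sum.cong[OF refl])
    fix i assume i: "i \<in> {1..n}"
    have "lam a (col j) (unit_exp i) = (if i = j then D a j else 0)"
      by (simp only: lam_unit_right[OF i] col_def compatible[OF assms i])
    thus "v i * lam a (col j) (unit_exp i) = unit_exp j i * (D a i * v i)" by (simp add: unit_exp_def)
  qed
  also have "\<dots> = D a j * v j" by (rule sum_unit_exp) (use assms m_le_n in auto)
  finally show ?thesis .
qed

text \<open>The two sides differ by \<open>lam a (col k) v\<close>, a multiple of
  \<open>v k\<close>. This is why the sum of the two exchange terms still quasi-commutes with the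
  remaining variables.\<close>

lemma lam_gp_gn:
  assumes "a \<in> {1..r}" "k \<in> {1..m}" "v k = 0"
  shows "lam a (gn k) v = lam a (gp k) v"
proof -
  have "lam a (gp k) v - lam a (gn k) v = lam a (col k) v"
    by (simp only: lam_diff_left[symmetric] gp_diff_gn)
  thus ?thesis using lam_col[OF assms(1,2)] assms(3) by simp
qed

text \<open>Evaluate the skew form on two columns. So the diagonal agrees at mutable indices joined
  by a nonzero entry of \<open>B\<close>, which lets mutation keep the same
  \<open>D\<close>.\<close>

lemma D_symmetrizer:
  assumes "a \<in> {1..r}" "i \<in> {1..m}" "j \<in> {1..m}"
  shows "D a i * B i j = D a j * B i j"
proof -
  have "lam a (col j) (col i) = - lam a (col i) (col j)" by (rule lam_skew) fact
  hence "D a j * B j i = - (D a i * B i j)" using assms by (simp add: lam_col) (simp add: col_def)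
  thus ?thesis using B_skew[OF assms(2,3)] by auto
qed

end

section \<open>One mutation step\<close>

locale mutation = seed_frame +
  fixes k :: nat
  assumes k: "k \<in> {1..m}"
begin

lemma k_n: "k \<in> {1..n}" using k m_le_n by auto

lemma positive_column_k [simp]: "positive_column k B k = 0"
  and negative_column_k [simp]: "negative_column k B k = 0"
  and gp_k [simp]: "gp k k = -1" and gn_k [simp]: "gn k k = -1"
  using B_diag[OF k] by (auto simp: positive_column_def negative_column_def gp_def gn_def)

definition Yk' where "Yk' = M (gp k) + M (gn k)"
definition Y' where "Y' = Y(k := Yk')"

text \<open>The linear change of exponents that puts the term \<open>gp k\<close> in place of the
  new variable. Choosing \<open>gn k\<close> instead would give the same commutation exponents, by
  \<open>lam_gp_gn\<close>.\<close>

definition E :: "(nat \<Rightarrow> int) \<Rightarrow> nat \<Rightarrow> int" where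
  "E u = u(k := 0) + (\<lambda>i. u k * gp k i)"

definition L' where "L' a i j = lam a (E (unit_exp i)) (E (unit_exp j))"

lemma E_fixed: "u k = 0 \<Longrightarrow> E u = u"
  by (auto simp: E_def)

lemma E_unit [simp]: "E (unit_exp k) = gp k"
  by (auto simp: E_def unit_exp_def fun_eq_iff)

lemma Yk'_nonzero: "Yk' \<noteq> 0" unfolding Yk'_def by (rule M_add_M_nonzero)

lemma Yk'_quasi_commute:
  assumes "v k = 0"
  shows "Yk' * M v = S (\<lambda>a. 2 * lam a (gp k) v) * (M v * Yk')"
proof -
  have "S (\<lambda>a. 2 * lam a (gn k) v) = S (\<lambda>a. 2 * lam a (gp k) v)"
    by (rule S_cong) (simp add: lam_gp_gn[OF _ k, of _ v] assms)
  thus ?thesis unfolding Yk'_def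
    by (simp only: distrib_left distrib_right M_quasi_commute[of _ v] )
qed

lemma L'_fixed: "i \<in> {1..n} \<Longrightarrow> j \<in> {1..n} \<Longrightarrow> i \<noteq> k \<Longrightarrow> j \<noteq> k \<Longrightarrow> L' a i j = L a i j"
  by (simp add: L'_def E_fixed lam_unit)

sublocale mu: quasi_torus r s n Y' L'
proof
  show "Y' i \<noteq> 0" if "i \<in> {1..n}" for i
    using that Y_nonzero Yk'_nonzero by (simp add: Y'_def)
  show "L' a i j = - L' a j i" if "a \<in> {1..r}" for a i j
    unfolding L'_def by (rule lam_skew) fact
  show "quasi_commute r n s L' Y'" unfolding quasi_commute_def
  proof (intro ballI)
    fix i j assume ij: "i \<in> {1..n}" "j \<in> {1..n}"
    have t: "t_monomial r s (\<lambda>a. L' a i j) = S (\<lambda>a. 2 * L' a i j)"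
      unfolding t_monomial_eq_S by (rule S_cong) simp
    have YM: "Y' i = M (unit_exp i)" if "i \<noteq> k" "i \<in> {1..n}" for i
      using that M_unit by (simp add: Y'_def)
    consider "i \<noteq> k" "j \<noteq> k" | "i = k" "j \<noteq> k" | "i \<noteq> k" "j = k" | "i = k" "j = k" by blast
    hence "Y' i * Y' j = S (\<lambda>a. 2 * L' a i j) * (Y' j * Y' i)"
    proof cases
      case 1
      thus ?thesis using M_quasi_commute[of "unit_exp i" "unit_exp j"] ij
        by (simp add: YM L'_def E_fixed)
    next
      case 2
      thus ?thesis using Yk'_quasi_commute[of "unit_exp j"] ij
        by (simp add: YM L'_def E_fixed) (simp add: Y'_def)
    next
      case 3
      have "S (\<lambda>a. 2 * L' a i j) * (Yk' * M (unit_exp i)) =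
          S ((\<lambda>a. 2 * L' a i j) + (\<lambda>a. 2 * lam a (gp k) (unit_exp i))) * (M (unit_exp i) * Yk')"
        using 3 by (simp only: Yk'_quasi_commute[of "unit_exp i"] S_mult_S unit_exp_simps)
      also have "S ((\<lambda>a. 2 * L' a i j) + (\<lambda>a. 2 * lam a (gp k) (unit_exp i))) = S 0"
        by (rule S_cong) (use 3 in \<open>simp add: L'_def E_fixed lam_skew[of _ "gp k" "unit_exp i"]\<close>)
      finally show ?thesis using 3 ij by (simp add: YM) (simp add: Y'_def)
    next
      case 4
      have "S (\<lambda>a. 2 * L' a k k) = S 0" by (rule S_cong) (simp add: L'_def lam_self)
      thus ?thesis using 4 by simp
    qed
    thus "Y' i * Y' j = t_monomial r s (\<lambda>a. L' a i j) * (Y' j * Y' i)" by (simp only: t)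
  qed
qed

lemma mu_M_fixed: "u k = 0 \<Longrightarrow> mu.M u = M u"
proof -
  assume u: "u k = 0"
  have "S (mu.half_exponent u) = S (half_exponent u)"
  proof (rule S_cong)
    fix a
    show "mu.half_exponent u a = half_exponent u a"
      unfolding mu.half_exponent_def half_exponent_def
    proof (intro sum.cong refl)
      fix i j assume "j \<in> {1..n}" "i \<in> {1..<j}"
      thus "u i * u j * L' a j i = u i * u j * L a j i"
        using u L'_fixed[of j i a] by (cases "i = k"; cases "j = k") auto
    qed
  qed
  moreover have "ordered_monomial n Y' u = ordered_monomial n Y u"
    by (rule ordered_monomial_cong) (use u in \<open>auto simp: Y'_def\<close>)
  ultimately show ?thesis by (simp add: mu.M_def M_def)
qed

lemma mu_M_unit: "mu.M (unit_exp k) = Yk'"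
  using mu.M_unit[OF k_n] by (simp add: Y'_def)

lemma lam_expand_E: "lam a (E u) w = (\<Sum>i\<in>{1..n}. u i * lam a (E (unit_exp i)) w)"
proof -
  have ex: "lam a v w = (\<Sum>i\<in>{1..n}. v i * lam a (unit_exp i) w)" for v
  proof -
    have "lam a (unit_exp i) w = (\<Sum>j\<in>{1..n}. w j * L a i j)" if "i \<in> {1..n}" for i
      by (subst lam_expand_right) (use that in \<open>simp add: lam_unit\<close>)
    hence "(\<Sum>i\<in>{1..n}. v i * lam a (unit_exp i) w) = (\<Sum>i\<in>{1..n}. v i * (\<Sum>j\<in>{1..n}. w j * L a i j))"
      by (intro sum.cong) auto
    thus ?thesis by (simp add: lam_def sum_distrib_left mult.assoc)
  qed
  have "lam a (E u) w = lam a (u(k := 0)) w + u k * lam a (gp k) w"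
    unfolding E_def by (simp only: lam_add_left lam_scale_left)
  also have "lam a (u(k := 0)) w = (\<Sum>i\<in>{1..n}. (u(k := 0)) i * lam a (unit_exp i) w)" by (rule ex)
  also have "\<dots> = (\<Sum>i\<in>{1..n} - {k}. (u(k := 0)) i * lam a (unit_exp i) w)"
    by (rule sum.mono_neutral_right) auto
  also have "\<dots> = (\<Sum>i\<in>{1..n} - {k}. u i * lam a (E (unit_exp i)) w)"
    by (rule sum.cong) (auto simp: E_fixed)
  also have "\<dots> + u k * lam a (gp k) w = (\<Sum>i\<in>{1..n}. u i * lam a (E (unit_exp i)) w)"
    using k_n by (subst sum.remove[of "{1..n}" k]) (auto simp: add.commute)
  finally show ?thesis .
qed

lemma mu_lam: "a \<in> {1..r} \<Longrightarrow> mu.lam a u v = lam a (E u) (E v)"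
proof -
  assume a: "a \<in> {1..r}"
  have r: "lam a w (E v) = (\<Sum>j\<in>{1..n}. v j * lam a w (E (unit_exp j)))" for w
  proof -
    have "lam a w (E v) = - lam a (E v) w" by (rule lam_skew[OF a])
    also have "\<dots> = - (\<Sum>j\<in>{1..n}. v j * lam a (E (unit_exp j)) w)" by (simp only: lam_expand_E[of a v])
    also have "\<dots> = (\<Sum>j\<in>{1..n}. v j * lam a w (E (unit_exp j)))"
      unfolding sum_negf[symmetric]
    proof (rule sum.cong[OF refl])
      fix j
      show "- (v j * lam a (E (unit_exp j)) w) = v j * lam a w (E (unit_exp j))"
        using lam_skew[OF a, of w "E (unit_exp j)"] by simp
    qed
    finally show ?thesis .
  qed
  have "lam a (E u) (E v) = (\<Sum>i\<in>{1..n}. u i * lam a (E (unit_exp i)) (E v))" by (rule lam_expand_E)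
  also have "\<dots> = (\<Sum>i\<in>{1..n}. u i * (\<Sum>j\<in>{1..n}. v j * lam a (E (unit_exp i)) (E (unit_exp j))))"
    by (simp only: r[of "E (unit_exp _)"])
  also have "\<dots> = mu.lam a u v"
    by (simp only: mu.lam_def L'_def sum_distrib_left mult.assoc)
  finally show ?thesis ..
qed

end

text \<open>Agrees with \<open>V UNIV\<close> but does not mention commutation exponents, so that
  Laurent expansions in different seeds can be compared without naming their frames.\<close>

definition torus :: "nat \<Rightarrow> (nat \<Rightarrow> 'f::division_ring) \<Rightarrow> nat \<Rightarrow> (nat \<Rightarrow> 'f) \<Rightarrow> 'f set" where
  "torus r s n Y = additive_span {ordered_monomial r s e * ordered_monomial n Y u | e u. True}"

lemma (in quasi_torus) V_UNIV_eq_torus: "V UNIV = torus r s n Y"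
proof -
  have 1: "S e * M u = ordered_monomial r s (e + half_exponent u) * ordered_monomial n Y u" for e u
    by (simp only: M_def S_mult_S) (simp only: S_def)
  have 2: "ordered_monomial r s e * ordered_monomial n Y u = S (e - half_exponent u) * M u" for e u
    by (simp only: 1 diff_add_cancel)
  have "{S e * M u | e u. u \<in> UNIV} = {ordered_monomial r s e * ordered_monomial n Y u | e u. True}"
    using 1 2 by blast
  thus ?thesis by (simp add: V_def torus_def)
qed

lemma (in quasi_torus) V_of_int_mult: "x \<in> V U \<Longrightarrow> of_int c * x \<in> V U"
  unfolding V_def by (rule additive_span_of_int_mult)

context mutation
begin

text \<open>Exponent of the scalar that appears when the power of the new variable is split off from
  a normalised monomial of the mutated seed.\<close>

definition shift :: "(nat \<Rightarrow> int) \<Rightarrow> nat \<Rightarrow> int" where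
  "shift u a = - mu.lam a (u(k := 0)) (\<lambda>i. u k * unit_exp k i)"

lemma mu_M_expand: "mu.M u = S (shift u) * (M (u(k := 0)) * Yk' powi u k)"
proof -
  let ?w = "\<lambda>i. u k * unit_exp k i"
  have w: "u(k := 0) + ?w = u" by (auto simp: unit_exp_def fun_eq_iff)
  have "mu.Q (u(k := 0)) ?w * mu.M u = mu.M (u(k := 0)) * mu.M ?w"
    using mu.M_mult[of "u(k := 0)" ?w] by (simp only: w)
  also have "\<dots> = M (u(k := 0)) * Yk' powi u k"
    by (simp add: mu_M_fixed mu.M_scale mu_M_unit)
  finally have *: "mu.Q (u(k := 0)) ?w * mu.M u = M (u(k := 0)) * Yk' powi u k" .
  have "shift u = - (\<lambda>a. mu.lam a (u(k := 0)) ?w)" by (auto simp: shift_def)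
  hence "S (shift u) = inverse (mu.Q (u(k := 0)) ?w)" by (simp only: mu.Q_def S_minus)
  hence "S (shift u) * (mu.Q (u(k := 0)) ?w * mu.M u) = mu.M u"
    by (simp add: mult.assoc[symmetric])
  thus ?thesis by (simp only: *)
qed

lemma Yk'_level: "Yk' \<in> V {u. u k = -1}"
  unfolding Yk'_def by (intro V_add V_M) auto

lemma Yk'_power_level: "Yk' ^ q \<in> V {u. u k = - int q}"
  using V_power_level[OF grading_coordinate[OF k_n] Yk'_level, of q] by simp

text \<open>After multiplication by a high power of \<open>Yk'\<close> only its non-negative powers
  occur. The power \<open>q\<close> has degree \<open>- q\<close> in \<open>Y k\<close>, so
  different powers separate by degree, and within one power the claim reduces to the old
  basis.\<close>

lemma mu_independent: "int_independent (\<lambda>(e, u). S e * mu.M u) (exponents r \<times> exponents n)"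
proof (rule int_independentI)
  fix A c
  assume A: "finite A" "A \<subseteq> exponents r \<times> exponents n"
    and sum0: "(\<Sum>i\<in>A. of_int (c i) * (case i of (e, u) \<Rightarrow> S e * mu.M u)) = 0"
  obtain N where N: "\<And>i. i \<in> A \<Longrightarrow> - int N \<le> snd i k"
  proof
    fix i assume "i \<in> A"
    hence "nat (- snd i k) \<le> (\<Sum>i\<in>A. nat (- snd i k))" using A(1) by (intro member_le_sum) auto
    thus "- int (\<Sum>i\<in>A. nat (- snd i k)) \<le> snd i k" by linarith
  qed
  let ?q = "\<lambda>i. nat (snd i k + int N)"
  let ?b = "\<lambda>i. S (fst i + shift (snd i)) * M ((snd i)(k := 0))"
  have term_eq: "S (fst i) * mu.M (snd i) * Yk' ^ N = ?b i * Yk' ^ ?q i" if "i \<in> A" for i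
  proof -
    have "Yk' ^ ?q i = Yk' powi int (?q i)" by (rule power_int_of_nat[symmetric])
    also have "int (?q i) = snd i k + int N" using N[OF that] by simp
    also have "Yk' powi (snd i k + int N) = Yk' powi snd i k * Yk' ^ N"
      using Yk'_nonzero by (simp only: power_int_add power_int_of_nat simp_thms)
    finally have "Yk' powi snd i k * Yk' ^ N = Yk' ^ ?q i" ..
    thus ?thesis by (simp only: mu_M_expand S_mult_S mult.assoc)
  qed
  let ?x = "\<lambda>p. \<Sum>i\<in>{i \<in> A. ?q i = nat (- p)}. of_int (c i) * ?b i"
  have xV: "?x p \<in> V {u. u k = 0}" for p
    by (intro V_sum V_of_int_mult V_monomial) simp
  \<comment> \<open>Summands are indexed by their degree in \<open>Y k\<close>, which is minus the
    power of \<open>Yk'\<close>; \<open>nat (- p)\<close> recovers the power.\<close>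
  let ?P = "(\<lambda>i. - int (?q i)) ` A"
  have level: "?x p * Yk' ^ nat (- p) \<in> V {u. u k = p}" if "p \<in> ?P" for p
  proof -
    have "0 + - int (nat (- p)) = p" using that by auto
    thus ?thesis
      using V_mult_level[OF grading_coordinate[OF k_n] xV Yk'_power_level, of p "nat (- p)"] by (simp only:)
  qed
  have "(\<Sum>p\<in>?P. ?x p * Yk' ^ nat (- p)) = (\<Sum>p\<in>?P. \<Sum>i\<in>{i \<in> A. - int (?q i) = p}. of_int (c i) * ?b i * Yk' ^ ?q i)"
  proof (rule sum.cong[OF refl])
    fix p assume "p \<in> ?P"
    hence "{i \<in> A. ?q i = nat (- p)} = {i \<in> A. - int (?q i) = p}" by auto
    hence "?x p * Yk' ^ nat (- p) = (\<Sum>i\<in>{i \<in> A. - int (?q i) = p}. of_int (c i) * ?b i * Yk' ^ nat (- p))"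
      by (simp only: sum_distrib_right)
    also have "\<dots> = (\<Sum>i\<in>{i \<in> A. - int (?q i) = p}. of_int (c i) * ?b i * Yk' ^ ?q i)"
    proof (rule sum.cong[OF refl])
      fix i assume "i \<in> {i \<in> A. - int (?q i) = p}"
      hence "nat (- p) = ?q i" by auto
      thus "of_int (c i) * ?b i * Yk' ^ nat (- p) = of_int (c i) * ?b i * Yk' ^ ?q i" by (simp only:)
    qed
    finally show "?x p * Yk' ^ nat (- p) = (\<Sum>i\<in>{i \<in> A. - int (?q i) = p}. of_int (c i) * ?b i * Yk' ^ ?q i)" .
  qed
  also have "\<dots> = (\<Sum>i\<in>A. of_int (c i) * ?b i * Yk' ^ ?q i)"
    using A(1) by (subst sum.group) auto
  also have "\<dots> = (\<Sum>i\<in>A. of_int (c i) * (case i of (e, u) \<Rightarrow> S e * mu.M u)) * Yk' ^ N"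
    unfolding sum_distrib_right
  proof (rule sum.cong[OF refl])
    fix i assume "i \<in> A"
    thus "of_int (c i) * ?b i * Yk' ^ ?q i = of_int (c i) * (case i of (e, u) \<Rightarrow> S e * mu.M u) * Yk' ^ N"
      using term_eq[of i] by (simp add: mult.assoc case_prod_beta)
  qed
  finally have "(\<Sum>p\<in>?P. ?x p * Yk' ^ nat (- p)) = 0" using sum0 by simp
  from V_homogeneous_sum_zero[OF grading_coordinate[OF k_n] _ level this] A(1)
  have x0: "?x p = 0" if "p \<in> ?P" for p using that Yk'_nonzero by auto
  show "\<forall>i\<in>A. c i = 0"
  proof
    fix i0 assume i0: "i0 \<in> A"
    let ?A = "{i \<in> A. ?q i = ?q i0}"
    \<comment> \<open>Within one power of \<open>Yk'\<close> the exponent in direction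
      \<open>k\<close> is common to all summands, so resetting it to 0 loses no information.\<close>
    let ?\<phi> = "\<lambda>i. (trim r (fst i + shift (snd i)), (snd i)(k := 0))"
    have inj: "inj_on ?\<phi> ?A"
    proof (rule inj_onI)
      fix x y assume xy: "x \<in> ?A" "y \<in> ?A" "?\<phi> x = ?\<phi> y"
      have "?q x = ?q y" using xy by simp
      moreover have "- int N \<le> snd x k" "- int N \<le> snd y k" using N xy(1,2) by blast+
      ultimately have "snd x k = snd y k" by linarith
      moreover have "(snd x)(k := 0) = (snd y)(k := 0)" using xy(3) by simp
      ultimately have snd: "snd x = snd y" by (metis fun_upd_triv fun_upd_upd)
      have "fst x a = fst y a" for a
      proof (cases "a \<in> {1..r}")
        case True
        have "trim r (fst x + shift (snd x)) a = trim r (fst y + shift (snd y)) a" using xy(3) by simp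
        thus ?thesis using True snd by (simp add: trim_def)
      next
        case False
        have "fst x \<in> exponents r" "fst y \<in> exponents r" using xy(1,2) A(2) by auto
        thus ?thesis using False unfolding exponents_def by simp
      qed
      thus "x = y" using snd by (simp add: prod_eq_iff fun_eq_iff)
    qed
    have g: "inv_into ?A ?\<phi> (?\<phi> i) = i" if "i \<in> ?A" for i
      by (rule inv_into_f_f[OF inj that])
    let ?g = "inv_into ?A ?\<phi>"
    have "(\<Sum>x\<in>?\<phi> ` ?A. of_int (c (?g x)) * (case x of (e, u) \<Rightarrow> S e * M u)) =
        (\<Sum>i\<in>?A. of_int (c (?g (?\<phi> i))) * (case ?\<phi> i of (e, u) \<Rightarrow> S e * M u))"
      by (rule sum.reindex[OF inj, unfolded o_def])
    also have "\<dots> = (\<Sum>i\<in>?A. of_int (c i) * ?b i)"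
    proof (rule sum.cong[OF refl])
      fix i assume i: "i \<in> ?A"
      show "of_int (c (?g (?\<phi> i))) * (case ?\<phi> i of (e, u) \<Rightarrow> S e * M u) = of_int (c i) * ?b i"
        by (simp only: g[OF i] prod.case S_trim)
    qed
    also have "\<dots> = 0" using x0[OF imageI[OF i0]] by (simp only: minus_minus nat_int)
    finally have "c (?g x) = 0" if "x \<in> ?\<phi> ` ?A" for x
    proof (rule int_independentD[OF independent _ _ _ that, rotated 2])
      show "finite (?\<phi> ` ?A)" using A(1) by simp
      have "(snd i)(k := 0) \<in> exponents n" if "i \<in> A" for i
        using that A(2) unfolding exponents_def by auto
      thus "?\<phi> ` ?A \<subseteq> exponents r \<times> exponents n" using trim_in_exponents by auto
    qed
    thus "c i0 = 0" using g[of i0] i0 by (metis (mono_tags, lifting) imageI mem_Collect_eq)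
  qed
qed

sublocale mu: quantum_frame r s n Y' L'
  by unfold_locales (rule mu_independent)

abbreviation B' where "B' \<equiv> matrix_mutation k B"

lemma B'_k: "B' i k = - B i k" by (simp add: matrix_mutation_def)

lemma B'_skew:
  assumes "i \<in> {1..m}" "j \<in> {1..m}"
  shows "B' i j = - B' j i"
proof -
  have *: "sgn x * max 0 (x * y) = sgn y * max 0 (x * y)" for x y :: int
  proof (cases "x * y > 0")
    case True
    hence "sgn x = sgn y" by (auto simp: zero_less_mult_iff)
    thus ?thesis by simp
  next
    case False
    hence "max 0 (x * y) = 0" by simp
    thus ?thesis by (simp only: mult_zero_right)
  qed
  have sk: "B i j = - B j i" "B k j = - B j k" "B k i = - B i k" "B i k = - B k i"
    using B_skew assms k by blast+
  show ?thesis
  proof (cases "i = k \<or> j = k")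
    case True
    thus ?thesis unfolding matrix_mutation_def using sk by auto
  next
    case False
    have "sgn (B i k) * max 0 (B i k * B k j) = - (sgn (B j k) * max 0 (B j k * B k i))"
      using *[of "B i k" "B k j"] unfolding sk(2,3) by (simp add: sgn_minus mult.commute)
    thus ?thesis using False sk(1) by (simp add: matrix_mutation_def)
  qed
qed

text \<open>The correction made by matrix mutation and the substitution of \<open>gp k\<close>
  cancel, up to a non-negative multiple of \<open>col k\<close>.\<close>

lemma E_col':
  assumes "j \<in> {1..m}" "j \<noteq> k"
  shows "E (\<lambda>i. B' i j) = col j + (\<lambda>i. max 0 (- B k j) * col k i)"
proof
  fix i
  have *: "sgn x * max 0 (x * y) - y * (if x > 0 then x else 0) = max 0 (- y) * x" for x y :: int
  proof -
    consider "x = 0" | "x > 0" "y \<ge> 0" | "x > 0" "y < 0" | "x < 0" "y \<ge> 0" | "x < 0" "y < 0" by linarith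
    thus ?thesis by cases (auto simp: max_def mult_less_0_iff zero_less_mult_iff mult_le_0_iff zero_le_mult_iff)
  qed
  show "E (\<lambda>i. B' i j) i = (col j + (\<lambda>i. max 0 (- B k j) * col k i)) i"
  proof (cases "i = k")
    case True
    thus ?thesis using assms B_diag[OF k] by (simp add: E_def matrix_mutation_def col_def)
  next
    case False
    thus ?thesis using *[of "B i k" "B k j"] assms
      by (simp add: E_def matrix_mutation_def col_def gp_def positive_column_def algebra_simps split: if_splits)
  qed
qed

text \<open>Rewriting with \<open>E\<close> reduces the claim to \<open>lam_col\<close>. For
  \<open>j \<noteq> k\<close> and \<open>i = k\<close> the contributions
  \<open>D a j * gp k j\<close> and \<open>max 0 (- B k j) * D a k\<close> cancel by
  \<open>D_symmetrizer\<close>.\<close>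

lemma mu_lam_col':
  assumes a: "a \<in> {1..r}" and j: "j \<in> {1..m}" and i: "i \<in> {1..n}"
  shows "mu.lam a (\<lambda>l. B' l j) (unit_exp i) = (if i = j then D a j else 0)"
proof (cases "j = k")
  case True
  have "E (\<lambda>l. B' l j) = - col k"
    using B_diag[OF k] True by (auto simp: E_def B'_k col_def fun_eq_iff)
  hence "mu.lam a (\<lambda>l. B' l j) (unit_exp i) = - (D a k * E (unit_exp i) k)"
    using lam_col[OF a k] by (simp add: mu_lam[OF a] lam_minus_left)
  thus ?thesis using True by (cases "i = k") (auto simp: E_fixed)
next
  case False
  let ?c = "max 0 (- B k j)"
  have "mu.lam a (\<lambda>l. B' l j) (unit_exp i) = D a j * E (unit_exp i) j + ?c * (D a k * E (unit_exp i) k)"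
    unfolding mu_lam[OF a] E_col'[OF j False] by (simp only: lam_add_left lam_scale_left lam_col[OF a] j k)
  moreover have "D a j * gp k j = ?c * D a k"
  proof -
    have "B k j = - B j k" using B_skew j k by blast
    hence "gp k j = ?c" using False by (auto simp: gp_def positive_column_def)
    thus ?thesis using D_symmetrizer[OF a j k] \<open>B k j = - B j k\<close> by (auto simp: max_def)
  qed
  ultimately show ?thesis using False by (cases "i = k"; cases "i = j") (auto simp: E_fixed)
qed

sublocale mu: seed_frame r s n Y' L' m B' D
proof
  show "(\<Sum>l\<in>{1..n}. B' l j * L' a l i) = (if i = j then D a j else 0)"
    if "a \<in> {1..r}" "j \<in> {1..m}" "i \<in> {1..n}" for a i j
    using mu_lam_col'[OF that] mu.lam_unit_right[OF that(3), of a "\<lambda>l. B' l j"] by simp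
  show "B' i j = - B' j i" if "i \<in> {1..m}" "j \<in> {1..m}" for i j
    using that by (rule B'_skew)
qed (use m_le_n D_nonzero in auto)

lemma B'_B': "matrix_mutation k B' = B"
proof (intro ext)
  fix i j
  show "matrix_mutation k B' i j = B i j"
  proof (cases "i = k \<or> j = k")
    case True
    thus ?thesis unfolding matrix_mutation_def by auto
  next
    case False
    hence "matrix_mutation k B' i j = B i j + sgn (B i k) * max 0 (B i k * B k j) +
        sgn (- B i k) * max 0 ((- B i k) * (- B k j))"
      by (simp add: matrix_mutation_def)
    also have "\<dots> = B i j" by (simp add: sgn_minus)
    finally show ?thesis .
  qed
qed

text \<open>Multiply by \<open>Yk'\<close> on the right. The mutated column \<open>k\<close> is the
  negated one, so each term of the return exchange becomes \<open>Y k\<close> times the opposite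
  term of \<open>Yk'\<close>; the scalars match because \<open>lam a\<close> cannot distinguish
  \<open>gp k\<close> from \<open>gn k\<close> on exponents without \<open>k\<close>.\<close>

lemma involution: "mu.M (mu.gp k) + mu.M (mu.gn k) = Y k"
proof -
  let ?p = "positive_column k B" and ?n = "negative_column k B"
  have pc: "positive_column k B' = ?n" "negative_column k B' = ?p"
    by (auto simp: positive_column_def negative_column_def B'_k)
  have *: "mu.M (v - unit_exp k) * Yk' = Y k * M (v - unit_exp k)" if v: "v k = 0"
    and lam0: "\<And>a. a \<in> {1..r} \<Longrightarrow> lam a v (gp k) = lam a (unit_exp k) v" for v
  proof -
    have "mu.M (v - unit_exp k) * Yk' = mu.Q (v - unit_exp k) (unit_exp k) * mu.M v"
      using mu.M_mult[of "v - unit_exp k" "unit_exp k"] by (simp only: mu_M_unit diff_add_cancel)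
    also have "mu.Q (v - unit_exp k) (unit_exp k) = Q (unit_exp k) (v - unit_exp k)"
      unfolding mu.Q_def Q_def
    proof (rule S_cong)
      fix a assume a: "a \<in> {1..r}"
      have "mu.lam a (v - unit_exp k) (unit_exp k) = lam a v (gp k)"
        using v by (simp add: mu.lam_diff_left mu.lam_self[OF a] mu_lam[OF a] E_fixed)
      thus "mu.lam a (v - unit_exp k) (unit_exp k) = lam a (unit_exp k) (v - unit_exp k)"
        using lam0[OF a] by (simp add: lam_diff_right lam_self[OF a])
    qed
    also have "mu.M v = M v" by (rule mu_M_fixed) (rule v)
    also have "Q (unit_exp k) (v - unit_exp k) * M v = M (unit_exp k) * M (v - unit_exp k)"
      by (simp only: M_mult add.commute[of "unit_exp k" "v - unit_exp k"] diff_add_cancel)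
    finally show ?thesis by (simp only: M_unit[OF k_n])
  qed
  have lamp: "lam a ?p (gp k) = lam a (unit_exp k) ?p" if "a \<in> {1..r}" for a
    using that by (simp add: gp_def lam_diff_right lam_self lam_skew[of a ?p "unit_exp k"])
  have lamn: "lam a ?n (gp k) = lam a (unit_exp k) ?n" if a: "a \<in> {1..r}" for a
  proof -
    have "lam a (gp k) ?n = lam a (gn k) ?n" using lam_gp_gn[OF a k, of ?n] by simp
    hence "lam a ?n (gp k) = lam a ?n (gn k)" using lam_skew[OF a, of ?n] by simp
    thus ?thesis using a by (simp add: gn_def lam_diff_right lam_self lam_skew[of a ?n "unit_exp k"])
  qed
  have "(mu.M (mu.gp k) + mu.M (mu.gn k)) * Yk' = Y k * M (?n - unit_exp k) + Y k * M (?p - unit_exp k)"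
    unfolding distrib_right mu.gp_def mu.gn_def pc using *[of ?n] *[of ?p] lamp lamn by simp
  also have "\<dots> = Y k * Yk'" by (simp only: Yk'_def gp_def gn_def distrib_left add.commute)
  finally show ?thesis using Yk'_nonzero by simp
qed

lemma Yk_in_mu: "Y k \<in> mu.V UNIV"
  unfolding involution[symmetric] by (intro mu.V_add mu.V_M) auto

end

section \<open>The quantum Laurent phenomenon\<close>

context quasi_torus
begin

lemma V_UNIV_mult: "x \<in> V UNIV \<Longrightarrow> y \<in> V UNIV \<Longrightarrow> x * y \<in> V UNIV"
  by (erule (1) V_mult) simp

lemma V_power:
  assumes "x \<in> V U" "0 \<in> P 0" "\<And>q u v. u \<in> U \<Longrightarrow> v \<in> P q \<Longrightarrow> u + v \<in> P (Suc q)"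
  shows "x ^ q \<in> V (P q)"
proof (induction q)
  case 0
  show ?case using V_1[OF assms(2)] by simp
next
  case (Suc q)
  show ?case using V_mult[OF assms(1) Suc assms(3)] by simp
qed

lemma V_UNIV_power: "x \<in> V UNIV \<Longrightarrow> x ^ q \<in> V UNIV"
  by (rule V_power[where P = "\<lambda>_. UNIV"]) auto

lemma M_expand:
  assumes "k \<in> {1..n}"
  shows "\<exists>e. M u = S e * (M (u(k := 0)) * Y k powi u k)"
proof -
  let ?w = "\<lambda>i. u k * unit_exp k i"
  have w: "u(k := 0) + ?w = u" by (auto simp: unit_exp_def fun_eq_iff)
  have *: "Q (u(k := 0)) ?w * M u = M (u(k := 0)) * Y k powi u k"
    using M_mult[of "u(k := 0)" ?w] by (simp only: w M_scale M_unit[OF assms])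
  have "M u = inverse (Q (u(k := 0)) ?w) * (M (u(k := 0)) * Y k powi u k)"
    unfolding *[symmetric] by (simp add: mult.assoc[symmetric])
  hence "M u = S (- (\<lambda>a. lam a (u(k := 0)) ?w)) * (M (u(k := 0)) * Y k powi u k)"
    by (simp only: Q_def S_minus)
  thus ?thesis by (intro exI[of _ "- (\<lambda>a. lam a (u(k := 0)) ?w)"])
qed

lemma power_leading:
  assumes "grading l" "y \<in> V {u. l u = 0}" "z \<in> V {u. l u > 0}"
  shows "(y + z) ^ p - y ^ p \<in> V {u. l u > 0}"
proof (induction p)
  case (Suc p)
  have y: "(y + z) \<in> V {u. l u \<ge> 0}" using assms(2,3) by (auto intro!: V_add elim!: V_mono')
  have yp: "y ^ p \<in> V {u. l u = 0}" using V_power_level[OF assms(1,2), of p] by simp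
  have "(y + z) ^ Suc p - y ^ Suc p = (y + z) * ((y + z) ^ p - y ^ p) + z * y ^ p"
    by (simp add: algebra_simps)
  also have "\<dots> \<in> V {u. l u > 0}"
    by (intro V_add V_mult[OF y Suc] V_mult[OF assms(3) yp]) (auto simp: grading_add[OF assms(1)])
  finally show ?case .
qed simp

end

context quantum_frame
begin

lemma V_top_less:
  assumes l: "grading l" and "y + z \<in> V {u. l u < b}" "y \<in> V {u. l u = d}" "z \<in> V {u. l u < d}" "y \<noteq> 0"
  shows "d < b"
proof (rule ccontr)
  assume "\<not> d < b"
  hence "(y + z) - z \<in> V {u. l u < d}" using assms by (intro V_diff) (auto elim!: V_mono')
  hence "y = 0"
    using V_level_disjoint[OF l assms(3), of "{u. l u < d}"] by auto
  thus False using assms by simp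
qed

end

context mutation
begin

text \<open>Makes \<open>Yk'\<close> an explicit polynomial variable. The coefficients do not
  involve direction \<open>k\<close> and therefore belong to the old and the new torus
  alike.\<close>

lemma mu_expand:
  assumes "x \<in> mu.V U" and U: "\<And>u. u \<in> U \<Longrightarrow> 0 \<le> u k \<and> u k \<le> int K"
  obtains \<rho> where "\<And>p. \<rho> p \<in> V ((\<lambda>u. u(k := 0)) ` (U \<inter> {u. u k = int p}))"
    "x = (\<Sum>p\<le>K. \<rho> p * Yk' ^ p)"
proof -
  have "\<exists>\<rho>. (\<forall>p. \<rho> p \<in> V ((\<lambda>u. u(k := 0)) ` (U \<inter> {u. u k = int p}))) \<and> x = (\<Sum>p\<le>K. \<rho> p * Yk' ^ p)"
    using assms(1)
  proof (induction rule: mu.V_induct)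
    case zero
    show ?case by (intro exI[of _ "\<lambda>_. 0"]) simp
  next
    case (monomial e u)
    let ?y = "S (e + shift u) * M (u(k := 0))"
    obtain q where q: "u k = int q" "q \<le> K" using U[OF monomial] by (metis int_nat_eq nat_int nat_le_iff)
    let ?\<rho> = "\<lambda>p. if p = q then ?y else 0"
    have "?\<rho> p \<in> V ((\<lambda>u. u(k := 0)) ` (U \<inter> {u. u k = int p}))" for p
      using q monomial by (auto intro!: V_monomial)
    moreover have "S e * mu.M u = (\<Sum>p\<le>K. ?\<rho> p * Yk' ^ p)"
    proof -
      have "(\<Sum>p\<le>K. ?\<rho> p * Yk' ^ p) = (\<Sum>p\<le>K. if p = q then ?y * Yk' ^ q else 0)"
        by (rule sum.cong) auto
      also have "\<dots> = ?y * Yk' ^ q" using q(2) by (simp add: sum.delta)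
      finally show ?thesis by (simp only: mu_M_expand q(1) power_int_of_nat S_mult_S mult.assoc)
    qed
    ultimately show ?case by (intro exI[of _ ?\<rho>] conjI allI)
  next
    case (diff x y)
    then obtain \<rho> \<rho>' where "\<And>p. \<rho> p \<in> V ((\<lambda>u. u(k := 0)) ` (U \<inter> {u. u k = int p}))" "x = (\<Sum>p\<le>K. \<rho> p * Yk' ^ p)"
      "\<And>p. \<rho>' p \<in> V ((\<lambda>u. u(k := 0)) ` (U \<inter> {u. u k = int p}))" "y = (\<Sum>p\<le>K. \<rho>' p * Yk' ^ p)" by blast
    thus ?case
      by (intro exI[of _ "\<lambda>p. \<rho> p - \<rho>' p"] conjI allI V_diff)
        (simp_all only: left_diff_distrib sum_subtractf)
  qed
  thus ?thesis using that by blast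
qed

text \<open>By involutivity \<open>Y k\<close> is itself Laurent in the mutated seed, and the other
  variables are common to both seeds.\<close>

lemma V_nonneg_in_mu:
  assumes "x \<in> V {u. u k \<ge> 0}"
  shows "x \<in> mu.V UNIV"
  using assms
proof (induction rule: V_induct)
  case (monomial e u)
  obtain f where f: "M u = S f * (M (u(k := 0)) * Y k powi u k)" using M_expand[OF k_n] by blast
  have "Y k powi u k \<in> mu.V UNIV"
    using monomial by (simp add: power_int_def mu.V_UNIV_power Yk_in_mu)
  moreover have "M (u(k := 0)) \<in> mu.V UNIV"
    using mu.V_M[of "u(k := 0)" UNIV] by (simp add: mu_M_fixed)
  ultimately show ?case unfolding f S_mult_S by (intro mu.V_S_mult mu.V_UNIV_mult)
qed (auto intro: mu.V_diff)

text \<open>Non-negative powers of \<open>Yk'\<close> expand in the old torus, and neither term of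
  \<open>Yk'\<close> has a negative exponent at \<open>j\<close>.\<close>

lemma mu_nonneg_in_V:
  assumes "j \<noteq> k" "x \<in> mu.V {u. u k \<ge> 0 \<and> u j \<ge> d}" "j \<in> {1..m}"
  shows "x \<in> V {u. u j \<ge> d}"
  using assms(2)
proof (induction rule: mu.V_induct)
  case (monomial e u)
  have "Yk' \<in> V {u. u j \<ge> 0}" unfolding Yk'_def
    by (intro V_add V_M) (use assms(1) in \<open>auto simp: gp_def gn_def positive_column_def negative_column_def\<close>)
  hence y: "Yk' ^ nat (u k) \<in> V {u. u j \<ge> 0}"
    by (rule V_power[where P = "\<lambda>_. {u. u j \<ge> 0}"]) auto
  have m: "M (u(k := 0)) \<in> V {u. u j \<ge> d}" by (rule V_M) (use monomial assms(1) in auto)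
  have "S e * mu.M u = S e * (S (shift u) * (M (u(k := 0)) * Yk' ^ nat (u k)))"
    using monomial by (simp add: mu_M_expand power_int_def)
  also have "\<dots> \<in> V {u. u j \<ge> d}"
    by (intro V_S_mult V_mult[OF m y]) auto
  finally show ?case .
qed (auto intro: V_diff)

lemma mu_nonneg_in_V_UNIV:
  assumes "x \<in> mu.V {u. u k \<ge> 0}"
  shows "x \<in> V UNIV"
  using assms
proof (induction rule: mu.V_induct)
  case (monomial e u)
  have "Yk' \<in> V UNIV" unfolding Yk'_def by (intro V_add V_M) auto
  hence "Yk' ^ nat (u k) \<in> V UNIV" by (rule V_UNIV_power)
  moreover have "S e * mu.M u = S e * (S (shift u) * (M (u(k := 0)) * Yk' ^ nat (u k)))"
    using monomial by (simp add: mu_M_expand power_int_def)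
  ultimately show ?case by (auto intro!: V_S_mult V_UNIV_mult V_M)
qed (auto intro: V_diff)

lemma Yk'_in_mu: "Yk' \<in> mu.V {u. u k = 1 \<and> (\<forall>i. i \<noteq> k \<longrightarrow> u i = 0)}"
  unfolding mu_M_unit[symmetric] by (rule mu.V_M) auto

text \<open>Clear denominators with \<open>Yk' ^ N\<close> and expand in powers of
  \<open>Yk'\<close>. The summand with power \<open>p\<close> is homogeneous of degree
  \<open>- p\<close> in \<open>Y k\<close>, so the bottom part \<open>h\<close> comes from a single
  power, and \<open>Yk' ^ N\<close> cancels.\<close>

lemma bottom_divisible:
  assumes h: "h \<in> V {u. u k = - int \<delta>}" and z: "z \<in> V {u. u k > - int \<delta>}" and f: "h + z \<in> mu.V UNIV"
  obtains \<rho> where "\<rho> \<in> V {u. u k = 0}" "h = \<rho> * Yk' ^ \<delta>"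
proof -
  obtain N0 where "N0 \<ge> 0" "h + z \<in> mu.V (UNIV \<inter> {u. - N0 \<le> u k \<and> u k \<le> N0})"
    using mu.V_bounded[OF f, of "\<lambda>u. u k"] .
  \<comment> \<open>Being at least \<open>\<delta>\<close>, \<open>N\<close> puts the index
    \<open>\<delta> + N\<close> of the relevant summand within the range up to
    \<open>2 * N\<close>.\<close>
  define N where "N = nat (max N0 (int \<delta>))"
  have N: "N \<ge> \<delta>" "int N \<ge> N0" by (auto simp: N_def)
  have f': "h + z \<in> mu.V {u. - int N \<le> u k \<and> u k \<le> int N}"
    using \<open>h + z \<in> mu.V (UNIV \<inter> _)\<close> by (rule mu.V_mono') (use N in auto)
  have "Yk' ^ N \<in> mu.V {u. u k = int N}"
    by (rule mu.V_power[OF Yk'_in_mu, where P = "\<lambda>q. {u. u k = int q}"]) auto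
  from mu.V_mult[OF f' this, of "{u. 0 \<le> u k \<and> u k \<le> int (2 * N)}"]
  have "(h + z) * Yk' ^ N \<in> mu.V {u. 0 \<le> u k \<and> u k \<le> int (2 * N)}" by auto
  then obtain \<rho> where "\<And>p. \<rho> p \<in> V ((\<lambda>u. u(k := 0)) ` ({u. 0 \<le> u k \<and> u k \<le> int (2 * N)} \<inter> {u. u k = int p}))"
    and eq: "(h + z) * Yk' ^ N = (\<Sum>p\<le>2 * N. \<rho> p * Yk' ^ p)"
    by (rule mu_expand[of _ _ "2 * N"]) auto
  from this(1) have \<rho>: "\<rho> p \<in> V {u. u k = 0}" for p by (rule V_mono') auto
  note gr = grading_coordinate[OF k_n]
  let ?p = "\<delta> + N"
  have lev: "\<rho> p * Yk' ^ p \<in> V {u. u k = - int p}" for p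
    using V_mult_level[OF gr \<rho> Yk'_power_level, of p p] by simp
  have hN: "h * Yk' ^ N \<in> V {u. u k = - int ?p}"
    using V_mult_level[OF gr h Yk'_power_level, of N] by (simp add: algebra_simps)
  have zN: "z * Yk' ^ N \<in> V {u. u k > - int ?p}"
    by (rule V_mult[OF z Yk'_power_level]) auto
  have "(\<Sum>p\<le>2 * N. \<rho> p * Yk' ^ p) = \<rho> ?p * Yk' ^ ?p + (\<Sum>p\<in>{..2 * N} - {?p}. \<rho> p * Yk' ^ p)"
    using N by (intro sum.remove) auto
  hence "h * Yk' ^ N - \<rho> ?p * Yk' ^ ?p = (\<Sum>p\<in>{..2 * N} - {?p}. \<rho> p * Yk' ^ p) - z * Yk' ^ N"
    using eq by (simp add: algebra_simps)
  also have "\<dots> \<in> V {u. u k \<noteq> - int ?p}"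
  proof (intro V_diff V_sum)
    show "\<rho> p * Yk' ^ p \<in> V {u. u k \<noteq> - int ?p}" if "p \<in> {..2 * N} - {?p}" for p
      using lev[of p] by (rule V_mono') (use that in auto)
    show "z * Yk' ^ N \<in> V {u. u k \<noteq> - int ?p}" using zN by (rule V_mono') auto
  qed
  finally have "h * Yk' ^ N - \<rho> ?p * Yk' ^ ?p = 0"
    using V_level_disjoint[OF gr V_diff[OF hN lev[of ?p]], of "{u. u k \<noteq> - int ?p}"] by auto
  hence "h * Yk' ^ N = (\<rho> ?p * Yk' ^ \<delta>) * Yk' ^ N" by (simp add: power_add mult.assoc)
  hence "h = \<rho> ?p * Yk' ^ \<delta>" using Yk'_nonzero by simp
  thus ?thesis using that \<rho> by blast
qed

section \<open>Division by powers of the exchange binomial\<close>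

definition width :: int where "width = \<bar>D 1 k\<bar>"
text \<open>The degree by commutation with \<open>Y k\<close>, read in the first formal variable.
  The two terms of \<open>Yk'\<close> differ in it by \<open>D 1 k\<close>, so \<open>width\<close>
  is the span of the exchange binomial, positive as soon as \<open>1 \<le> r\<close>.\<close>

definition lk :: "(nat \<Rightarrow> int) \<Rightarrow> int" where "lk u = lam 1 u (unit_exp k)"

lemma grading_lk: "grading lk" unfolding lk_def by (rule grading_lam)

lemma Yk'_top_bottom:
  assumes "1 \<le> r"
  obtains t t' where "Yk' = M t + M t'" "t k = -1" "t' k = -1" "lk t = lk t' + width"
proof -
  have "lk (gp k) - lk (gn k) = D 1 k"
    unfolding grading_diff[OF grading_lk, symmetric] gp_diff_gn
    using lam_col[of 1 k "unit_exp k"] assms k by (simp add: lk_def)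
  thus ?thesis
    using that[of "gp k" "gn k"] that[of "gn k" "gp k"]
    by (cases "D 1 k > 0") (auto simp: width_def Yk'_def add.commute)
qed

text \<open>In the expansion of the power only the pure powers of the two terms reach the ends of
  the \<open>lk\<close> interval.\<close>

lemma Yk'_power_top_bottom:
  assumes "1 \<le> r"
  obtains t t' where
    "Yk' ^ \<delta> - M t ^ \<delta> \<in> V {u. u k = - int \<delta> \<and> int \<delta> * lk t' \<le> lk u \<and> lk u < int \<delta> * lk t}"
    "Yk' ^ \<delta> - M t' ^ \<delta> \<in> V {u. u k = - int \<delta> \<and> int \<delta> * lk t' < lk u \<and> lk u \<le> int \<delta> * lk t}"
    "t k = -1" "t' k = -1" "lk t = lk t' + width"
proof -
  obtain t t' where t: "Yk' = M t + M t'" "t k = -1" "t' k = -1" "lk t = lk t' + width"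
    using Yk'_top_bottom[OF assms] .
  have wpos: "width > 0" using D_nonzero[of 1 k] assms k by (simp add: width_def)
  have Y: "Yk' \<in> V {u. u k = -1 \<and> lk t' \<le> lk u \<and> lk u \<le> lk t}"
    unfolding t(1) by (intro V_add V_M) (use t wpos in auto)
  have pow: "M x ^ \<delta> \<in> V {u. u k = - int \<delta> \<and> lk u = int \<delta> * lk x}" if "x k = -1" for x \<delta>
    by (rule V_power[OF V_M[of x "{x}"], where P = "\<lambda>\<delta>. {u. u k = - int \<delta> \<and> lk u = int \<delta> * lk x}"])
      (auto simp: that grading_0[OF grading_lk] grading_add[OF grading_lk] algebra_simps)
  have "Yk' ^ \<delta> - M t ^ \<delta> \<in> V {u. u k = - int \<delta> \<and> int \<delta> * lk t' \<le> lk u \<and> lk u < int \<delta> * lk t}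
      \<and> Yk' ^ \<delta> - M t' ^ \<delta> \<in> V {u. u k = - int \<delta> \<and> int \<delta> * lk t' < lk u \<and> lk u \<le> int \<delta> * lk t}" for \<delta>
  proof (induction \<delta>)
    case (Suc \<delta>)
    have 1: "Yk' ^ Suc \<delta> - M t ^ Suc \<delta> = Yk' * (Yk' ^ \<delta> - M t ^ \<delta>) + M t' * M t ^ \<delta>"
      and 2: "Yk' ^ Suc \<delta> - M t' ^ Suc \<delta> = Yk' * (Yk' ^ \<delta> - M t' ^ \<delta>) + M t * M t' ^ \<delta>"
      by (simp_all add: t(1) algebra_simps)
    have le: "int \<delta> * lk t' \<le> int \<delta> * lk t" using t(4) wpos by (intro mult_left_mono) auto
    show ?case unfolding 1 2
    proof (intro conjI V_add)
      show "Yk' * (Yk' ^ \<delta> - M t ^ \<delta>) \<in> V {u. u k = - int (Suc \<delta>) \<and> int (Suc \<delta>) * lk t' \<le> lk u \<and> lk u < int (Suc \<delta>) * lk t}"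
        by (rule V_mult[OF Y Suc[THEN conjunct1]]) (auto simp: grading_add[OF grading_lk] algebra_simps)
      show "Yk' * (Yk' ^ \<delta> - M t' ^ \<delta>) \<in> V {u. u k = - int (Suc \<delta>) \<and> int (Suc \<delta>) * lk t' < lk u \<and> lk u \<le> int (Suc \<delta>) * lk t}"
        by (rule V_mult[OF Y Suc[THEN conjunct2]]) (auto simp: grading_add[OF grading_lk] algebra_simps)
      show "M t' * M t ^ \<delta> \<in> V {u. u k = - int (Suc \<delta>) \<and> int (Suc \<delta>) * lk t' \<le> lk u \<and> lk u < int (Suc \<delta>) * lk t}"
        by (rule V_mult[OF V_M[of t' "{t'}"] pow[of t, OF t(2)]])
          (use t wpos le in \<open>auto simp: grading_add[OF grading_lk] algebra_simps\<close>)
      show "M t * M t' ^ \<delta> \<in> V {u. u k = - int (Suc \<delta>) \<and> int (Suc \<delta>) * lk t' < lk u \<and> lk u \<le> int (Suc \<delta>) * lk t}"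
        by (rule V_mult[OF V_M[of t "{t}"] pow[of t', OF t(3)]])
          (use t wpos le in \<open>auto simp: grading_add[OF grading_lk] algebra_simps\<close>)
    qed
  qed simp
  thus ?thesis using that t by blast
qed

text \<open>Euclidean division from above: the top level of \<open>c\<close> is removed by a
  multiple of \<open>Yk' ^ \<delta>\<close>, whose top \<open>M t ^ \<delta>\<close> is invertible.
  A removal reaches down by at most the span \<open>int \<delta> * width\<close>, so it never goes
  below the lower bound of the window.\<close>

lemma division:
  assumes r: "1 \<le> r" and c: "c \<in> V {u. u k = - int \<delta>}"
  obtains \<rho> A where "\<rho> \<in> V {u. u k = 0}"
    "c - \<rho> * Yk' ^ \<delta> \<in> V {u. u k = - int \<delta> \<and> A \<le> lk u \<and> lk u < A + int \<delta> * width}"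
proof -
  obtain t t' where t: "Yk' ^ \<delta> - M t ^ \<delta> \<in> V {u. u k = - int \<delta> \<and> int \<delta> * lk t' \<le> lk u \<and> lk u < int \<delta> * lk t}"
    "t k = -1" "lk t = lk t' + width"
    using Yk'_power_top_bottom[OF r, of \<delta>] .
  obtain N where N: "c \<in> V ({u. u k = - int \<delta>} \<inter> {u. - N \<le> lk u \<and> lk u \<le> N})" using V_bounded[OF c] .
  let ?W = "int \<delta> * width" and ?t = "\<lambda>i. - int \<delta> * t i"
  have Mt: "M ?t * M t ^ \<delta> = 1"
    unfolding M_scale power_int_minus power_int_of_nat using M_nonzero[of t] by simp
  have "\<exists>\<rho>\<in>V {u. u k = 0}. c - \<rho> * Yk' ^ \<delta> \<in> V {u. u k = - int \<delta> \<and> - N \<le> lk u \<and> lk u < - N + ?W}"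
    if "c \<in> V {u. u k = - int \<delta> \<and> - N \<le> lk u \<and> lk u < - N + ?W + int K}" for K
    using that
  proof (induction K arbitrary: c)
    case 0
    thus ?case by (intro bexI[of _ 0]) auto
  next
    case (Suc K)
    let ?d = "- N + ?W + int K"
    obtain y z where yz: "y \<in> V ({u. u k = - int \<delta> \<and> - N \<le> lk u \<and> lk u < - N + ?W + int (Suc K)} \<inter> {u. lk u = ?d})"
      "z \<in> V ({u. u k = - int \<delta> \<and> - N \<le> lk u \<and> lk u < - N + ?W + int (Suc K)} - {u. lk u = ?d})" "c = y + z"
      using V_split[OF Suc.prems] .
    have y: "y \<in> V {u. u k = - int \<delta> \<and> lk u = ?d}" using yz(1) by (rule V_mono') auto
    have z: "z \<in> V {u. u k = - int \<delta> \<and> - N \<le> lk u \<and> lk u < ?d}" using yz(2) by (rule V_mono') auto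
    have lkt: "lk ?t = - (int \<delta> * lk t)" unfolding lk_def lam_scale_left by (rule mult_minus_left)
    have \<rho>0: "y * M ?t \<in> V {u. u k = 0 \<and> lk u = ?d - int \<delta> * lk t}"
      by (rule V_mult[OF y V_M[of ?t "{?t}"]]) (use t lkt in \<open>auto simp: grading_add[OF grading_lk]\<close>)
    have "y = y * M ?t * M t ^ \<delta>" by (simp only: mult.assoc Mt mult_1_right)
    hence "c - (y * M ?t) * Yk' ^ \<delta> = z - (y * M ?t) * (Yk' ^ \<delta> - M t ^ \<delta>)"
      unfolding yz(3) right_diff_distrib by simp
    also have "\<dots> \<in> V {u. u k = - int \<delta> \<and> - N \<le> lk u \<and> lk u < ?d}"
      by (intro V_diff z V_mult[OF \<rho>0 t(1)]) (auto simp: grading_add[OF grading_lk] t(3) algebra_simps)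
    finally obtain \<rho> where \<rho>: "\<rho> \<in> V {u. u k = 0}"
      "c - (y * M ?t) * Yk' ^ \<delta> - \<rho> * Yk' ^ \<delta> \<in> V {u. u k = - int \<delta> \<and> - N \<le> lk u \<and> lk u < - N + ?W}"
      using Suc.IH by blast
    have mem: "y * M ?t + \<rho> \<in> V {u. u k = 0}" using \<rho>0 \<rho>(1) by (auto intro!: V_add elim!: V_mono')
    have eq: "c - (y * M ?t + \<rho>) * Yk' ^ \<delta> = c - (y * M ?t) * Yk' ^ \<delta> - \<rho> * Yk' ^ \<delta>"
      by (simp add: algebra_simps)
    show ?case by (rule bexI[OF _ mem], unfold eq, rule \<rho>(2))
  qed
  moreover have "c \<in> V {u. u k = - int \<delta> \<and> - N \<le> lk u \<and> lk u < - N + ?W + int (nat (2 * N + 1))}"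
  proof (rule V_mono'[OF N], rule subsetI)
    fix u assume u: "u \<in> {u. u k = - int \<delta>} \<inter> {u. - N \<le> lk u \<and> lk u \<le> N}"
    moreover have "0 \<le> ?W" by (simp add: width_def)
    ultimately have "lk u < - N + ?W + int (nat (2 * N + 1))" by (simp only: Int_iff mem_Collect_eq) linarith
    thus "u \<in> {u. u k = - int \<delta> \<and> - N \<le> lk u \<and> lk u < - N + ?W + int (nat (2 * N + 1))}"
      using u by simp
  qed
  ultimately show ?thesis using that by blast
qed

text \<open>For nonzero \<open>\<rho>\<close> the tops multiply and so do the bottoms, hence the
  product spans at least as much as \<open>Yk' ^ \<delta>\<close>. For \<open>\<delta> = 0\<close>
  the interval is empty.\<close>

lemma narrow_multiple_zero:
  assumes r: "1 \<le> r" and "\<rho> \<in> V UNIV"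
    and x: "\<rho> * Yk' ^ \<delta> \<in> V {u. A \<le> lk u \<and> lk u < A + int \<delta> * width}"
  shows "\<rho> = 0"
proof (rule ccontr)
  assume "\<rho> \<noteq> 0"
  obtain t t' where t: "Yk' ^ \<delta> - M t ^ \<delta> \<in> V {u. u k = - int \<delta> \<and> int \<delta> * lk t' \<le> lk u \<and> lk u < int \<delta> * lk t}"
    "Yk' ^ \<delta> - M t' ^ \<delta> \<in> V {u. u k = - int \<delta> \<and> int \<delta> * lk t' < lk u \<and> lk u \<le> int \<delta> * lk t}"
    "lk t = lk t' + width"
    using Yk'_power_top_bottom[OF r, of \<delta>] .
  have pow: "M x ^ \<delta> \<in> V {u. lk u = int \<delta> * lk x}" for x
    using V_power_level[OF grading_lk V_M, of x] by simp
  note add = grading_add[OF grading_lk]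
  have "(Yk' ^ \<delta> - M t ^ \<delta>) + M t ^ \<delta> \<in> V {u. lk u \<le> int \<delta> * lk t}"
    by (intro V_add V_mono'[OF t(1)] V_mono'[OF pow]) auto
  hence Yhi: "Yk' ^ \<delta> \<in> V {u. lk u \<le> int \<delta> * lk t}" by simp
  have "(Yk' ^ \<delta> - M t' ^ \<delta>) + M t' ^ \<delta> \<in> V {u. lk u \<ge> int \<delta> * lk t'}"
    by (intro V_add V_mono'[OF t(2)] V_mono'[OF pow]) auto
  hence Ylo: "Yk' ^ \<delta> \<in> V {u. lk u \<ge> int \<delta> * lk t'}" by simp
  obtain d y z where d: "y \<in> V {u. lk u = d}" "y \<noteq> 0" "z \<in> V {u. lk u < d}" "\<rho> = y + z"
    using V_top[OF assms(2) \<open>\<rho> \<noteq> 0\<close>, of lk, unfolded Int_UNIV_left] .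
  \<comment> \<open>The bottom of \<open>\<rho>\<close> is found as the top for the opposite degree;
    its level is \<open>- d'\<close>.\<close>
  obtain d' y' z' where d'': "y' \<in> V {u. - lk u = d'}" "y' \<noteq> 0" "z' \<in> V {u. - lk u < d'}" "\<rho> = y' + z'"
    using V_top[OF assms(2) \<open>\<rho> \<noteq> 0\<close>, of "\<lambda>u. - lk u", unfolded Int_UNIV_left] .
  have "d + int \<delta> * lk t < A + int \<delta> * width"
  proof (rule V_top_less[OF grading_lk])
    show "y * M t ^ \<delta> \<in> V {u. lk u = d + int \<delta> * lk t}"
      using V_mult_level[OF grading_lk d(1) pow] .
    show "y * (Yk' ^ \<delta> - M t ^ \<delta>) + z * Yk' ^ \<delta> \<in> V {u. lk u < d + int \<delta> * lk t}"
      by (intro V_add V_mult[OF d(1) t(1)] V_mult[OF d(3) Yhi]) (auto simp: add)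
    show "y * M t ^ \<delta> + (y * (Yk' ^ \<delta> - M t ^ \<delta>) + z * Yk' ^ \<delta>) \<in> V {u. lk u < A + int \<delta> * width}"
      using x unfolding d(4) by (rule_tac V_mono'[of _ "{u. A \<le> lk u \<and> lk u < A + int \<delta> * width}"])
        (auto simp: algebra_simps)
  qed (use d in simp)
  moreover have "d' - int \<delta> * lk t' < - A + 1"
  proof (rule V_top_less[OF grading_minus[OF grading_lk]])
    show "y' * M t' ^ \<delta> \<in> V {u. - lk u = d' - int \<delta> * lk t'}"
      by (rule V_mult[OF d''(1) pow]) (auto simp: add)
    show "y' * (Yk' ^ \<delta> - M t' ^ \<delta>) + z' * Yk' ^ \<delta> \<in> V {u. - lk u < d' - int \<delta> * lk t'}"
      by (intro V_add V_mult[OF d''(1) t(2)] V_mult[OF d''(3) Ylo]) (auto simp: add)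
    show "y' * M t' ^ \<delta> + (y' * (Yk' ^ \<delta> - M t' ^ \<delta>) + z' * Yk' ^ \<delta>) \<in> V {u. - lk u < - A + 1}"
      using x unfolding d''(4) by (rule_tac V_mono'[of _ "{u. A \<le> lk u \<and> lk u < A + int \<delta> * width}"])
        (auto simp: algebra_simps)
  qed (use d'' in simp)
  moreover have "- d' \<le> d"
  proof (rule ccontr)
    assume "\<not> - d' \<le> d"
    have "\<rho> \<in> V {u. lk u \<le> d}" unfolding d(4) using d(1,3) by (auto intro!: V_add elim!: V_mono')
    moreover have "\<rho> \<in> V {u. lk u \<ge> - d'}" unfolding d''(4) using d''(1,3) by (auto intro!: V_add elim!: V_mono')
    ultimately have "\<rho> = 0"
      using V_disjoint[of \<rho> "{u. lk u \<le> d}" "{u. lk u \<ge> - d'}"] \<open>\<not> - d' \<le> d\<close>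
        determined_Collect[OF grading_lk, of "\<lambda>x. x \<ge> - d'"] by fastforce
    thus False using \<open>\<rho> \<noteq> 0\<close> by simp
  qed
  ultimately show False using t(3) by (simp add: algebra_simps)
qed

end

section \<open>Two mutation directions\<close>

locale mutation_pair = mutation +
  fixes j :: nat
  assumes j: "j \<in> {1..m}" and j_neq_k: "j \<noteq> k"
begin

lemma j_n: "j \<in> {1..n}" using j m_le_n by auto

text \<open>In the instances \<open>J\<close> and \<open>KJ\<close> the names \<open>Yk'\<close>,
  \<open>lk\<close> and \<open>width\<close> refer to direction \<open>j\<close>:
  \<open>J.Yk'\<close> is the new variable there before, \<open>KJ.Yk'\<close> after the mutation in
  direction \<open>k\<close>.\<close>

sublocale J: mutation r s n Y L m B D j
  by unfold_locales (rule j)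

sublocale KJ: mutation r s n Y' L' m B' D j
  by unfold_locales (rule j)

text \<open>The sign of \<open>B k j\<close> decides which term of \<open>Yk'\<close> is free of
  \<open>Y j\<close>. That term is \<open>g\<close>, the lowest part of \<open>Yk'\<close> in
  \<open>Y j\<close> whenever \<open>B k j\<close> is nonzero.\<close>

definition g :: "nat \<Rightarrow> int" where "g = (if B k j > 0 then gp k else gn k)"
definition g' :: "nat \<Rightarrow> int" where "g' = (if B k j > 0 then gn k else gp k)"
text \<open>The counterpart of \<open>E\<close> for the term \<open>g\<close>: it yields the
  exponent of the part of lowest degree in \<open>Y j\<close>, and the signs fit so that the mutated
  column \<open>j\<close> returns exactly to \<open>col j\<close>.\<close>

definition Eg :: "(nat \<Rightarrow> int) \<Rightarrow> nat \<Rightarrow> int" where "Eg u = u(k := 0) + (\<lambda>i. u k * g i)"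

lemma B_jk: "B j k = - B k j" using B_skew[OF j k] .

lemma g_k: "g k = -1" "g' k = -1" by (auto simp: g_def g'_def)

lemma g_j: "g j = 0" and g'_j: "g' j = \<bar>B k j\<bar>"
  using j_neq_k B_jk by (auto simp: g_def g'_def gp_def gn_def positive_column_def negative_column_def)

lemma Yk'_g: "Yk' = M g + M g'"
  by (auto simp: g_def g'_def Yk'_def add.commute)

lemma lk_g: "J.lk g = J.lk (gp k)" "J.lk g' = J.lk (gp k)" if "1 \<le> r"
proof -
  have "J.lk (gn k) = J.lk (gp k)"
    unfolding J.lk_def by (rule lam_gp_gn) (use that k j_neq_k in auto)
  thus "J.lk g = J.lk (gp k)" "J.lk g' = J.lk (gp k)" by (auto simp: g_def g'_def)
qed

lemma lam_g: "a \<in> {1..r} \<Longrightarrow> v k = 0 \<Longrightarrow> lam a g v = lam a (gp k) v"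
  using lam_gp_gn[OF _ k] by (auto simp: g_def)

text \<open>If \<open>B k j\<close> is not positive, using \<open>gn k\<close> for
  \<open>gp k\<close> removes precisely the multiple of \<open>col k\<close> that is left over in
  \<open>E_col'\<close>.\<close>

lemma Eg_col': "Eg (\<lambda>i. B' i j) = col j"
proof (cases "B k j > 0")
  case True
  hence "Eg (\<lambda>i. B' i j) = E (\<lambda>i. B' i j)" by (simp add: Eg_def E_def g_def)
  thus ?thesis using E_col'[OF j j_neq_k] True by (simp add: max_def zero_fun_def[symmetric])
next
  case False
  have "Eg (\<lambda>i. B' i j) = E (\<lambda>i. B' i j) + (\<lambda>i. B' k j * (gn k - gp k) i)"
    using False by (simp add: Eg_def E_def g_def fun_eq_iff algebra_simps)
  also have "gn k - gp k = - col k" using gp_diff_gn[of k] by (metis minus_diff_eq)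
  also have "E (\<lambda>i. B' i j) + (\<lambda>i. B' k j * (- col k) i) = col j"
    unfolding E_col'[OF j j_neq_k] using False j_neq_k by (auto simp: fun_eq_iff matrix_mutation_def max_def)
  finally show ?thesis .
qed

lemma M_Eg: "M (Eg u) = S (shift u) * (M (u(k := 0)) * M g powi u k)"
proof -
  let ?w = "\<lambda>i. u k * g i" and ?v = "\<lambda>i. u k * unit_exp k i"
  have 1: "Q (u(k := 0)) ?w * M (Eg u) = M (u(k := 0)) * M g powi u k"
    unfolding Eg_def by (simp only: M_mult[symmetric] M_scale)
  have 2: "S (shift u) = inverse (Q (u(k := 0)) ?w)"
    unfolding Q_def S_minus[symmetric]
  proof (rule S_cong)
    fix a assume a: "a \<in> {1..r}"
    have "shift u a = - (u k * lam a (u(k := 0)) (gp k))"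
      unfolding shift_def mu.lam_scale_right mu_lam[OF a] by (simp add: E_fixed)
    also have "lam a (u(k := 0)) (gp k) = lam a (u(k := 0)) g"
      using lam_g[OF a, of "u(k := 0)"] lam_skew[OF a, of "u(k := 0)"] by simp
    finally show "shift u a = (- (\<lambda>a. lam a (u(k := 0)) ?w)) a" by (simp add: lam_scale_right)
  qed
  show ?thesis unfolding 2 1[symmetric] by (simp add: mult.assoc[symmetric])
qed

lemma M_g_level: "M g \<in> V {u. u j = 0}"
  by (rule V_M) (simp add: g_j)

lemma M_g'_level: "B k j \<noteq> 0 \<Longrightarrow> M g' \<in> V {u. u j > 0}"
  by (rule V_M) (simp add: g'_j)

lemma mu_M_leading:
  assumes b: "B k j \<noteq> 0" and u: "u k \<ge> 0"
  shows "mu.M u - M (Eg u) \<in> V {v. v j > u j}"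
proof -
  have "Yk' ^ nat (u k) - M g ^ nat (u k) \<in> V {v. v j > 0}"
    unfolding Yk'_g by (rule power_leading[OF grading_coordinate[OF j_n] M_g_level M_g'_level[OF b]])
  hence "S (shift u) * (M (u(k := 0)) * (Yk' ^ nat (u k) - M g ^ nat (u k))) \<in> V {v. v j > u j}"
    by (intro V_S_mult V_mult[OF V_M[of "u(k := 0)" "{u(k := 0)}"]]) (use j_neq_k in auto)
  thus ?thesis using u by (simp add: mu_M_expand M_Eg power_int_def right_diff_distrib)
qed

lemma KJ_exponents:
  "mu.gp j j = -1" "mu.gn j j = -1" "mu.gp j k \<ge> 0" "mu.gn j k \<ge> 0"
  using j_neq_k mu.B_diag[OF j] by (auto simp: mu.gp_def mu.gn_def positive_column_def negative_column_def)

text \<open>The rank two computation: up to a monomial that does not involve \<open>Y j\<close>, mutation in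
  direction \<open>j\<close> before and after the mutation in direction \<open>k\<close> have the same part of lowest
  degree in \<open>Y j\<close>.\<close>
lemma KJ_Yk'_in_J: "KJ.Yk' \<in> J.mu.V UNIV"
proof (cases "B k j = 0")
  case True
  have "B' i j = B i j" for i
    using True j_neq_k by (auto simp: matrix_mutation_def)
  hence "mu.gp j = gp j" "mu.gn j = gn j"
    by (auto simp: mu.gp_def gp_def mu.gn_def gn_def positive_column_def negative_column_def)
  moreover have "gp j k = 0" "gn j k = 0"
    using True j_neq_k by (auto simp: gp_def gn_def positive_column_def negative_column_def)
  ultimately have "KJ.Yk' = J.Yk'" by (simp add: KJ.Yk'_def J.Yk'_def mu_M_fixed)
  thus ?thesis using mu.V_UNIV J.mu.V_UNIV[OF J.Yk'_in_mu] by simp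
next
  case False
  let ?G = "mu.gp j" and ?G' = "mu.gn j"
  \<comment> \<open>One \<open>?w\<close> serves both terms of the binomial, because
    \<open>Eg\<close> sends the difference of their exponents, the mutated column \<open>j\<close>,
    to \<open>col j\<close>.\<close>
  let ?w = "Eg ?G - gp j"
  have Eg_j: "Eg u j = u j" for u using j_neq_k by (simp add: Eg_def g_j)
  have "Eg ?G - Eg ?G' = Eg (?G - ?G')" by (auto simp: Eg_def fun_eq_iff algebra_simps)
  also have "?G - ?G' = (\<lambda>i. B' i j)" unfolding mu.gp_diff_gn mu.col_def ..
  finally have diff: "Eg ?G - Eg ?G' = gp j - gn j" unfolding Eg_col' gp_diff_gn .
  have EG: "Eg ?G = ?w + gp j" "Eg ?G' = ?w + gn j" using diff by (auto simp: algebra_simps)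
  have wj: "?w j = 0" using KJ_exponents by (simp add: Eg_j)
  have "M ?w * J.Yk' = Q ?w (gp j) * M (Eg ?G) + Q ?w (gn j) * M (Eg ?G')"
    unfolding J.Yk'_def distrib_left M_mult EG[symmetric] ..
  also have "Q ?w (gn j) = Q ?w (gp j)"
    unfolding Q_def
  proof (rule S_cong)
    fix a assume a: "a \<in> {1..r}"
    show "lam a ?w (gn j) = lam a ?w (gp j)"
      using lam_gp_gn[OF a j, of ?w, OF wj] lam_skew[OF a, of ?w] by simp
  qed
  finally have "M ?w * J.Yk' = Q ?w (gp j) * (M (Eg ?G) + M (Eg ?G'))" by (simp only: distrib_left)
  hence lead: "M (Eg ?G) + M (Eg ?G') = S (- (\<lambda>a. lam a ?w (gp j))) * (M ?w * J.Yk')"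
    using Q_nonzero[of ?w "gp j"] by (simp add: Q_def[symmetric] S_minus mult.assoc[symmetric])
  have "M ?w \<in> J.mu.V UNIV" using J.mu.V_M[of ?w UNIV] J.mu_M_fixed[of ?w, OF wj] by (simp only: UNIV_I simp_thms)
  hence "M (Eg ?G) + M (Eg ?G') \<in> J.mu.V UNIV"
    unfolding lead by (intro J.mu.V_S_mult J.mu.V_UNIV_mult J.mu.V_UNIV[OF J.Yk'_in_mu])
  \<comment> \<open>Both terms start at exponent -1 in \<open>Y j\<close>, so whatever lies strictly
    above is non-negative there and passes to the torus of \<open>J\<close>.\<close>
  moreover have "(mu.M ?G - M (Eg ?G)) + (mu.M ?G' - M (Eg ?G')) \<in> J.mu.V UNIV"
  proof (rule J.V_nonneg_in_mu[OF V_add])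
    show "mu.M ?G - M (Eg ?G) \<in> V {u. 0 \<le> u j}"
      using mu_M_leading[OF False, of ?G, OF KJ_exponents(3)] by (rule V_mono') (use KJ_exponents in auto)
    show "mu.M ?G' - M (Eg ?G') \<in> V {u. 0 \<le> u j}"
      using mu_M_leading[OF False, of ?G', OF KJ_exponents(4)] by (rule V_mono') (use KJ_exponents in auto)
  qed
  ultimately have "(M (Eg ?G) + M (Eg ?G')) + ((mu.M ?G - M (Eg ?G)) + (mu.M ?G' - M (Eg ?G'))) \<in> J.mu.V UNIV"
    by (rule J.mu.V_add)
  thus ?thesis by (simp add: KJ.Yk'_def algebra_simps)
qed

lemma Yk'_leading:
  assumes r: "1 \<le> r"
  obtains N N1 where "Yk' = N + N1" "N \<noteq> 0" "N \<in> V {u. u j = 0 \<and> u k = -1 \<and> J.lk u = J.lk (gp k)}"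
    "N1 \<in> V {u. u j > 0}"
proof (cases "B k j = 0")
  case True
  have "Yk' \<in> V {u. u j = 0 \<and> u k = -1 \<and> J.lk u = J.lk (gp k)}" unfolding Yk'_g
    by (intro V_add V_M) (use True lk_g[OF r] in \<open>auto simp: g_j g'_j g_k\<close>)
  thus ?thesis using that[of Yk' 0] Yk'_nonzero by simp
next
  case False
  show ?thesis
    by (rule that[OF Yk'_g _ _ M_g'_level[OF False]]) (auto intro!: V_M simp: g_j g_k lk_g[OF r])
qed

text \<open>Replace \<open>Yk'\<close> by its part \<open>N\<close> free of \<open>Y j\<close>.
  \<open>KJ.lk\<close> gives \<open>Yk'\<close> the weight \<open>J.lk (gp k)\<close>, which is also
  the weight of \<open>N\<close>, so the interval is inherited. Distinct powers of \<open>N\<close>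
  have distinct degrees in \<open>Y k\<close>, so nothing cancels and \<open>c' = 0\<close> forces
  \<open>c = 0\<close>.\<close>

lemma mu_leading:
  assumes r: "1 \<le> r" and c: "c \<in> mu.V {u. u j = d \<and> 0 \<le> u k \<and> A \<le> KJ.lk u \<and> KJ.lk u < A'}"
  obtains c' where "c' \<in> V {u. u j = d \<and> A \<le> J.lk u \<and> J.lk u < A'}" "c - c' \<in> V {u. u j > d}"
    "c' = 0 \<Longrightarrow> c = 0"
proof -
  obtain N N1 where N: "Yk' = N + N1" "N \<noteq> 0" "N \<in> V {u. u j = 0 \<and> u k = -1 \<and> J.lk u = J.lk (gp k)}"
    "N1 \<in> V {u. u j > 0}" using Yk'_leading[OF r] .
  let ?U = "{u. u j = d \<and> 0 \<le> u k \<and> A \<le> KJ.lk u \<and> KJ.lk u < A'}"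
  obtain K0 where "K0 \<ge> 0" "c \<in> mu.V (?U \<inter> {u. - K0 \<le> u k \<and> u k \<le> K0})" using mu.V_bounded[OF c] .
  define K where "K = nat K0"
  let ?U' = "?U \<inter> {u. - K0 \<le> u k \<and> u k \<le> K0}"
  obtain \<rho> where \<rho>: "\<And>p. \<rho> p \<in> V ((\<lambda>u. u(k := 0)) ` (?U' \<inter> {u. u k = int p}))"
    and c_eq: "c = (\<Sum>p\<le>K. \<rho> p * Yk' ^ p)"
    by (rule mu_expand[OF \<open>c \<in> mu.V ?U'\<close>, of K]) (use \<open>K0 \<ge> 0\<close> K_def in auto)
  have lkE: "KJ.lk u = J.lk (u(k := 0)) + u k * J.lk (gp k)" for u
  proof -
    have "KJ.lk u = lam 1 (E u) (unit_exp j)"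
      unfolding KJ.lk_def using mu_lam[of 1] r j_neq_k by (simp add: E_fixed)
    thus ?thesis unfolding E_def lam_add_left lam_scale_left J.lk_def .
  qed
  have \<rho>': "\<rho> p \<in> V {u. u j = d \<and> u k = 0 \<and> A \<le> J.lk u + int p * J.lk (gp k) \<and> J.lk u + int p * J.lk (gp k) < A'}" for p
    using \<rho>[of p] by (rule V_mono') (use j_neq_k lkE in auto)
  have Np: "N ^ p \<in> V {u. u j = 0 \<and> u k = - int p \<and> J.lk u = int p * J.lk (gp k)}" for p
    by (rule V_power[OF N(3), where P = "\<lambda>p. {u. u j = 0 \<and> u k = - int p \<and> J.lk u = int p * J.lk (gp k)}"])
      (auto simp: grading_0[OF J.grading_lk] grading_add[OF J.grading_lk] algebra_simps)
  let ?c = "\<Sum>p\<le>K. \<rho> p * N ^ p"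
  have "\<rho> p * N ^ p \<in> V {u. u j = d \<and> A \<le> J.lk u \<and> J.lk u < A'}" for p
    by (rule V_mult[OF \<rho>' Np]) (auto simp: grading_add[OF J.grading_lk])
  hence 1: "?c \<in> V {u. u j = d \<and> A \<le> J.lk u \<and> J.lk u < A'}" by (intro V_sum)
  have "\<rho> p * (Yk' ^ p - N ^ p) \<in> V {u. u j > d}" for p
  proof -
    have "Yk' ^ p - N ^ p \<in> V {u. u j > 0}" unfolding N(1)
      by (rule power_leading[OF grading_coordinate[OF j_n] V_mono'[OF N(3)] N(4)]) auto
    from V_mult[OF \<rho>' this] show ?thesis by auto
  qed
  hence "(\<Sum>p\<le>K. \<rho> p * (Yk' ^ p - N ^ p)) \<in> V {u. u j > d}" by (intro V_sum)
  hence 2: "c - ?c \<in> V {u. u j > d}" by (simp add: c_eq right_diff_distrib sum_subtractf)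
  have 3: "c = 0" if "?c = 0"
  proof -
    let ?P = "(\<lambda>p. - int p) ` {..K}"
    have "(\<Sum>q\<in>?P. \<rho> (nat (- q)) * N ^ nat (- q)) = ?c"
      by (subst sum.reindex) (auto simp: inj_on_def)
    hence s0: "(\<Sum>q\<in>?P. \<rho> (nat (- q)) * N ^ nat (- q)) = 0" using that by simp
    have lev: "\<rho> (nat (- q)) * N ^ nat (- q) \<in> V {u. u k = q}" if "q \<in> ?P" for q
      by (rule V_mult[OF \<rho>' Np]) (use that in auto)
    have "\<rho> p * N ^ p = 0" if "p \<in> {..K}" for p
      using V_homogeneous_sum_zero[OF grading_coordinate[OF k_n] _ lev s0, of "- int p"] that by simp
    hence "\<rho> p = 0" if "p \<in> {..K}" for p using that N(2) by simp
    thus ?thesis by (simp add: c_eq)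
  qed
  show ?thesis using that[OF 1 2 3] .
qed

text \<open>Induction on a bound for the pole order in \<open>Y j\<close>. The two exchange
  binomials in direction \<open>j\<close> meet only in the original torus, so everything is first
  multiplied by a power of \<open>Yk'\<close> that brings it there; this factor is divided out at
  the end.\<close>

theorem laurent_exchange:
  assumes r: "1 \<le> r" and "f \<in> V UNIV" "f \<in> mu.V UNIV" "f \<in> J.mu.V UNIV"
  shows "f \<in> KJ.mu.V UNIV"
proof -
  have "f \<in> KJ.mu.V UNIV"
    if "f \<in> V UNIV" "f \<in> J.mu.V UNIV" "f \<in> mu.V {u. u j \<ge> - int \<delta>}" for \<delta> f
    using that
  proof (induction \<delta> arbitrary: f)
    case 0
    thus ?case using KJ.V_nonneg_in_mu by simp
  next
    case (Suc \<delta>)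
    let ?d = "Suc \<delta>"
    obtain c z where c0: "c \<in> mu.V ({u. u j \<ge> - int ?d} \<inter> {u. u j = - int ?d})"
      "z \<in> mu.V ({u. u j \<ge> - int ?d} - {u. u j = - int ?d})" and f: "f = c + z"
      using mu.V_split[OF Suc.prems(3)] .
    have c: "c \<in> mu.V {u. u j = - int ?d}" using c0(1) by (rule mu.V_mono') auto
    have z: "z \<in> mu.V {u. u j > - int ?d}" using c0(2) by (rule mu.V_mono') auto
    obtain \<rho> A where \<rho>: "\<rho> \<in> mu.V {u. u j = 0}"
      and c1: "c - \<rho> * KJ.Yk' ^ ?d \<in> mu.V {u. u j = - int ?d \<and> A \<le> KJ.lk u \<and> KJ.lk u < A + int ?d * KJ.width}"
      using KJ.division[OF r c] .
    let ?c1 = "c - \<rho> * KJ.Yk' ^ ?d"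
    obtain N1 where N1: "N1 \<ge> 0" "f \<in> mu.V ({u. u j \<ge> - int ?d} \<inter> {u. - N1 \<le> u k \<and> u k \<le> N1})"
      using mu.V_bounded[OF Suc.prems(3)] .
    obtain N2 where N2: "N2 \<ge> 0" "\<rho> \<in> mu.V ({u. u j = 0} \<inter> {u. - N2 \<le> u k \<and> u k \<le> N2})"
      using mu.V_bounded[OF \<rho>] .
    obtain N3 where N3: "N3 \<ge> 0" "?c1 \<in> mu.V ({u. u j = - int ?d \<and> A \<le> KJ.lk u \<and> KJ.lk u < A + int ?d * KJ.width}
        \<inter> {u. - N3 \<le> u k \<and> u k \<le> N3})"
      using mu.V_bounded[OF c1] .
    obtain N4 where N4: "N4 \<ge> 0" "z \<in> mu.V ({u. u j > - int ?d} \<inter> {u. - N4 \<le> u k \<and> u k \<le> N4})"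
      using mu.V_bounded[OF z] .
    \<comment> \<open>A single exponent that clears the negative powers of \<open>Yk'\<close> from
      all four elements at once.\<close>
    define N where "N = nat (max (max N1 N2) (max N3 N4))"
    have N: "N1 \<le> int N" "N2 \<le> int N" "N3 \<le> int N" "N4 \<le> int N" using N1(1) by (auto simp: N_def)
    let ?y = "Yk' ^ N"
    let ?\<mu> = "KJ.lk (unit_exp k)"
    note gl = mu.grading_add[OF KJ.grading_lk]
    have "Yk' \<in> mu.V {unit_exp k}" unfolding mu_M_unit[symmetric] by (rule mu.V_M) simp
    hence y: "?y \<in> mu.V {u. u k = int N \<and> u j = 0 \<and> KJ.lk u = int N * ?\<mu>}"
      by (rule mu.V_power[where P = "\<lambda>N. {u. u k = int N \<and> u j = 0 \<and> KJ.lk u = int N * ?\<mu>}"])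
        (use j_neq_k in \<open>auto simp: gl mu.grading_0[OF KJ.grading_lk] algebra_simps\<close>)
    have yf: "?y * f \<in> mu.V {u. u k \<ge> 0}" by (rule mu.V_mult[OF y N1(2)]) (use N in auto)
    have y\<rho>: "?y * \<rho> \<in> mu.V {u. u k \<ge> 0 \<and> u j \<ge> 0}" by (rule mu.V_mult[OF y N2(2)]) (use N in auto)
    have yc1: "?y * ?c1 \<in> mu.V {u. u j = - int ?d \<and> 0 \<le> u k \<and> A + int N * ?\<mu> \<le> KJ.lk u \<and>
        KJ.lk u < (A + int N * ?\<mu>) + int ?d * KJ.width}"
      by (rule mu.V_mult[OF y N3(2)]) (use N in \<open>auto simp: gl\<close>)
    have yz: "?y * z \<in> mu.V {u. u k \<ge> 0 \<and> u j \<ge> - int \<delta>}" by (rule mu.V_mult[OF y N4(2)]) (use N in auto)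
    let ?F = "?y * f - ?y * \<rho> * KJ.Yk' ^ ?d"
    have F: "?F = ?y * ?c1 + ?y * z" by (simp add: f algebra_simps)
    have yJ: "?y \<in> J.mu.V UNIV"
    proof (rule J.mu.V_UNIV_power, rule J.V_nonneg_in_mu)
      show "Yk' \<in> V {u. u j \<ge> 0}" unfolding Yk'_g by (intro V_add V_M) (auto simp: g_j g'_j)
    qed
    have y\<rho>J: "?y * \<rho> \<in> J.mu.V UNIV"
      by (rule J.V_nonneg_in_mu[OF mu_nonneg_in_V[OF j_neq_k y\<rho> j]])
    have FJ: "?F \<in> J.mu.V UNIV"
      by (intro J.mu.V_diff J.mu.V_UNIV_mult[OF yJ Suc.prems(2)]
          J.mu.V_UNIV_mult[OF y\<rho>J J.mu.V_UNIV_power[OF KJ_Yk'_in_J]])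
    have "KJ.Yk' \<in> mu.V {u. u k \<ge> 0}" unfolding KJ.Yk'_def
      by (intro mu.V_add mu.V_M) (use KJ_exponents in auto)
    hence "KJ.Yk' ^ ?d \<in> mu.V {u. u k \<ge> 0}" by (rule mu.V_power[where P = "\<lambda>_. {u. u k \<ge> 0}"]) auto
    with y\<rho> have "?y * \<rho> * KJ.Yk' ^ ?d \<in> mu.V {u. u k \<ge> 0}" by (rule mu.V_mult) auto
    with yf have "?F \<in> mu.V {u. u k \<ge> 0}" by (rule mu.V_diff)
    hence FV: "?F \<in> V UNIV" by (rule mu_nonneg_in_V_UNIV)
    obtain c' where c': "c' \<in> V {u. u j = - int ?d \<and> A + int N * ?\<mu> \<le> J.lk u \<and>
        J.lk u < (A + int N * ?\<mu>) + int ?d * KJ.width}"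
      "?y * ?c1 - c' \<in> V {u. u j > - int ?d}" "c' = 0 \<Longrightarrow> ?y * ?c1 = 0"
      by (rule mu_leading[OF r yc1]) blast
    have "?y * z \<in> V {u. u j > - int ?d}"
      using mu_nonneg_in_V[OF j_neq_k yz j] by (rule V_mono') auto
    with c'(2) have rest: "(?y * ?c1 - c') + ?y * z \<in> V {u. u j > - int ?d}" by (rule V_add)
    have "c' \<in> V {u. u j = - int ?d}" using c'(1) by (rule V_mono') auto
    moreover have "c' + ((?y * ?c1 - c') + ?y * z) \<in> J.mu.V UNIV" using FJ unfolding F by simp
    ultimately obtain \<rho>2 where \<rho>2: "\<rho>2 \<in> V {u. u j = 0}" "c' = \<rho>2 * J.Yk' ^ ?d"
      using J.bottom_divisible[OF _ rest] by blast
    \<comment> \<open>The widths before and after the mutation in direction \<open>k\<close> agree,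
      both being \<open>\<bar>D 1 j\<bar>\<close>: mutation keeps \<open>D\<close>.\<close>
    have "\<rho>2 * J.Yk' ^ ?d \<in> V {u. A + int N * ?\<mu> \<le> J.lk u \<and> J.lk u < (A + int N * ?\<mu>) + int ?d * J.width}"
      using c'(1) unfolding \<rho>2(2) J.width_def KJ.width_def by (rule V_mono') auto
    hence "\<rho>2 = 0" by (rule J.narrow_multiple_zero[OF r V_UNIV[OF \<rho>2(1)]])
    hence yc0: "?y * ?c1 = 0" using c'(3) \<rho>2(2) by simp
    have Fz: "?F = ?y * z" unfolding F yc0 by simp
    have "?F \<in> KJ.mu.V UNIV"
    proof (rule Suc.IH[OF FV FJ])
      show "?F \<in> mu.V {u. u j \<ge> - int \<delta>}" unfolding Fz using yz by (rule mu.V_mono') auto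
    qed
    have "?c1 = 0" using yc0 Yk'_nonzero by simp
    hence f_eq: "f = \<rho> * KJ.Yk' ^ ?d + inverse ?y * ?F"
      unfolding Fz using Yk'_nonzero by (simp add: f mult.assoc[symmetric])
    \<comment> \<open>\<open>?y\<close> remains a monomial in the seed mutated in both directions,
      since mutation in direction \<open>j\<close> leaves the variable \<open>Yk'\<close> in
      place.\<close>
    have "inverse ?y = mu.M (\<lambda>i. - int N * unit_exp k i)"
      unfolding mu.M_scale mu_M_unit power_int_minus power_int_of_nat ..
    also have "\<dots> = KJ.mu.M (\<lambda>i. - int N * unit_exp k i)"
      using KJ.mu_M_fixed[of "\<lambda>i. - int N * unit_exp k i"] j_neq_k by simp
    finally have "inverse ?y \<in> KJ.mu.V UNIV" by (simp add: KJ.mu.V_M)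
    moreover have "\<rho> \<in> KJ.mu.V UNIV"
      using \<rho> by (intro KJ.V_nonneg_in_mu) (auto elim!: mu.V_mono')
    ultimately have "\<rho> * KJ.Yk' ^ ?d + inverse ?y * ?F \<in> KJ.mu.V UNIV"
      using \<open>?F \<in> KJ.mu.V UNIV\<close> KJ.mu.V_UNIV[OF KJ.Yk'_in_mu]
      by (intro KJ.mu.V_add KJ.mu.V_UNIV_mult KJ.mu.V_UNIV_power)
    thus ?case by (subst f_eq)
  qed
  moreover obtain N where "N \<ge> 0" "f \<in> mu.V (UNIV \<inter> {u. - N \<le> u j \<and> u j \<le> N})"
    using mu.V_bounded[OF assms(3)] .
  hence "f \<in> mu.V {u. u j \<ge> - int (nat N)}" by (elim mu.V_mono') auto
  ultimately show ?thesis using assms by blast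
qed

end

section \<open>Seeds along mutation sequences\<close>

context quantum_frame
begin

lemma commutation_exponents_unique:
  assumes "quasi_commute r n s L2 Y" and a: "a \<in> {1..r}" and ij: "i \<in> {1..n}" "j \<in> {1..n}"
  shows "L2 a i j = L a i j"
proof -
  have "Y i * Y j = t_monomial r s (\<lambda>a. L2 a i j) * (Y j * Y i)"
    using assms(1) ij unfolding quasi_commute_def by blast
  moreover have "Y i * Y j = t_monomial r s (\<lambda>a. L a i j) * (Y j * Y i)"
    using Y_quasi_commute ij unfolding quasi_commute_def by blast
  ultimately have "t_monomial r s (\<lambda>a. L2 a i j) * (Y j * Y i) = t_monomial r s (\<lambda>a. L a i j) * (Y j * Y i)"
    by (simp only:)
  moreover have "Y j * Y i \<noteq> 0" using Y_nonzero ij by simp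
  ultimately have "S ((\<lambda>a. L2 a i j) + (\<lambda>a. L2 a i j)) = S ((\<lambda>a. L a i j) + (\<lambda>a. L a i j))"
    by (simp only: t_monomial_eq_S mult_right_cancel simp_thms not_False_eq_True)
  from S_inj[OF this a] show ?thesis by simp
qed

text \<open>The exponents picked by \<open>SOME\<close> need not be those of the frame, but the two
  agree on the relevant indices.\<close>

lemma commutative_monomial_eq_M: "commutative_monomial r n s Y u = M u"
proof -
  have "quasi_commute r n s (commutation_matrices r n s Y) Y"
    unfolding commutation_matrices_def by (rule someI[of "\<lambda>L. quasi_commute r n s L Y"]) (rule Y_quasi_commute)
  note L2 = commutation_exponents_unique[OF this]
  have "ordered_monomial r s (\<lambda>a. \<Sum>j\<in>{1..n}. \<Sum>i\<in>{1..<j}. u i * u j * commutation_matrices r n s Y a j i) =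
      S (half_exponent u)" unfolding S_def[symmetric]
    by (rule S_cong) (auto simp: half_exponent_def L2 intro!: sum.cong)
  thus ?thesis by (simp only: commutative_monomial_def M_def)
qed

text \<open>Independence of the \<open>s a\<close> lets the square of a monomial \<open>S e\<close>
  determine its exponents, so the definite description is well defined.\<close>

lemma half_commutator_eq:
  assumes "k \<in> {1..n}"
  shows "half_commutator r s (Y k) (M p) = S (\<lambda>a. lam a p (unit_exp k))"
proof -
  let ?u = "S (\<lambda>a. lam a p (unit_exp k))"
  have range: "range (ordered_monomial r s) = range S" by (simp add: S_def[abs_def])
  have comm: "M p * Y k = ?u\<^sup>2 * (Y k * M p)"
  proof -
    have "S (\<lambda>a. 2 * lam a p (unit_exp k)) = S ((\<lambda>a. lam a p (unit_exp k)) + (\<lambda>a. lam a p (unit_exp k)))"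
      by (rule S_cong) simp
    thus ?thesis using M_quasi_commute[of p "unit_exp k"]
      by (simp only: M_unit[OF assms] S_add power2_eq_square)
  qed
  show ?thesis unfolding half_commutator_def range
  proof (rule the_equality)
    show "?u \<in> range S \<and> ?u\<^sup>2 * Y k * M p = M p * Y k" by (simp add: comm mult.assoc)
    fix u assume u: "u \<in> range S \<and> u\<^sup>2 * Y k * M p = M p * Y k"
    then obtain e where e: "u = S e" by blast
    have "u\<^sup>2 * (Y k * M p) = ?u\<^sup>2 * (Y k * M p)" using u comm by (simp add: mult.assoc)
    moreover have "Y k * M p \<noteq> 0" using Y_nonzero[OF assms] by simp
    ultimately have "S (e + e) = S ((\<lambda>a. lam a p (unit_exp k)) + (\<lambda>a. lam a p (unit_exp k)))"
      by (simp only: e power2_eq_square S_add mult_right_cancel simp_thms not_False_eq_True)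
    from S_inj[OF this] have "e a = lam a p (unit_exp k)" if "a \<in> {1..r}" for a
      using that by fastforce
    thus "u = ?u" unfolding e by (rule S_cong)
  qed
qed

end

context mutation
begin

lemma exchange_term:
  "S (\<lambda>a. lam a v (unit_exp k)) * M v * inverse (Y k) = M (v - unit_exp k)"
proof -
  have "Q v (- unit_exp k) = inverse (Q v (unit_exp k))" by (rule Q_minus_right)
  hence "M v * inverse (Y k) = inverse (Q v (unit_exp k)) * M (v - unit_exp k)"
    using M_mult[of v "- unit_exp k"] by (simp add: M_minus M_unit[OF k_n])
  thus ?thesis by (simp add: Q_def[symmetric] mult.assoc) (simp add: mult.assoc[symmetric])
qed

lemma toroidal_mutation_eq: "toroidal_mutation r n s k (Y, B) = (Y', B')"
  by (simp add: commutative_monomial_eq_M half_commutator_eq[OF k_n] Let_def distrib_right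
      exchange_term Y'_def Yk'_def gp_def gn_def)

lemma exchange_relation:
  "Yk' * Y k = S (\<lambda>a. lam a (gp k) (unit_exp k)) * M (positive_column k B) +
     S (\<lambda>a. lam a (gn k) (unit_exp k)) * M (negative_column k B)"
proof -
  have "M (gp k) * Y k = Q (gp k) (unit_exp k) * M (gp k + unit_exp k)"
    "M (gn k) * Y k = Q (gn k) (unit_exp k) * M (gn k + unit_exp k)"
    unfolding M_unit[OF k_n, symmetric] M_mult by (rule refl)+
  thus ?thesis unfolding Yk'_def distrib_right Q_def by (simp only: gp_def gn_def diff_add_cancel)
qed

text \<open>The scalars are inverse to those of \<open>exchange_relation\<close>; together the two
  forms say that the bar involution respects the exchange relation.\<close>

lemma exchange_relation_right:
  "Y k * Yk' = S (\<lambda>a. - lam a (gp k) (unit_exp k)) * M (positive_column k B) +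
     S (\<lambda>a. - lam a (gn k) (unit_exp k)) * M (negative_column k B)"
proof -
  have s: "Q (unit_exp k) v = S (\<lambda>a. - lam a v (unit_exp k))" for v
    unfolding Q_def by (rule S_cong) (rule lam_skew)
  have "Y k * M (gp k) = Q (unit_exp k) (gp k) * M (gp k + unit_exp k)"
    "Y k * M (gn k) = Q (unit_exp k) (gn k) * M (gn k + unit_exp k)"
    unfolding M_unit[OF k_n, symmetric] M_mult by (simp_all only: add.commute)
  thus ?thesis unfolding Yk'_def distrib_left s by (simp only: gp_def gn_def diff_add_cancel)
qed

end

text \<open>Hides the commutation exponents, which change along a mutation sequence, and the
  diagonal, so that inductions over sequences speak about seeds only.\<close>

definition seed_ok :: "nat \<Rightarrow> (nat \<Rightarrow> 'f::division_ring) \<Rightarrow> nat \<Rightarrow> nat \<Rightarrow> 'f seed \<Rightarrow> bool" where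
  "seed_ok r s n m X \<longleftrightarrow> (\<exists>L D. seed_frame r s n (fst X) L m (snd X) D)"

lemma seed_ok_mutation:
  assumes "seed_ok r s n m (Y, B)" "k \<in> {1..m}"
  obtains L D where "mutation r s n Y L m B D k"
  using assms unfolding seed_ok_def mutation_def mutation_axioms_def by auto

lemma seed_ok_toroidal_mutation:
  assumes "seed_ok r s n m X" "k \<in> {1..m}"
  shows "seed_ok r s n m (toroidal_mutation r n s k X)"
proof -
  obtain Y B where X: "X = (Y, B)" by fastforce
  obtain L D where "mutation r s n Y L m B D k" using seed_ok_mutation assms unfolding X by blast
  then interpret mutation r s n Y L m B D k .
  have "seed_frame r s n Y' L' m B' D" by unfold_locales
  thus ?thesis unfolding X toroidal_mutation_eq seed_ok_def by auto
qed

lemma toroidal_mutation_involution: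
  assumes "seed_ok r s n m X" "k \<in> {1..m}"
  shows "toroidal_mutation r n s k (toroidal_mutation r n s k X) = X"
proof -
  obtain Y B where X: "X = (Y, B)" by fastforce
  obtain L D where "mutation r s n Y L m B D k" using seed_ok_mutation assms unfolding X by blast
  then interpret mutation r s n Y L m B D k .
  interpret mm: mutation r s n Y' L' m B' D k by unfold_locales (rule k)
  have "mm.Y' = Y'(k := Y k)" unfolding mm.Y'_def mm.Yk'_def involution ..
  hence "mm.Y' = Y" by (simp add: Y'_def)
  thus ?thesis unfolding X toroidal_mutation_eq mm.toroidal_mutation_eq B'_B' by simp
qed

lemma snd_toroidal_mutation: "snd (toroidal_mutation r n s k X) = matrix_mutation k (snd X)"
  by (cases X) (simp add: Let_def)

lemma ordered_monomial_eq_prod: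
  "ordered_monomial N (x :: nat \<Rightarrow> 'c::field) u = (\<Prod>i\<in>{1..N}. x i powi u i)"
  by (induction N) (auto simp: ordered_monomial_Suc)

text \<open>For \<open>r = 0\<close> every scalar \<open>S e\<close> is 1, so normalised monomials
  are plain products and the exchange relation is the commutative one.\<close>

lemma classical_mutation_eq_toroidal:
  fixes X :: "'c::field seed"
  assumes "seed_ok 0 s n m X" "k \<in> {1..m}"
  shows "classical_mutation n k X = toroidal_mutation 0 n s k X"
proof -
  obtain x B where X: "X = (x, B)" by fastforce
  obtain L D where "mutation 0 s n x L m B D k" using seed_ok_mutation assms unfolding X by blast
  then interpret mutation 0 s n x L m B D k .
  have S1: "S e = 1" for e by (simp add: S_def)
  have M: "M u = (\<Prod>i\<in>{1..n}. x i powi u i)" for u by (simp add: M_def S1 ordered_monomial_eq_prod)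
  have "M (gp k) * x k = M (positive_column k B)" "M (gn k) * x k = M (negative_column k B)"
    unfolding M_unit[OF k_n, symmetric] M_mult Q_def S1 by (simp_all only: gp_def gn_def diff_add_cancel mult_1_left)
  hence "(M (positive_column k B) + M (negative_column k B)) / x k = Yk'"
    using Y_nonzero[OF k_n] by (simp add: Yk'_def field_simps)
  thus ?thesis unfolding X toroidal_mutation_eq by (simp add: M Y'_def)
qed

text \<open>The upper bound in the sense of Berenstein, Fomin and Zelevinsky.\<close>

definition upper :: "nat \<Rightarrow> (nat \<Rightarrow> 'f::division_ring) \<Rightarrow> nat \<Rightarrow> nat \<Rightarrow> 'f seed \<Rightarrow> 'f set" where
  "upper r s n m X = {f \<in> torus r s n (fst X). \<forall>j\<in>{1..m}. f \<in> torus r s n (fst (toroidal_mutation r n s j X))}"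

text \<open>A neighbour of the mutated seed is either the original seed, by involutivity, or a
  mutation in two different directions, which is the case of
  \<open>laurent_exchange\<close>.\<close>

lemma upper_subset:
  assumes r: "1 \<le> r" and ok: "seed_ok r s n m X" and k: "k \<in> {1..m}"
  shows "upper r s n m X \<subseteq> upper r s n m (toroidal_mutation r n s k X)"
proof
  fix f assume f: "f \<in> upper r s n m X"
  obtain Y B where X: "X = (Y, B)" by fastforce
  obtain L D where "mutation r s n Y L m B D k" using seed_ok_mutation[OF _ k] ok unfolding X by blast
  then interpret mutation r s n Y L m B D k .
  have "f \<in> torus r s n (fst (toroidal_mutation r n s j (toroidal_mutation r n s k X)))" if j: "j \<in> {1..m}" for j
  proof (cases "j = k")
    case True
    thus ?thesis using f toroidal_mutation_involution[OF ok k] by (simp add: upper_def)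
  next
    case False
    interpret mutation_pair r s n Y L m B D k j by unfold_locales (use j False in auto)
    have "f \<in> torus r s n Y" "f \<in> torus r s n (fst (toroidal_mutation r n s k (Y, B)))"
      "f \<in> torus r s n (fst (toroidal_mutation r n s j (Y, B)))"
      using f j k unfolding upper_def X by auto
    hence "f \<in> V UNIV" "f \<in> mu.V UNIV" "f \<in> J.mu.V UNIV"
      unfolding toroidal_mutation_eq J.toroidal_mutation_eq fst_conv
        V_UNIV_eq_torus mu.V_UNIV_eq_torus J.mu.V_UNIV_eq_torus .
    hence "f \<in> KJ.mu.V UNIV" by (rule laurent_exchange[OF r])
    thus ?thesis unfolding X
      by (simp del: toroidal_mutation.simps add: toroidal_mutation_eq KJ.toroidal_mutation_eq KJ.mu.V_UNIV_eq_torus)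
  qed
  moreover have "f \<in> torus r s n (fst (toroidal_mutation r n s k X))" using f k by (simp add: upper_def)
  ultimately show "f \<in> upper r s n m (toroidal_mutation r n s k X)" by (simp add: upper_def)
qed

lemma variable_in_upper:
  assumes ok: "seed_ok r s n m X" and i: "i \<in> {1..n}"
  shows "fst X i \<in> upper r s n m X"
proof -
  obtain Y B where X: "X = (Y, B)" by fastforce
  obtain L D where sf: "seed_frame r s n Y L m B D" using ok unfolding X seed_ok_def by auto
  then interpret seed_frame r s n Y L m B D .
  have "Y i \<in> V UNIV" using V_M[of "unit_exp i" UNIV] by (simp add: M_unit[OF i])
  moreover have "Y i \<in> torus r s n (fst (toroidal_mutation r n s j X))" if j: "j \<in> {1..m}" for j
  proof -
    interpret mutation r s n Y L m B D j by unfold_locales (rule j)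
    have "Y i \<in> mu.V UNIV"
    proof (cases "i = j")
      case True
      thus ?thesis using Yk_in_mu by simp
    next
      case False
      thus ?thesis using mu.V_M[of "unit_exp i" UNIV] mu.M_unit[OF i] by (simp add: Y'_def)
    qed
    thus ?thesis unfolding X toroidal_mutation_eq by (simp add: mu.V_UNIV_eq_torus)
  qed
  ultimately show ?thesis by (simp add: upper_def X V_UNIV_eq_torus)
qed

lemma mutate_along_snoc: "mutate_along \<mu> (ks @ [k]) X = \<mu> k (mutate_along \<mu> ks X)"
  by (simp add: mutate_along_def)

lemma mutate_along_append: "mutate_along \<mu> (ks @ ls) X = mutate_along \<mu> ls (mutate_along \<mu> ks X)"
  by (simp add: mutate_along_def)

lemma mutate_along_Nil [simp]: "mutate_along \<mu> [] X = X"
  by (simp add: mutate_along_def)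

lemma seed_ok_mutate_along:
  assumes "seed_ok r s n m X" "set ks \<subseteq> {1..m}"
  shows "seed_ok r s n m (mutate_along (toroidal_mutation r n s) ks X)"
  using assms(2)
  by (induction ks rule: rev_induct) (auto simp: assms(1) mutate_along_snoc intro!: seed_ok_toroidal_mutation)

lemma mutate_along_rev:
  assumes "seed_ok r s n m X" "set ks \<subseteq> {1..m}"
  shows "mutate_along (toroidal_mutation r n s) (rev ks) (mutate_along (toroidal_mutation r n s) ks X) = X"
  using assms(2)
proof (induction ks rule: rev_induct)
  case (snoc k ks)
  have "mutate_along (toroidal_mutation r n s) (rev (ks @ [k])) (mutate_along (toroidal_mutation r n s) (ks @ [k]) X) =
    mutate_along (toroidal_mutation r n s) (rev ks)
      (toroidal_mutation r n s k (toroidal_mutation r n s k (mutate_along (toroidal_mutation r n s) ks X)))"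
    by (simp add: mutate_along_snoc) (simp add: mutate_along_def)
  moreover have "toroidal_mutation r n s k (toroidal_mutation r n s k (mutate_along (toroidal_mutation r n s) ks X)) =
      mutate_along (toroidal_mutation r n s) ks X"
    by (rule toroidal_mutation_involution[OF seed_ok_mutate_along[OF assms(1)]]) (use snoc.prems in auto)
  ultimately show ?case using snoc by simp
qed simp

text \<open>A variable lies in the upper bound of its own seed; walking back along the sequence,
  each mutation keeps it in the upper bound.\<close>

theorem laurent_phenomenon:
  assumes r: "1 \<le> r" and ok: "seed_ok r s n m X" and ks: "set ks \<subseteq> {1..m}" and i: "i \<in> {1..n}"
  shows "fst (mutate_along (toroidal_mutation r n s) ks X) i \<in> torus r s n (fst X)"
proof -
  have "upper r s n m (mutate_along (toroidal_mutation r n s) ks X) \<subseteq> upper r s n m X"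
    using ks
  proof (induction ks rule: rev_induct)
    case (snoc k ks)
    let ?X = "mutate_along (toroidal_mutation r n s) ks X"
    have ok': "seed_ok r s n m ?X" using snoc.prems by (intro seed_ok_mutate_along[OF ok]) auto
    have k: "k \<in> {1..m}" using snoc.prems by auto
    from upper_subset[OF r seed_ok_toroidal_mutation[OF ok' k] k]
    have "upper r s n m (toroidal_mutation r n s k ?X) \<subseteq> upper r s n m ?X"
      unfolding toroidal_mutation_involution[OF ok' k] .
    thus ?case using snoc by (auto simp: mutate_along_snoc)
  qed simp
  moreover have "fst (mutate_along (toroidal_mutation r n s) ks X) i \<in> upper r s n m (mutate_along (toroidal_mutation r n s) ks X)"
    by (rule variable_in_upper[OF seed_ok_mutate_along[OF ok ks] i])
  ultimately show ?thesis by (auto simp: upper_def)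
qed

lemma classical_mutate_along_eq_toroidal:
  fixes X :: "'c::field seed"
  assumes "seed_ok 0 s n m X" "set ks \<subseteq> {1..m}"
  shows "mutate_along (classical_mutation n) ks X = mutate_along (toroidal_mutation 0 n s) ks X"
  using assms(2)
  by (induction ks rule: rev_induct)
    (auto simp: mutate_along_snoc intro!: classical_mutation_eq_toroidal seed_ok_mutate_along[OF assms(1)])

section \<open>Specialization and the bar involution\<close>

text \<open>Builds a monomial one variable at a time, for properties known of single variables and
  needed for the monomials of exchange relations.\<close>

lemma nonneg_exponent_induct:
  fixes u :: "nat \<Rightarrow> int"
  assumes "\<And>i. i \<in> {1..n} \<Longrightarrow> 0 \<le> u i"
    and zero: "\<And>u. (\<And>i. i \<in> {1..n} \<Longrightarrow> u i = 0) \<Longrightarrow> P u"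
    and step: "\<And>i u. i \<in> {1..n} \<Longrightarrow> P u \<Longrightarrow> P (unit_exp i + u)"
  shows "P u"
  using assms(1)
proof (induction "nat (\<Sum>i\<in>{1..n}. u i)" arbitrary: u)
  case 0
  hence "(\<Sum>i\<in>{1..n}. u i) \<le> 0" by simp
  moreover have "0 \<le> (\<Sum>i\<in>{1..n}. u i)" using 0 by (intro sum_nonneg) auto
  ultimately have "(\<Sum>i\<in>{1..n}. u i) = 0" by simp
  hence "\<forall>i\<in>{1..n}. u i = 0" using 0 by (subst (asm) sum_nonneg_eq_0_iff) auto
  thus ?case by (intro zero) auto
next
  case (Suc K)
  have "(\<Sum>i\<in>{1..n}. u i) \<noteq> 0" using Suc.hyps(2) by auto
  then obtain i where i: "i \<in> {1..n}" "u i \<noteq> 0" by (meson sum.neutral)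
  let ?v = "u - unit_exp i"
  have "(\<Sum>l\<in>{1..n}. ?v l) = (\<Sum>l\<in>{1..n}. u l) - 1"
    using sum_unit_exp[of "{1..n}" i "\<lambda>_. 1 :: int"] i(1) by (simp add: sum_subtractf)
  hence "K = nat (\<Sum>l\<in>{1..n}. ?v l)" using Suc.hyps(2) by simp
  moreover have "0 \<le> ?v l" if "l \<in> {1..n}" for l
    using Suc.prems[OF that] Suc.prems[OF i(1)] i(2) by (cases "l = i") auto
  ultimately have "P ?v" by (rule Suc.hyps(1))
  from step[OF i(1) this] show ?case by simp
qed

context quasi_torus
begin

lemma V_S: "S e \<in> V {0}"
  using V_monomial[of 0 "{0}" e] by simp

lemma M_add_unit: "M (u + v) = S (\<lambda>a. - lam a u v) * (M u * M v)"
proof -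
  have "S (\<lambda>a. - lam a u v) * (M u * M v) = S ((\<lambda>a. - lam a u v) + (\<lambda>a. lam a u v)) * M (u + v)"
    by (simp only: M_mult Q_def S_mult_S)
  also have "(\<lambda>a. - lam a u v) + (\<lambda>a. lam a u v) = 0" by auto
  finally show ?thesis by (simp only: S_0 mult_1_left)
qed

lemma monomial_mult: "(S e * M u) * (S f * M v) = S (e + f + (\<lambda>a. lam a u v)) * M (u + v)"
proof -
  have "(S e * M u) * (S f * M v) = S e * (S f * (M u * M v))"
    by (simp add: S_left_commute[of "M u"] mult.assoc)
  thus ?thesis by (simp only: M_mult Q_def S_mult_S add.assoc)
qed

text \<open>Lets multiplicativity of an additively defined map be checked on monomials.\<close>

lemma bilinear_eqI:
  assumes mono: "\<And>e u f v. P (S e * M u) (S f * M v)"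
    and "\<And>x. P x 0" "\<And>x. P 0 x"
    and "\<And>x y z. x \<in> V UNIV \<Longrightarrow> y \<in> V UNIV \<Longrightarrow> z \<in> V UNIV \<Longrightarrow> P x z \<Longrightarrow> P y z \<Longrightarrow> P (x - y) z"
    and "\<And>x y z. x \<in> V UNIV \<Longrightarrow> y \<in> V UNIV \<Longrightarrow> z \<in> V UNIV \<Longrightarrow> P z x \<Longrightarrow> P z y \<Longrightarrow> P z (x - y)"
    and "x \<in> V UNIV" "y \<in> V UNIV"
  shows "P x y"
  using assms(6)
proof (induction rule: V_induct)
  case (monomial e u)
  show ?case using assms(7)
    by (induction rule: V_induct) (use assms V_monomial[of u UNIV e] in auto)
qed (use assms in auto)

end

context quantum_frame
begin

lemma V_coordinates:
  assumes "f \<in> V UNIV" "\<And>l. l \<in> {1..n} \<Longrightarrow> f \<in> V {u. u l = w l}"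
  shows "f \<in> V {u. \<forall>l\<in>{1..n}. u l = w l}"
proof -
  have "N \<le> n \<Longrightarrow> f \<in> V {u. \<forall>l\<in>{1..N}. u l = w l}" for N
  proof (induction N)
    case 0
    show ?case using assms(1) by simp
  next
    case (Suc N)
    have N: "Suc N \<in> {1..n}" using Suc.prems by auto
    have "f \<in> V ({u. \<forall>l\<in>{1..N}. u l = w l} \<inter> {u. u (Suc N) = w (Suc N)})"
      by (rule V_Int) (use Suc assms(2)[OF N] determined_Collect[OF grading_coordinate[OF N], of "\<lambda>x. x = w (Suc N)"] in auto)
    thus ?case by (rule V_mono') (auto simp: le_Suc_eq)
  qed
  from this[of n] show ?thesis by simp
qed

text \<open>On the torus this is the ring homomorphism to the integers that sends every
  \<open>s a\<close> and every variable to 1.\<close>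

definition eps :: "'a \<Rightarrow> int" where
  "eps = ext (\<lambda>_ _. 1)"

lemmas eps_props = ext_props[of "\<lambda>_ _. 1 :: int", OF refl, folded eps_def]

lemma eps_mult: "x \<in> V UNIV \<Longrightarrow> y \<in> V UNIV \<Longrightarrow> eps (x * y) = eps x * eps y"
  by (rule bilinear_eqI[where P = "\<lambda>x y. eps (x * y) = eps x * eps y"])
    (simp_all only: monomial_mult eps_props left_diff_distrib right_diff_distrib V_UNIV_mult mult_zero_left mult_zero_right)

text \<open>It reverses products: exchanging \<open>u\<close> and \<open>v\<close> inverts the
  scalar \<open>Q u v\<close>, just as inverting the \<open>s a\<close> does.\<close>

definition bar :: "'a \<Rightarrow> 'a" where
  "bar = ext (\<lambda>e u. S (- e) * M u)"

lemma S_minus_M_trim: "S (- trim r e) * M (trim n u) = S (- e) * M u"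
  by (simp add: M_trim S_minus S_trim)

lemmas bar_props = ext_props[of "\<lambda>e u. S (- e) * M u", OF S_minus_M_trim, folded bar_def]

lemma bar_in_V: "x \<in> V U \<Longrightarrow> bar x \<in> V U"
  by (induction rule: V_induct)
    (auto simp: bar_props(1,2) bar_props(3)[OF V_UNIV V_UNIV] intro: V_monomial V_diff)

lemma bar_mult: "x \<in> V UNIV \<Longrightarrow> y \<in> V UNIV \<Longrightarrow> bar (x * y) = bar y * bar x"
proof (rule bilinear_eqI[where P = "\<lambda>x y. bar (x * y) = bar y * bar x"])
  fix e u f v
  have "S (- (e + f + (\<lambda>a. lam a u v))) * M (u + v) = S (- f + - e + (\<lambda>a. lam a v u)) * M (v + u)"
    by (intro arg_cong2[where f = times] S_cong M_cong) (auto simp: lam_skew[of _ u v])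
  thus "bar (S e * M u * (S f * M v)) = bar (S f * M v) * bar (S e * M u)"
    by (simp only: monomial_mult bar_props(1))
qed (simp_all add: bar_props(2,3) left_diff_distrib right_diff_distrib V_UNIV_mult)

lemma bar_S: "bar (S e) = S (- e)"
  using bar_props(1)[of e 0] by simp

lemma bar_S_mult: "x \<in> V UNIV \<Longrightarrow> bar (S e * x) = S (- e) * bar x"
  using bar_mult[OF V_UNIV[OF V_S]] by (simp add: bar_S S_central[symmetric])

text \<open>Positivity is asked only of a coefficient sum, which is weak enough to pass to
  quotients. A positive sum also makes \<open>y\<close> nonzero, so \<open>d\<close> really is the
  top degree of \<open>f\<close>.\<close>

definition positive_top :: "((nat \<Rightarrow> int) \<Rightarrow> int) \<Rightarrow> 'a \<Rightarrow> bool" where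
  "positive_top l f \<longleftrightarrow> (\<exists>d y z. y \<in> V {u. l u = d} \<and> z \<in> V {u. l u < d} \<and> f = y + z \<and> eps y > 0)"

lemma positive_top_monomial: "positive_top l (S e * M u)"
  unfolding positive_top_def
  by (intro exI[of _ "l u"] exI[of _ "S e * M u"] exI[of _ 0]) (auto simp: eps_props intro!: V_monomial)

lemma top_mult:
  assumes l: "grading l" and "y \<in> V {u. l u = d}" "z \<in> V {u. l u < d}" "y' \<in> V {u. l u = d'}" "z' \<in> V {u. l u < d'}"
  shows "y * y' \<in> V {u. l u = d + d'}" "y * z' + z * (y' + z') \<in> V {u. l u < d + d'}"
proof -
  show "y * y' \<in> V {u. l u = d + d'}" by (rule V_mult_level[OF l]) fact+
  have yz: "y' + z' \<in> V {u. l u \<le> d'}"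
    by (intro V_add V_mono'[OF assms(4)] V_mono'[OF assms(5)]) auto
  show "y * z' + z * (y' + z') \<in> V {u. l u < d + d'}"
    by (intro V_add V_mult[OF assms(2,5)] V_mult[OF assms(3) yz]) (auto simp: grading_add[OF l])
qed

lemma positive_top_mult:
  assumes l: "grading l" and "positive_top l f" "positive_top l g"
  shows "positive_top l (f * g)"
proof -
  obtain d y z where f: "y \<in> V {u. l u = d}" "z \<in> V {u. l u < d}" "f = y + z" "eps y > 0"
    using assms(2) unfolding positive_top_def by blast
  obtain d' y' z' where g: "y' \<in> V {u. l u = d'}" "z' \<in> V {u. l u < d'}" "g = y' + z'" "eps y' > 0"
    using assms(3) unfolding positive_top_def by blast
  have "eps (y * y') > 0" using f g eps_mult[OF V_UNIV V_UNIV] by simp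
  moreover have "f * g = y * y' + (y * z' + z * (y' + z'))" using f g by (simp add: algebra_simps)
  ultimately show ?thesis unfolding positive_top_def using top_mult[OF l f(1,2) g(1,2)] by blast
qed

lemma positive_top_add:
  assumes "positive_top l f" "positive_top l g"
  shows "positive_top l (f + g)"
proof -
  obtain d y z where f: "y \<in> V {u. l u = d}" "z \<in> V {u. l u < d}" "f = y + z" "eps y > 0"
    using assms(1) unfolding positive_top_def by blast
  obtain d' y' z' where g: "y' \<in> V {u. l u = d'}" "z' \<in> V {u. l u < d'}" "g = y' + z'" "eps y' > 0"
    using assms(2) unfolding positive_top_def by blast
  consider "d < d'" | "d = d'" | "d' < d" by linarith
  thus ?thesis
  proof cases
    case 1
    have "y + z + z' \<in> V {u. l u < d'}" using f g 1 by (auto intro!: V_add elim!: V_mono')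
    thus ?thesis unfolding positive_top_def using f g
      by (intro exI[of _ d'] exI[of _ y'] exI[of _ "y + z + z'"]) (simp add: algebra_simps)
  next
    case 2
    have "eps (y + y') > 0" using f g eps_props(4)[OF V_UNIV V_UNIV] by simp
    thus ?thesis unfolding positive_top_def using f g 2
      by (intro exI[of _ d'] exI[of _ "y + y'"] exI[of _ "z + z'"]) (auto simp: algebra_simps intro: V_add)
  next
    case 3
    have "y' + z' + z \<in> V {u. l u < d}" using f g 3 by (auto intro!: V_add elim!: V_mono')
    thus ?thesis unfolding positive_top_def using f g
      by (intro exI[of _ d] exI[of _ y] exI[of _ "y' + z' + z"]) (simp add: algebra_simps)
  qed
qed

text \<open>Without zero divisors the top of \<open>f * g\<close> is the product of the tops, and
  \<open>eps\<close> is multiplicative. This carries positivity across the division by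
  \<open>Y k\<close> in an exchange relation.\<close>

lemma positive_top_left_factor:
  assumes l: "grading l" and f: "f \<in> V UNIV" and "positive_top l g" "positive_top l (f * g)"
  shows "positive_top l f"
proof -
  obtain d' y' z' where g: "y' \<in> V {u. l u = d'}" "z' \<in> V {u. l u < d'}" "g = y' + z'" "eps y' > 0"
    using assms(3) unfolding positive_top_def by blast
  obtain b w v where fg: "w \<in> V {u. l u = b}" "v \<in> V {u. l u < b}" "f * g = w + v" "eps w > 0"
    using assms(4) unfolding positive_top_def by blast
  have nz: "w \<noteq> 0" "y' \<noteq> 0" using fg(4) g(4) eps_props(2) by auto
  have "f \<noteq> 0"
  proof
    assume "f = 0"
    hence "w = - v" using fg(3) by (simp add: eq_neg_iff_add_eq_0)
    hence "w \<in> V {u. l u < b}" using V_uminus[OF fg(2)] by simp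
    hence "w = 0" using V_level_disjoint[OF l fg(1), of "{u. l u < b}"] by auto
    thus False using nz by simp
  qed
  then obtain d y z where yz: "y \<in> V {u. l u = d}" "y \<noteq> 0" "z \<in> V {u. l u < d}" "f = y + z"
    using V_top[OF f, of l, unfolded Int_UNIV_left] by blast
  have "w + v = y * y' + (y * z' + z * (y' + z'))" unfolding fg(3)[symmetric] yz(4) g(3) by (simp add: algebra_simps)
  from V_top_unique(2)[OF l this fg(1,2) top_mult[OF l yz(1,3) g(1,2)]] nz yz(2)
  have "w = y * y'" by simp
  hence "eps y * eps y' > 0" using fg(4) eps_mult[OF V_UNIV[OF yz(1)] V_UNIV[OF g(1)]] by simp
  hence "eps y > 0" using g(4) by (simp add: zero_less_mult_iff)
  thus ?thesis unfolding positive_top_def using yz by blast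
qed

end

section \<open>Specialization to the commutative torus\<close>

locale specialization = quantum_frame r s n Y L + c: quantum_frame 0 s0 n x Lc
  for r and s :: "nat \<Rightarrow> 'f::division_ring" and n Y L and s0 :: "nat \<Rightarrow> 'c::field" and x Lc
begin

lemma c_S [simp]: "c.S e = 1"
  by (simp add: c.S_def)

lemma c_Q [simp]: "c.Q u v = 1"
  by (simp add: c.Q_def)

definition sp :: "'f \<Rightarrow> 'c" where
  "sp = ext (\<lambda>e u. c.M u)"

lemmas sp_props = ext_props[of "\<lambda>e u. c.M u", OF c.M_trim, folded sp_def]

lemma sp_mult: "y \<in> V UNIV \<Longrightarrow> z \<in> V UNIV \<Longrightarrow> sp (y * z) = sp y * sp z"
proof (rule bilinear_eqI[where P = "\<lambda>y z. sp (y * z) = sp y * sp z"])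
  fix e u f v
  show "sp (S e * M u * (S f * M v)) = sp (S e * M u) * sp (S f * M v)"
    unfolding monomial_mult sp_props(1) c.M_mult by simp
qed (simp_all add: sp_props(2,3) left_diff_distrib right_diff_distrib V_UNIV_mult)

lemma sp_S: "sp (S e) = 1"
  using sp_props(1)[of e 0] by simp

lemma sp_S_mult: "y \<in> V UNIV \<Longrightarrow> sp (S e * y) = sp y"
  using sp_mult[OF V_UNIV[OF V_S]] by (simp add: sp_S)

lemma sp_in_V: "y \<in> V U \<Longrightarrow> sp y \<in> c.V U"
  by (induction rule: V_induct)
    (auto simp: sp_props(1,2) sp_props(3)[OF V_UNIV V_UNIV] intro: c.V_M c.V_diff)

text \<open>Specialization merges coefficients of equal monomials, which leaves their total
  unchanged.\<close>

lemma eps_sp: "y \<in> V UNIV \<Longrightarrow> c.eps (sp y) = eps y"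
proof (induction rule: V_induct)
  case (monomial e u)
  show ?case using c.eps_props(1)[of 0 u] by (simp add: sp_props(1) eps_props(1))
next
  case (diff y z)
  thus ?case by (simp add: sp_props(3) eps_props(3) c.eps_props(3) sp_in_V)
qed (simp add: sp_props(2) eps_props(2) c.eps_props(2))

text \<open>The invariant carried along mutations. It is always measured in the torus of the fixed
  base seed, also for variables of distant seeds.\<close>

definition compatible_variable :: "'f \<Rightarrow> 'c \<Rightarrow> bool" where
  "compatible_variable y z \<longleftrightarrow> y \<in> V UNIV \<and> sp y = z \<and> bar y = y \<and> (\<forall>l. grading l \<longrightarrow> positive_top l y)"

text \<open>\<open>Yk' * Y k\<close> is a sum of two monomials in the old variables; these inherit
  specialization, bar invariance and positive tops, and then \<open>Y k\<close> is cancelled.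
  Membership of \<open>Yk'\<close> in the base torus has to be supplied by the Laurent
  phenomenon.\<close>

lemma compatible_variable_step:
  assumes q: "mutation r s n Y2 L2 m B2 D2 k" and p: "mutation 0 s0 n x2 Lc2 m B2 Dc2 k"
    and cv: "\<And>i. i \<in> {1..n} \<Longrightarrow> compatible_variable (Y2 i) (x2 i)"
    and mem: "mutation.Yk' r s n Y2 L2 B2 k \<in> V UNIV"
  shows "compatible_variable (mutation.Yk' r s n Y2 L2 B2 k) (mutation.Yk' 0 s0 n x2 Lc2 B2 k)"
proof -
  interpret q: mutation r s n Y2 L2 m B2 D2 k by (rule q)
  interpret p: mutation 0 s0 n x2 Lc2 m B2 Dc2 k by (rule p)
  have mono: "compatible_variable (q.M u) (p.M u)" if "\<And>i. i \<in> {1..n} \<Longrightarrow> 0 \<le> u i" for u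
    using that
  proof (rule nonneg_exponent_induct)
    fix u :: "nat \<Rightarrow> int" assume u: "\<And>i. i \<in> {1..n} \<Longrightarrow> u i = 0"
    have "q.M u = q.M 0" by (rule q.M_cong) (use u in auto)
    moreover have "p.M u = p.M 0" by (rule p.M_cong) (use u in auto)
    ultimately have "q.M u = S 0 * M 0" "p.M u = c.M 0" by simp_all
    thus "compatible_variable (q.M u) (p.M u)" unfolding compatible_variable_def
      by (auto simp only: sp_props(1) bar_props(1) positive_top_monomial intro!: V_monomial) (simp_all add: V_1)
  next
    fix i and u :: "nat \<Rightarrow> int"
    assume i: "i \<in> {1..n}" and IH: "compatible_variable (q.M u) (p.M u)"
    let ?e = "\<lambda>a. - q.lam a (unit_exp i) u" and ?e' = "\<lambda>a. - q.lam a u (unit_exp i)"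
    have qM: "q.M (unit_exp i + u) = S ?e * (Y2 i * q.M u)"
      using q.M_add_unit[of "unit_exp i" u] by (simp only: q.M_unit[OF i])
    have qM': "q.M (unit_exp i + u) = S ?e' * (q.M u * Y2 i)"
      using q.M_add_unit[of u "unit_exp i"] by (simp only: q.M_unit[OF i] add.commute[of u])
    \<comment> \<open>The same monomial is written with its factors in both orders, since
      \<open>bar\<close> reverses the product and inverts the scalar.\<close>
    have "S ?e' = S (- ?e)" by (rule S_cong) (simp add: q.lam_skew[of _ u "unit_exp i"])
    hence qM'': "q.M (unit_exp i + u) = S (- ?e) * (q.M u * Y2 i)" using qM' by (simp only:)
    have pM: "p.M (unit_exp i + u) = x2 i * p.M u"
      using p.M_mult[of "unit_exp i" u] by (simp add: p.M_unit[OF i] p.Q_def)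
    have Yi: "Y2 i \<in> V UNIV" "sp (Y2 i) = x2 i" "bar (Y2 i) = Y2 i" "\<And>l. grading l \<Longrightarrow> positive_top l (Y2 i)"
      using cv[OF i] by (auto simp: compatible_variable_def)
    have Mu: "q.M u \<in> V UNIV" "sp (q.M u) = p.M u" "bar (q.M u) = q.M u" "\<And>l. grading l \<Longrightarrow> positive_top l (q.M u)"
      using IH by (auto simp: compatible_variable_def)
    have "positive_top l (S ?e * (Y2 i * q.M u))" if l: "grading l" for l
      using positive_top_mult[OF l positive_top_monomial[of l ?e 0] positive_top_mult[OF l Yi(4)[OF l] Mu(4)[OF l]]]
      by simp
    moreover have "bar (S ?e * (Y2 i * q.M u)) = q.M (unit_exp i + u)"
      unfolding qM'' bar_S_mult[OF V_UNIV_mult[OF Yi(1) Mu(1)]] bar_mult[OF Yi(1) Mu(1)] Yi(3) Mu(3) ..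
    moreover have "sp (S ?e * (Y2 i * q.M u)) = x2 i * p.M u"
      by (simp add: sp_S_mult V_UNIV_mult sp_mult Yi Mu)
    ultimately show "compatible_variable (q.M (unit_exp i + u)) (p.M (unit_exp i + u))"
      unfolding compatible_variable_def pM using qM Yi(1) Mu(1) by (auto intro!: V_S_mult V_UNIV_mult)
  qed
  let ?P = "positive_column k B2" and ?N = "negative_column k B2"
  let ?a = "\<lambda>a. q.lam a (q.gp k) (unit_exp k)" and ?b = "\<lambda>a. q.lam a (q.gn k) (unit_exp k)"
  have P: "q.M ?P \<in> V UNIV" "sp (q.M ?P) = p.M ?P" "bar (q.M ?P) = q.M ?P" "\<And>l. grading l \<Longrightarrow> positive_top l (q.M ?P)"
    using mono[of ?P] by (auto simp: compatible_variable_def positive_column_def)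
  have N: "q.M ?N \<in> V UNIV" "sp (q.M ?N) = p.M ?N" "bar (q.M ?N) = q.M ?N" "\<And>l. grading l \<Longrightarrow> positive_top l (q.M ?N)"
    using mono[of ?N] by (auto simp: compatible_variable_def negative_column_def)
  have Yk: "Y2 k \<in> V UNIV" "sp (Y2 k) = x2 k" "bar (Y2 k) = Y2 k" "\<And>l. grading l \<Longrightarrow> positive_top l (Y2 k)"
    using cv[OF q.k_n] by (auto simp: compatible_variable_def)
  have SPN: "S ?a * q.M ?P \<in> V UNIV" "S ?b * q.M ?N \<in> V UNIV" using P N by (auto intro: V_S_mult)
  note ex = q.exchange_relation
  have "sp q.Yk' * x2 k = p.Yk' * x2 k"
  proof -
    have "sp q.Yk' * x2 k = sp (q.Yk' * Y2 k)" by (simp add: sp_mult mem Yk)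
    also have "\<dots> = p.M ?P + p.M ?N" unfolding ex sp_props(4)[OF SPN] by (simp add: sp_S_mult P N)
    also have "\<dots> = p.Yk' * x2 k" unfolding p.exchange_relation by simp
    finally show ?thesis .
  qed
  hence "sp q.Yk' = p.Yk'" using p.Y_nonzero[OF q.k_n] by simp
  moreover have "bar q.Yk' = q.Yk'"
  proof -
    have "Y2 k * bar q.Yk' = bar (q.Yk' * Y2 k)" by (simp add: bar_mult mem Yk)
    also have "\<dots> = S (- ?a) * q.M ?P + S (- ?b) * q.M ?N"
      unfolding ex bar_props(4)[OF SPN] by (simp only: bar_S_mult[OF P(1)] bar_S_mult[OF N(1)] P(3) N(3))
    also have "\<dots> = Y2 k * q.Yk'" unfolding q.exchange_relation_right by (simp add: fun_Compl_def)
    finally show ?thesis using q.Y_nonzero[OF q.k_n] by simp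
  qed
  moreover have "positive_top l q.Yk'" if l: "grading l" for l
  proof (rule positive_top_left_factor[OF l mem Yk(4)[OF l]])
    have "positive_top l (S ?a * q.M ?P)" "positive_top l (S ?b * q.M ?N)"
      using positive_top_mult[OF l positive_top_monomial[of l ?a 0] P(4)[OF l]]
        positive_top_mult[OF l positive_top_monomial[of l ?b 0] N(4)[OF l]] by simp_all
    thus "positive_top l (q.Yk' * Y2 k)" unfolding ex by (rule positive_top_add)
  qed
  ultimately show ?thesis using mem by (simp add: compatible_variable_def)
qed

lemma compatible_variable_base:
  assumes "i \<in> {1..n}"
  shows "compatible_variable (Y i) (x i)"
proof -
  have "Y i = S 0 * M (unit_exp i)" "x i = c.M (unit_exp i)" using M_unit c.M_unit assms by simp_all
  thus ?thesis unfolding compatible_variable_def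
    by (auto simp only: sp_props(1) bar_props(1) positive_top_monomial intro!: V_monomial) simp_all
qed

text \<open>The extreme degrees of \<open>y\<close> survive specialization, so \<open>y\<close> has the exponents of its specialization.\<close>
lemma compatible_variable_rigid:
  assumes cv: "compatible_variable y (x i)" and i: "i \<in> {1..n}"
  obtains c where "c \<in> V {u. \<forall>l\<in>{1..n}. u l = 0}" "y = c * Y i" "bar c = c" "sp c = 1"
proof -
  have y: "y \<in> V UNIV" "sp y = x i" "bar y = y" "\<And>l. grading l \<Longrightarrow> positive_top l y"
    using cv by (auto simp: compatible_variable_def)
  have bound: "y \<in> V {u. l u \<le> l (unit_exp i)}" if l: "grading l" for l
  proof -
    obtain d h z where h: "h \<in> V {u. l u = d}" "z \<in> V {u. l u < d}" "y = h + z" "eps h > 0"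
      using y(4)[OF l] unfolding positive_top_def by blast
    \<comment> \<open>The positive sum keeps the top component alive under \<open>sp\<close>, so its
      degree must be the degree of the monomial \<open>x i\<close>.\<close>
    have "c.eps (sp h) > 0" using h(4) eps_sp[OF V_UNIV[OF h(1)]] by simp
    hence "sp h \<noteq> 0" using c.eps_props(2) by auto
    have "sp h + sp z = c.M (unit_exp i) + 0"
      using y(2) sp_props(4)[OF V_UNIV[OF h(1)] V_UNIV[OF h(2)]] by (simp add: h(3) c.M_unit[OF i])
    from c.V_top_unique(1)[OF l this sp_in_V[OF h(1)] sp_in_V[OF h(2)] c.V_M[of "unit_exp i" "{u. l u = l (unit_exp i)}"]]
    have "d = l (unit_exp i)" using \<open>sp h \<noteq> 0\<close> by simp
    thus ?thesis using h by (auto intro!: V_add elim!: V_mono')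
  qed
  have "y \<in> V {u. u l = unit_exp i l}" if "l \<in> {1..n}" for l
  proof -
    note gr = grading_coordinate[OF that]
    \<comment> \<open>Upper bounds for a coordinate and for its negative pin the coordinate
      down.\<close>
    have "y \<in> V ({u. u l \<le> unit_exp i l} \<inter> {u. - u l \<le> - unit_exp i l})"
      using bound[OF gr] bound[OF grading_minus[OF gr]] determined_Collect[OF grading_minus[OF gr], of "\<lambda>x. x \<le> - unit_exp i l"]
      by (rule V_Int)
    thus ?thesis by (rule V_mono') auto
  qed
  hence yV: "y \<in> V {u. \<forall>l\<in>{1..n}. u l = unit_exp i l}" by (rule V_coordinates[OF y(1)])
  let ?c = "y * M (- unit_exp i)"
  have c: "?c \<in> V {u. \<forall>l\<in>{1..n}. u l = 0}"
    by (rule V_mult[OF yV V_M[of "- unit_exp i" "{- unit_exp i}"]]) auto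
  have ycY: "y = ?c * Y i" using Y_nonzero[OF i] by (simp add: M_minus M_unit[OF i] mult.assoc)
  have Yi: "Y i \<in> V UNIV" "bar (Y i) = Y i" "sp (Y i) = x i"
    using compatible_variable_base[OF i] by (auto simp: compatible_variable_def)
  have central: "k * z = z * k" if "k \<in> V {u. \<forall>l\<in>{1..n}. u l = 0}" for k z
    using that
  proof (induction rule: V_induct)
    case (monomial e u)
    have "M u = M 0" by (rule M_cong) (use monomial in auto)
    thus ?case by (simp add: S_central)
  qed (auto simp: algebra_simps)
  have "bar ?c * Y i = bar (?c * Y i)"
    unfolding bar_mult[OF V_UNIV[OF c] Yi(1)] Yi(2) by (rule central[OF bar_in_V[OF c]])
  hence "bar ?c * Y i = ?c * Y i" using ycY y(3) by simp
  hence 1: "bar ?c = ?c" using Y_nonzero[OF i] by simp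
  have "sp ?c * x i = x i" using sp_mult[OF V_UNIV[OF c] Yi(1)] ycY y(2) Yi(3) by simp
  hence "sp ?c = 1" using c.Y_nonzero[OF i] by simp
  thus ?thesis using that c ycY 1 by blast
qed

end

section \<open>Comparison of toroidal and classical seeds\<close>

lemma int_independent_reindex:
  assumes b: "int_independent b I" and \<phi>: "inj_on \<phi> J" "\<phi> ` J \<subseteq> I" and eq: "\<And>j. j \<in> J \<Longrightarrow> b' j = b (\<phi> j)"
  shows "int_independent b' J"
proof (rule int_independentI)
  fix A c assume A: "finite A" "A \<subseteq> J" "(\<Sum>j\<in>A. of_int (c j) * b' j) = 0"
  have inj: "inj_on \<phi> A" using \<phi>(1) A(2) by (rule inj_on_subset)
  let ?g = "inv_into A \<phi>"
  have "(\<Sum>i\<in>\<phi> ` A. of_int (c (?g i)) * b i) = (\<Sum>j\<in>A. of_int (c (?g (\<phi> j))) * b (\<phi> j))"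
    by (rule sum.reindex[OF inj, unfolded o_def])
  also have "\<dots> = (\<Sum>j\<in>A. of_int (c j) * b' j)"
    by (rule sum.cong[OF refl]) (use A(2) eq inj in \<open>auto simp: inv_into_f_f\<close>)
  also have "\<dots> = 0" by fact
  finally have "c (?g i) = 0" if "i \<in> \<phi> ` A" for i
    using int_independentD[OF b _ _ _ that, of "\<lambda>i. c (?g i)"] A \<phi>(2) by blast
  thus "\<forall>j\<in>A. c j = 0" using inj by (metis imageI inv_into_f_f)
qed

lemma scalars_0I:
  assumes "\<And>z. of_int z = (0 :: 'f::division_ring) \<Longrightarrow> z = 0"
  shows "scalars 0 (s :: nat \<Rightarrow> 'f)"
proof
  show "int_independent (ordered_monomial 0 s) (exponents 0)"
  proof (rule int_independentI)
    fix A c assume A: "finite A" "A \<subseteq> exponents 0" "(\<Sum>i\<in>A. of_int (c i) * ordered_monomial 0 s i) = 0"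
    have "A \<subseteq> {\<lambda>_. 0}" using A(2) by (auto simp: exponents_def)
    then consider "A = {}" | "A = {\<lambda>_. 0}" by blast
    thus "\<forall>i\<in>A. c i = 0" by cases (use A(3) assms in auto)
  qed
qed auto

section \<open>Bar invariant units of the base ring\<close>

context scalars
begin

lemma of_int_eq_0_imp: "of_int z = (0 :: 'f) \<Longrightarrow> z = 0"
  using int_independentD[OF s_independent, of "{\<lambda>_. 0}" "\<lambda>_. z" "\<lambda>_. 0"]
  by (simp add: exponents_def ordered_monomial_zero_exp)

text \<open>The base ring is treated as a torus of its own, with the \<open>s a\<close> as variables
  and the integers as scalars, so that degrees in the \<open>s a\<close> obey the lemmas on
  gradings.\<close>

lemma scalar_frame: "quantum_frame 0 s r s (\<lambda>_ _ _. 0)"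
proof -
  interpret K: scalars 0 s by (rule scalars_0I) (rule of_int_eq_0_imp)
  have "quasi_commute 0 r s (\<lambda>_ _ _. 0) s"
    unfolding quasi_commute_def t_monomial_def ordered_monomial_0 mult_1_left by (intro ballI s_central)
  then interpret K: quasi_torus 0 s r s "\<lambda>_ _ _. 0"
    by unfold_locales (use s_nonzero in auto)
  have "int_independent (\<lambda>(e, u). K.S e * K.M u) (exponents 0 \<times> exponents r)"
  proof (rule int_independent_reindex[OF s_independent, of snd])
    show "inj_on snd (exponents 0 \<times> exponents r)" by (auto simp: inj_on_def exponents_def fun_eq_iff)
    show "(case j of (e, u) \<Rightarrow> K.S e * K.M u) = ordered_monomial r s (snd j)" for j
      by (auto simp: K.S_def K.M_def split: prod.splits)
  qed auto
  thus ?thesis by unfold_locales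
qed

text \<open>Stated with some additive map in place of \<open>bar\<close>, because \<open>bar\<close>
  depends on a frame and the property is needed for constants coming from two different
  frames.\<close>

definition bar_fixed :: "'f \<Rightarrow> bool" where
  "bar_fixed c \<longleftrightarrow> (\<exists>F. F c = c \<and> F 0 = 0 \<and> (\<forall>e. F (S e) = S (- e)) \<and>
     (\<forall>x\<in>additive_span (range S). \<forall>y\<in>additive_span (range S). F (x - y) = F x - F y))"

text \<open>A unit of the base ring that is fixed by the bar involution has no top degree in any \<open>s a\<close>,
  since its top and bottom degrees are opposite and the top degrees of the unit and its inverse cancel.\<close>
lemma bar_fixed_unit:
  assumes c: "c \<in> additive_span (range S)" "bar_fixed c" and c': "c' \<in> additive_span (range S)" "bar_fixed c'"
    and unit: "c * c' = 1"
  obtains N where "c = of_int N"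
proof -
  interpret K: quantum_frame 0 s r s "\<lambda>_ _ _. 0" by (rule scalar_frame)
  have KS: "K.S e = 1" for e by (simp add: K.S_def)
  have KM: "K.M e = S e" for e by (simp add: K.M_def KS S_def)
  have KV: "K.V U = additive_span (S ` U)" for U
    unfolding K.V_def KS KM by (rule arg_cong[where f = additive_span]) auto
  have bottom: "z \<in> K.V {e. - e a \<le> d}" if z: "z \<in> K.V {e. e a \<le> d}" "bar_fixed z" for z a and d :: int
  proof -
    obtain F where F: "F z = z" "F 0 = 0" "\<And>e. F (S e) = S (- e)"
      "\<And>x y. x \<in> K.V UNIV \<Longrightarrow> y \<in> K.V UNIV \<Longrightarrow> F (x - y) = F x - F y"
      using z(2) unfolding bar_fixed_def KV by blast
    have "F z \<in> K.V {e. - e a \<le> d}" using z(1)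
    proof (induction rule: K.V_induct)
      case (monomial e u)
      thus ?case using K.V_M[of "- u" "{e. - e a \<le> d}"] by (simp add: KS KM F(3))
    qed (auto simp: F(2) F(4)[OF K.V_UNIV K.V_UNIV] intro: K.V_diff)
    thus ?thesis by (simp add: F(1))
  qed
  have top: "\<exists>d\<ge>0. \<exists>y w. y \<in> K.V {e. e a = d} \<and> y \<noteq> 0 \<and> w \<in> K.V {e. e a < d} \<and> z = y + w \<and> z \<in> K.V {e. - e a \<le> d}"
    if a: "a \<in> {1..r}" and z: "z \<in> additive_span (range S)" "bar_fixed z" "z \<noteq> 0" for z a
  proof -
    have zV: "z \<in> K.V UNIV" using z(1) by (simp add: KV)
    obtain d y w where y: "y \<in> K.V {e. e a = d}" "y \<noteq> 0" "w \<in> K.V {e. e a < d}" "z = y + w"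
      using K.V_top[OF zV z(3), of "\<lambda>e. e a", unfolded Int_UNIV_left] .
    have le: "z \<in> K.V {e. e a \<le> d}" unfolding y(4)
      by (intro K.V_add K.V_mono'[OF y(1)] K.V_mono'[OF y(3)]) auto
    note ge = bottom[OF le z(2)]
    have "d \<ge> 0"
    proof (rule ccontr)
      assume "\<not> d \<ge> 0"
      hence "{e. e a \<le> d} \<inter> {e. - e a \<le> d} = {}" by auto
      hence "z = 0"
        using K.V_disjoint[OF le ge] K.determined_Collect[OF K.grading_coordinate[OF a], of "\<lambda>x. - x \<le> d"] by blast
      thus False using z(3) by simp
    qed
    thus ?thesis using y ge by blast
  qed
  have nz: "c \<noteq> 0" "c' \<noteq> 0" using unit by auto
  have "c \<in> K.V {e. e a = (0 :: nat \<Rightarrow> int) a}" if a: "a \<in> {1..r}" for a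
  proof -
    note gr = K.grading_coordinate[OF a]
    obtain d y w where d: "d \<ge> 0" "y \<in> K.V {e. e a = d}" "y \<noteq> 0" "w \<in> K.V {e. e a < d}" "c = y + w" "c \<in> K.V {e. - e a \<le> d}"
      using top[OF a c nz(1)] by blast
    obtain d' y' w' where d': "d' \<ge> 0" "y' \<in> K.V {e. e a = d'}" "y' \<noteq> 0" "w' \<in> K.V {e. e a < d'}" "c' = y' + w'"
      using top[OF a c' nz(2)] by blast
    have "y * y' + (y * w' + w * (y' + w')) = 1 + 0" using unit unfolding d(5) d'(5) by (simp add: algebra_simps)
    from K.V_top_unique(1)[OF gr this K.top_mult[OF gr d(2,4) d'(2,4)], of 0] K.V_1[of "{e. e a = 0}"] d(3) d'(3)
    have "d + d' = 0" by simp
    hence "d = 0" using d(1) d'(1) by simp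
    hence 1: "c \<in> K.V {e. - e a \<le> 0}" using d(6) by simp
    have 2: "c \<in> K.V {e. e a \<le> 0}" unfolding d(5)
      by (intro K.V_add K.V_mono'[OF d(2)] K.V_mono'[OF d(4)]) (use \<open>d = 0\<close> in auto)
    from 2 1 have "c \<in> K.V ({e. e a \<le> 0} \<inter> {e. - e a \<le> 0})"
      by (rule K.V_Int) (rule K.determined_Collect[OF gr])
    thus ?thesis by (rule K.V_mono') auto
  qed
  with c(1) have "c \<in> K.V {e. \<forall>a\<in>{1..r}. e a = (0 :: nat \<Rightarrow> int) a}" by (intro K.V_coordinates) (auto simp: KV)
  hence "\<exists>N. c = of_int N"
  proof (induction rule: K.V_induct)
    case zero
    show ?case by (intro exI[of _ 0]) simp
  next
    case (monomial e u)
    have "K.M u = K.M 0" by (rule K.M_cong) (use monomial in auto)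
    thus ?case by (intro exI[of _ 1]) (simp add: KS)
  next
    case (diff x y)
    thus ?case by (metis of_int_diff)
  qed
  thus ?thesis using that by blast
qed

end

lemma (in quantum_frame) eps_of_int: "eps (of_int N) = N"
proof -
  have one: "1 \<in> V UNIV" "eps 1 = 1" using V_1[of UNIV] eps_props(1)[of 0 0] by auto
  have mem: "of_int N \<in> V UNIV" for N using V_of_int_mult[OF one(1), of N] by simp
  show ?thesis
  proof (induction N rule: int_induct[where k = 0])
    case (step1 i)
    thus ?case using eps_props(4)[OF mem[of i] one(1)] one(2) by simp
  next
    case (step2 i)
    thus ?case using eps_props(3)[OF mem[of i] one(1)] one(2) by simp
  qed (simp add: eps_props(2))
qed

lemma (in quasi_torus) constant_in_scalars:
  assumes "c \<in> V {u. \<forall>l\<in>{1..n}. u l = 0}"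
  shows "c \<in> additive_span (range S)"
  using assms
proof (induction rule: V_induct)
  case (monomial e u)
  have "M u = M 0" by (rule M_cong) (use monomial in auto)
  thus ?case by (auto intro: additive_span.base)
qed (auto intro: additive_span.intros)

lemma (in quantum_frame) bar_fixedI:
  assumes "bar c = c"
  shows "bar_fixed c"
proof -
  have "additive_span (range S) \<subseteq> V UNIV"
    unfolding V_def
  proof (rule additive_span_mono, rule image_subsetI, rule CollectI)
    show "\<exists>f u. S e = S f * M u \<and> u \<in> UNIV" for e
      by (intro exI[of _ e] exI[of _ 0]) simp
  qed
  thus ?thesis unfolding bar_fixed_def
    using assms bar_props(2) bar_S bar_props(3) by (intro exI[of _ bar]) blast
qed

lemma (in specialization) eps_eq_1: "c \<in> V UNIV \<Longrightarrow> sp c = 1 \<Longrightarrow> eps c = 1"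
  using eps_sp[of c] c.eps_of_int[of 1] by simp

lemma snd_mutate_along:
  "snd (mutate_along (toroidal_mutation r n s) ks X) = fold matrix_mutation ks (snd X)"
  by (induction ks rule: rev_induct) (auto simp: mutate_along_snoc snd_toroidal_mutation simp del: toroidal_mutation.simps)

text \<open>Matrix mutation does not see the variables, so both sequences carry the same matrices;
  the Laurent phenomenon keeps each new toroidal variable in the base torus.\<close>

lemma (in specialization) compatible_variable_along:
  assumes r: "1 \<le> r" and ok: "seed_ok r s n m (Y, B)" "seed_ok 0 s0 n m (x, B)" and "set ks \<subseteq> {1..m}" "i \<in> {1..n}"
  shows "compatible_variable (fst (mutate_along (toroidal_mutation r n s) ks (Y, B)) i)
    (fst (mutate_along (toroidal_mutation 0 n s0) ks (x, B)) i)"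
  using assms(4,5)
proof (induction ks arbitrary: i rule: rev_induct)
  case Nil
  thus ?case by (simp add: compatible_variable_base)
next
  case (snoc k ks)
  let ?X = "mutate_along (toroidal_mutation r n s) ks (Y, B)" and ?C = "mutate_along (toroidal_mutation 0 n s0) ks (x, B)"
  obtain Y2 B2 where X: "?X = (Y2, B2)" by fastforce
  have "snd ?C = snd ?X" by (simp only: snd_mutate_along snd_conv)
  then obtain x2 where C: "?C = (x2, B2)" using X by (metis prod.collapse snd_conv)
  have ks: "set ks \<subseteq> {1..m}" and k: "k \<in> {1..m}" using snoc.prems by auto
  obtain L2 D2 where q: "mutation r s n Y2 L2 m B2 D2 k"
    using seed_ok_mutation[OF seed_ok_mutate_along[OF ok(1) ks, unfolded X] k] .
  obtain Lc Dc where p: "mutation 0 s0 n x2 Lc m B2 Dc k"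
    using seed_ok_mutation[OF seed_ok_mutate_along[OF ok(2) ks, unfolded C] k] .
  interpret q: mutation r s n Y2 L2 m B2 D2 k by (rule q)
  interpret p: mutation 0 s0 n x2 Lc m B2 Dc k by (rule p)
  have cv: "compatible_variable (Y2 i) (x2 i)" if "i \<in> {1..n}" for i
    using snoc.IH[OF ks that] by (simp add: X C)
  have X': "mutate_along (toroidal_mutation r n s) (ks @ [k]) (Y, B) = (q.Y', q.B')"
    unfolding mutate_along_snoc X by (rule q.toroidal_mutation_eq)
  have C': "mutate_along (toroidal_mutation 0 n s0) (ks @ [k]) (x, B) = (p.Y', p.B')"
    unfolding mutate_along_snoc C by (rule p.toroidal_mutation_eq)
  have "q.Yk' \<in> V UNIV"
    using laurent_phenomenon[OF r ok(1) snoc.prems(1) q.k_n, unfolded X'] by (simp add: q.Y'_def V_UNIV_eq_torus)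
  from compatible_variable_step[OF q p cv this] cv[OF snoc.prems(2)]
  show ?case unfolding X' C' by (simp add: q.Y'_def p.Y'_def)
qed

lemma seed_ok_specialization:
  assumes "seed_ok r s n m (Y, B)" "seed_ok 0 s0 n m ((x :: nat \<Rightarrow> 'c::field), B)"
  obtains L Lc where "specialization r s n Y L s0 x Lc"
  using assms unfolding seed_ok_def specialization_def seed_frame_def by auto

text \<open>One direction applies \<open>sp\<close>. For the other, \<open>a\<close> is the frame at
  the start of the sequence and \<open>b\<close> the frame at its end. Rigidity in each gives a
  constant relating the same two variables, and the two constants are inverse to each other; so
  \<open>c\<close> is an integer, and its coefficient sum makes it 1.\<close>

lemma variables_agree_iff:
  fixes C :: "'c::field seed"
  assumes r: "1 \<le> r" and ok: "seed_ok r s n m X" "seed_ok 0 s0 n m C" and BC: "snd X = snd C"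
    and ks: "set ks \<subseteq> {1..m}" and i: "i \<in> {1..n}" "i' \<in> {1..n}"
  shows "fst (mutate_along (toroidal_mutation r n s) ks X) i' = fst X i \<longleftrightarrow>
    fst (mutate_along (toroidal_mutation 0 n s0) ks C) i' = fst C i"
proof -
  let ?X = "mutate_along (toroidal_mutation r n s) ks X" and ?C = "mutate_along (toroidal_mutation 0 n s0) ks C"
  obtain Y B x where X: "X = (Y, B)" and C: "C = (x, B)" using BC by (metis prod.collapse)
  obtain L Lc where "specialization r s n Y L s0 x Lc" using seed_ok_specialization ok unfolding X C by blast
  then interpret a: specialization r s n Y L s0 x Lc .
  have cva: "a.compatible_variable (fst ?X i') (fst ?C i')"
    using a.compatible_variable_along[OF r _ _ ks i(2)] ok by (simp add: X C)
  show ?thesis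
  proof
    assume "fst ?X i' = fst X i"
    hence "fst ?C i' = a.sp (Y i)" using cva by (simp add: a.compatible_variable_def X)
    also have "\<dots> = x i" using a.compatible_variable_base[OF i(1)] by (simp add: a.compatible_variable_def)
    finally show "fst ?C i' = fst C i" by (simp add: C)
  next
    assume eq: "fst ?C i' = fst C i"
    have okX: "seed_ok r s n m ?X" "seed_ok 0 s0 n m ?C" by (rule seed_ok_mutate_along[OF ok(1) ks], rule seed_ok_mutate_along[OF ok(2) ks])
    obtain Y2 B2 where X2: "?X = (Y2, B2)" by fastforce
    have "snd ?C = snd ?X" by (simp only: snd_mutate_along BC)
    then obtain x2 where C2: "?C = (x2, B2)" using X2 by (metis prod.collapse snd_conv)
    obtain L2 Lc2 where "specialization r s n Y2 L2 s0 x2 Lc2"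
      using seed_ok_specialization okX unfolding X2 C2 by blast
    then interpret b: specialization r s n Y2 L2 s0 x2 Lc2 .
    \<comment> \<open>Seen from the end, the start is reached by the reversed sequence, so
      \<open>Y i\<close> is itself a cluster variable relative to \<open>b\<close>.\<close>
    have return: "mutate_along (toroidal_mutation r n s) (rev ks) (Y2, B2) = (Y, B)"
      "mutate_along (toroidal_mutation 0 n s0) (rev ks) (x2, B2) = (x, B)"
      using mutate_along_rev[OF ok(1) ks] mutate_along_rev[OF ok(2) ks] unfolding X2 C2 by (simp_all only: X C)
    have rks: "set (rev ks) \<subseteq> {1..m}" using ks by simp
    have "b.compatible_variable (Y i) (x i)"
      using b.compatible_variable_along[OF r okX[unfolded X2 C2] rks i(1)] by (simp only: return fst_conv)
    moreover have xi: "x i = x2 i'" using eq[symmetric] unfolding C2 by (simp only: C fst_conv)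
    ultimately have cvb: "b.compatible_variable (Y i) (x2 i')" by simp
    have "a.compatible_variable (fst ?X i') (fst C i)" using cva unfolding eq .
    hence cvi: "a.compatible_variable (Y2 i') (x i)" unfolding X2 by (simp only: C fst_conv)
    obtain c where c: "c \<in> a.V {u. \<forall>l\<in>{1..n}. u l = 0}" "Y2 i' = c * Y i" "a.bar c = c" "a.sp c = 1"
      using a.compatible_variable_rigid[OF cvi i(1)] .
    obtain c' where c': "c' \<in> b.V {u. \<forall>l\<in>{1..n}. u l = 0}" "Y i = c' * Y2 i'" "b.bar c' = c'"
      using b.compatible_variable_rigid[OF cvb i(2)] by blast
    have "c * c' * Y2 i' = Y2 i'" using c(2) c'(2) by (simp add: mult.assoc)
    hence "c * c' = 1" using b.Y_nonzero[OF i(2)] by simp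
    then obtain N where N: "c = of_int N"
      using a.bar_fixed_unit[OF a.constant_in_scalars[OF c(1)] a.bar_fixedI[OF c(3)]
          b.constant_in_scalars[OF c'(1)] b.bar_fixedI[OF c'(3)]] by blast
    have "N = 1" using a.eps_eq_1[OF a.V_UNIV[OF c(1)] c(4)] a.eps_of_int[of N] by (simp add: N)
    hence "Y2 i' = Y i" using c(2) N by simp
    thus "fst ?X i' = fst X i" unfolding X2 by (simp only: X fst_conv)
  qed
qed

lemma seed_equiv_iff:
  "seed_equiv m n U W \<longleftrightarrow> (\<exists>\<sigma>. \<sigma> permutes {1..n} \<and> \<sigma> ` {1..m} = {1..m} \<and>
     (\<forall>i\<in>{1..n}. fst W (\<sigma> i) = fst U i) \<and>
     (\<forall>i\<in>{1..n}. \<forall>j\<in>{1..m}. snd W (\<sigma> i) (\<sigma> j) = snd U i j))"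
  by (cases U; cases W) simp

text \<open>The first seed is taken as base, from which \<open>rev ks @ ls\<close> leads to the
  second. The same permutation then works on both sides: matrices coincide, and variables are
  compared by \<open>variables_agree_iff\<close>.\<close>

lemma seed_equiv_mutate_along_iff:
  fixes C :: "'c::field seed"
  assumes r: "1 \<le> r" and ok: "seed_ok r s n m X" "seed_ok 0 s0 n m C" and BC: "snd X = snd C"
    and ks: "set ks \<subseteq> {1..m}" "set ls \<subseteq> {1..m}"
  shows "seed_equiv m n (mutate_along (toroidal_mutation r n s) ks X) (mutate_along (toroidal_mutation r n s) ls X) \<longleftrightarrow>
    seed_equiv m n (mutate_along (toroidal_mutation 0 n s0) ks C) (mutate_along (toroidal_mutation 0 n s0) ls C)"
proof -
  let ?X1 = "mutate_along (toroidal_mutation r n s) ks X" and ?X2 = "mutate_along (toroidal_mutation r n s) ls X"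
  let ?C1 = "mutate_along (toroidal_mutation 0 n s0) ks C" and ?C2 = "mutate_along (toroidal_mutation 0 n s0) ls C"
  have path: "mutate_along (toroidal_mutation r n s) (rev ks @ ls) ?X1 = ?X2"
    "mutate_along (toroidal_mutation 0 n s0) (rev ks @ ls) ?C1 = ?C2"
    unfolding mutate_along_append mutate_along_rev[OF ok(1) ks(1)] mutate_along_rev[OF ok(2) ks(1)] by (rule refl)+
  have B: "snd ?X1 = snd ?C1" "snd ?X2 = snd ?C2" by (simp_all only: snd_mutate_along BC)
  have "set (rev ks @ ls) \<subseteq> {1..m}" using ks by simp
  note vars = variables_agree_iff[OF r seed_ok_mutate_along[OF ok(1) ks(1)] seed_ok_mutate_along[OF ok(2) ks(1)] B(1) this,
      unfolded path]
  show ?thesis unfolding seed_equiv_iff B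
  proof (intro iff_exI conj_cong refl ball_cong)
    fix \<sigma> i assume "\<sigma> permutes {1..n}" "i \<in> {1..n}"
    hence "\<sigma> i \<in> {1..n}" using permutes_in_image[of \<sigma> "{1..n}" i] by blast
    thus "fst ?X2 (\<sigma> i) = fst ?X1 i \<longleftrightarrow> fst ?C2 (\<sigma> i) = fst ?C1 i"
      using vars[OF \<open>i \<in> {1..n}\<close>] by blast
  qed
qed

section \<open>From the given seeds to frames\<close>

lemma additive_span_subset_span_over: "additive_span (b ` I) \<subseteq> span_over \<int> b I"
proof
  fix x assume "x \<in> additive_span (b ` I)"
  then obtain A c where "finite A" "A \<subseteq> I" "x = (\<Sum>i\<in>A. of_int (c i :: int) * b i)"
    by (rule additive_span_as_sum)
  thus "x \<in> span_over \<int> b I"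
    unfolding span_over_def by (intro CollectI exI[of _ A] exI[of _ "\<lambda>i. of_int (c i)"]) simp
qed

lemma (in scalars) span_S_subset_base_ring: "additive_span (range S) \<subseteq> base_ring r s"
proof -
  have "range S \<subseteq> ordered_monomial r s ` exponents r"
  proof (rule image_subsetI)
    fix e
    show "S e \<in> ordered_monomial r s ` exponents r"
      by (rule image_eqI[of _ _ "trim r e"]) (simp only: S_def[symmetric] S_trim, rule trim_in_exponents)
  qed
  hence "additive_span (range S) \<subseteq> additive_span (ordered_monomial r s ` exponents r)" by (rule additive_span_mono)
  thus ?thesis using additive_span_subset_span_over unfolding base_ring_def by (rule order.trans)
qed

lemma (in scalars) alg_independent_nonzero:
  assumes "quantum_alg_independent r n s Y" "i \<in> {1..n}"
  shows "Y i \<noteq> 0"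
proof
  assume Y0: "Y i = 0"
  have om: "ordered_monomial N Y (unit_exp i) = (if i \<in> {1..N} then Y i else 1)" if "1 \<le> i" for N
    using that by (induction N) (auto simp: ordered_monomial_Suc unit_exp_def le_Suc_eq)
  have "1 \<in> additive_span (range S)" using S_0 by (metis additive_span.base rangeI)
  hence one: "1 \<in> base_ring r s" using span_S_subset_base_ring by blast
  have "(\<Sum>u\<in>{unit_exp i}. 1 * ordered_monomial n Y u) = 0" using om[of n] assms(2) Y0 by simp
  moreover have "{unit_exp i} \<subseteq> {u \<in> exponents n. \<forall>i. 0 \<le> u i}"
    using assms(2) by (auto simp: exponents_def unit_exp_def)
  ultimately have "\<forall>u\<in>{unit_exp i}. (\<lambda>_. 1 :: 'f) u = 0"
    using assms(1)[unfolded quantum_alg_independent_def lin_indep_over_def,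
        THEN spec[of _ "{unit_exp i}"], THEN spec[of _ "\<lambda>_. 1"]] one by blast
  thus False by simp
qed

text \<open>A large monomial \<open>M v\<close> clears the negative exponents, so polynomial
  independence over the base ring applies. The integer coefficients are then recovered from those in
  the base ring by independence of the \<open>s a\<close>.\<close>

lemma (in quasi_torus) alg_independent_imp_independent:
  assumes ai: "quantum_alg_independent r n s Y"
  shows "int_independent (\<lambda>(e, u). S e * M u) (exponents r \<times> exponents n)"
proof (rule int_independentI)
  fix A c
  assume A: "finite A" "A \<subseteq> exponents r \<times> exponents n"
    and sum0: "(\<Sum>i\<in>A. of_int (c i) * (case i of (e, u) \<Rightarrow> S e * M u)) = 0"
  define N where "N = (\<Sum>i\<in>A. \<Sum>l\<in>{1..n}. nat (- snd i l))"
  have N: "- int N \<le> snd i l" if "i \<in> A" "l \<in> {1..n}" for i l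
  proof -
    have "nat (- snd i l) \<le> (\<Sum>l\<in>{1..n}. nat (- snd i l))" using that by (intro member_le_sum) auto
    also have "\<dots> \<le> N" unfolding N_def
      using that A(1) by (intro member_le_sum[of i A "\<lambda>i. \<Sum>l\<in>{1..n}. nat (- snd i l)"]) auto
    finally show ?thesis by linarith
  qed
  define v where "v = (\<lambda>l. if l \<in> {1..n} then int N else 0)"
  define \<tau> where "\<tau> u = (\<lambda>a. lam a u v) + half_exponent (u + v)" for u
  have term_eq: "S e * M u * M v = S (e + \<tau> u) * ordered_monomial n Y (u + v)" for e u
    by (simp only: mult.assoc M_mult Q_def M_def[of "u + v"] S_mult_S \<tau>_def)
  let ?f = "\<lambda>i. snd i + v"
  define \<kappa> where "\<kappa> w = (\<Sum>i\<in>{i \<in> A. ?f i = w}. of_int (c i) * S (fst i + \<tau> (snd i)))" for w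
  have \<kappa>R: "\<kappa> w \<in> base_ring r s" for w
    unfolding \<kappa>_def
    by (rule subsetD[OF span_S_subset_base_ring])
      (intro additive_span_sum additive_span_of_int_mult additive_span.base, simp)
  have "(\<Sum>w\<in>?f ` A. \<kappa> w * ordered_monomial n Y w) =
      (\<Sum>w\<in>?f ` A. \<Sum>i\<in>{i \<in> A. ?f i = w}. of_int (c i) * (S (fst i + \<tau> (snd i)) * ordered_monomial n Y (?f i)))"
    unfolding \<kappa>_def by (intro sum.cong refl) (auto simp: sum_distrib_right mult.assoc intro!: sum.cong)
  also have "\<dots> = (\<Sum>i\<in>A. of_int (c i) * (S (fst i + \<tau> (snd i)) * ordered_monomial n Y (?f i)))"
    using A(1) by (subst sum.group) auto
  also have "\<dots> = (\<Sum>i\<in>A. of_int (c i) * (case i of (e, u) \<Rightarrow> S e * M u)) * M v"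
    unfolding sum_distrib_right
  proof (rule sum.cong[OF refl])
    fix i
    show "of_int (c i) * (S (fst i + \<tau> (snd i)) * ordered_monomial n Y (?f i)) =
        of_int (c i) * (case i of (e, u) \<Rightarrow> S e * M u) * M v"
      unfolding term_eq[symmetric] by (simp only: case_prod_beta mult.assoc)
  qed
  finally have s0: "(\<Sum>w\<in>?f ` A. \<kappa> w * ordered_monomial n Y w) = 0" using sum0 by simp
  have "?f ` A \<subseteq> {u \<in> exponents n. \<forall>i. 0 \<le> u i}"
  proof (rule image_subsetI, rule CollectI, intro conjI allI)
    fix i assume i: "i \<in> A"
    have ex: "snd i l = 0" if "l \<notin> {1..n}" for l using i A(2) that by (auto simp: exponents_def)
    show "?f i \<in> exponents n" using ex by (auto simp: exponents_def v_def)
    show "0 \<le> ?f i l" for l using N[OF i, of l] ex[of l] by (auto simp: v_def)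
  qed
  with ai[unfolded quantum_alg_independent_def lin_indep_over_def,
      THEN spec[of _ "?f ` A"], THEN spec[of _ \<kappa>]] A(1) \<kappa>R s0
  have \<kappa>0: "\<forall>w\<in>?f ` A. \<kappa> w = 0" by blast
  show "\<forall>i\<in>A. c i = 0"
  proof
    fix i0 assume i0: "i0 \<in> A"
    let ?A = "{i \<in> A. ?f i = ?f i0}"
    have "(\<Sum>i\<in>?A. of_int (c i) * ordered_monomial r s (fst i)) * S (\<tau> (snd i0)) = \<kappa> (?f i0)"
      unfolding \<kappa>_def sum_distrib_right
    proof (rule sum.cong[OF refl])
      fix i assume "i \<in> ?A"
      hence "snd i = snd i0" by simp
      thus "of_int (c i) * ordered_monomial r s (fst i) * S (\<tau> (snd i0)) = of_int (c i) * S (fst i + \<tau> (snd i))"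
        by (simp only: S_add mult.assoc) (simp only: S_def)
    qed
    hence "(\<Sum>i\<in>?A. of_int (c i) * ordered_monomial r s (fst i)) = 0" using \<kappa>0 i0 by simp
    moreover have "int_independent (\<lambda>i. ordered_monomial r s (fst i)) ?A"
    proof (rule int_independent_reindex[OF s_independent])
      show "inj_on fst ?A" by (auto simp: inj_on_def prod_eq_iff)
      show "fst ` ?A \<subseteq> exponents r" using A(2) by auto
    qed simp
    ultimately show "c i0 = 0"
      using int_independentD[of "\<lambda>i. ordered_monomial r s (fst i)" ?A ?A c i0] A(1) i0 by simp
  qed
qed

lemma toroidal_seed_imp_seed_ok:
  assumes "scalars r s" and mn: "m \<le> n" and ts: "toroidal_seed r m n s (Y, B)"
  shows "seed_ok r s n m (Y, B)"
proof -
  interpret scalars r s by fact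
  let ?L = "commutation_matrices r n s Y"
  have ai: "quantum_alg_independent r n s Y" and ex: "\<exists>L. quasi_commute r n s L Y"
    and comp: "toroidal_compatible r m n B ?L" and sk: "\<And>i j. i \<in> {1..m} \<Longrightarrow> j \<in> {1..m} \<Longrightarrow> B i j = - B j i"
    using ts unfolding toroidal_seed.simps by blast+
  have qc: "quasi_commute r n s ?L Y" unfolding commutation_matrices_def by (rule someI_ex[OF ex])
  note nz = alg_independent_nonzero[OF ai]
  \<comment> \<open>Exchanging two variables twice produces a scalar equal to 1, so the exponents of
    the two exchanges are opposite.\<close>
  have skew: "?L a i j = - ?L a j i" if "a \<in> {1..r}" "i \<in> {1..n}" "j \<in> {1..n}" for a i j
  proof -
    let ?e = "\<lambda>i j. (\<lambda>a. ?L a i j) + (\<lambda>a. ?L a i j)"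
    have "Y i * Y j = S (?e i j) * (Y j * Y i)" "Y j * Y i = S (?e j i) * (Y i * Y j)"
      using qc that(2,3) unfolding quasi_commute_def t_monomial_eq_S[symmetric] by blast+
    hence "Y i * Y j = S (?e i j + ?e j i) * (Y i * Y j)" by (metis S_mult_S)
    hence "S (?e i j + ?e j i) = S 0" using nz that(2,3) by simp
    from S_inj[OF this that(1)] show ?thesis by simp
  qed
  interpret quasi_torus r s n Y ?L
    by unfold_locales (erule nz, rule qc, erule (2) skew)
  interpret quantum_frame r s n Y ?L
    by unfold_locales (rule alg_independent_imp_independent[OF ai])
  let ?D = "\<lambda>a j. \<Sum>l\<in>{1..n}. B l j * ?L a l j"
  have "seed_frame r s n Y ?L m B ?D"
  proof
    fix a i j assume a: "a \<in> {1..r}" and j: "j \<in> {1..m}"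
    have off: "\<forall>j\<in>{1..m}. \<forall>i\<in>{1..n}. i \<noteq> j \<longrightarrow> (\<Sum>l\<in>{1..n}. B l j * ?L a l i) = 0"
      and diag: "(\<forall>j\<in>{1..m}. ?D a j > 0) \<or> (\<forall>j\<in>{1..m}. ?D a j < 0)"
      using comp a unfolding toroidal_compatible_def Let_def by blast+
    have "?D a j > 0 \<or> ?D a j < 0" using diag j by blast
    thus "?D a j \<noteq> 0" by linarith
    assume "i \<in> {1..n}"
    thus "(\<Sum>l\<in>{1..n}. B l j * ?L a l i) = (if i = j then ?D a j else 0)" using off j by simp
  next
    show "B i j = - B j i" if "i \<in> {1..m}" "j \<in> {1..m}" for i j using that by (rule sk)
  qed (rule mn)
  thus ?thesis unfolding seed_ok_def by auto
qed

lemma torus_fraction_field_imp_scalars: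
  fixes s :: "nat \<Rightarrow> 'f::{division_ring, ring_char_0}"
  assumes "torus_fraction_field r n \<Lambda> s X"
  shows "scalars r s"
  by unfold_locales
    (use assms lin_indep_over_Ints_imp_int_independent[of "ordered_monomial r s" "exponents r"]
      in \<open>auto simp: torus_fraction_field_def\<close>)

section \<open>The classical initial seed\<close>

definition embed :: "((nat \<Rightarrow>\<^sub>0 nat) \<Rightarrow>\<^sub>0 int) \<Rightarrow> rational_function" where
  "embed p = Fract p 1"

lemma embed_simps:
  "embed (p + q) = embed p + embed q" "embed (p * q) = embed p * embed q" "embed (p - q) = embed p - embed q"
  "embed 0 = 0" "embed 1 = 1" "embed p = 0 \<longleftrightarrow> p = 0"
  by (simp_all add: embed_def Zero_fract_def One_fract_def eq_fract)

lemma embed_of_int: "embed (of_int z) = of_int z"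
  by (induction z rule: int_induct[where k = 0]) (simp_all add: embed_simps)

lemma embed_sum: "embed (sum f A) = (\<Sum>i\<in>A. embed (f i))"
  by (induction A rule: infinite_finite_induct) (simp_all add: embed_simps)

lemma lookup_of_int_mult: "Poly_Mapping.lookup (of_int z * p) q = z * Poly_Mapping.lookup p q"
  for p :: "(nat \<Rightarrow>\<^sub>0 nat) \<Rightarrow>\<^sub>0 int"
  by (induction z rule: int_induct[where k = 0])
    (simp_all add: distrib_right left_diff_distrib lookup_add lookup_minus)

text \<open>Monomials with distinct exponents are distinct basis elements of the polynomial ring, so
  a relation can be read off coefficient by coefficient. For \<open>r = 0\<close> the base ring
  consists of integers.\<close>

lemma variable_alg_independent: "quantum_alg_independent 0 n s variable"
proof -
  define e where "e N u = (\<Sum>i\<in>{1..N}. Poly_Mapping.single i (nat (u i)))" for N :: nat and u :: "nat \<Rightarrow> int"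
  have vp: "variable i ^ q = embed (Poly_Mapping.single (Poly_Mapping.single i q) 1)" for i q
  proof (induction q)
    case (Suc q)
    have "variable i ^ Suc q = variable i * variable i ^ q" by simp
    also have "\<dots> = embed (Poly_Mapping.single (Poly_Mapping.single i 1) 1 * Poly_Mapping.single (Poly_Mapping.single i q) 1)"
      unfolding Suc embed_simps by (simp add: variable_def embed_def)
    also have "\<dots> = embed (Poly_Mapping.single (Poly_Mapping.single i (Suc q)) 1)"
      by (simp add: mult_single single_add[symmetric])
    finally show ?case .
  qed (simp add: embed_simps)
  have om: "ordered_monomial N variable u = embed (Poly_Mapping.single (e N u) 1)" if "\<forall>i. 0 \<le> u i" for N u
  proof (induction N)
    case (Suc N)
    have "ordered_monomial (Suc N) variable u =
        embed (Poly_Mapping.single (e N u) 1 * Poly_Mapping.single (Poly_Mapping.single (Suc N) (nat (u (Suc N)))) 1)"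
      unfolding ordered_monomial_Suc Suc embed_simps vp[symmetric] using that by (simp add: power_int_def)
    thus ?case by (simp add: mult_single e_def)
  qed (simp add: e_def embed_simps)
  have le: "Poly_Mapping.lookup (e N u) l = (if l \<in> {1..N} then nat (u l) else 0)" for N u l
    by (induction N) (auto simp: e_def lookup_add lookup_single when_def le_Suc_eq)
  have e_inj: "u = w" if "e n u = e n w" "u \<in> exponents n" "w \<in> exponents n" "\<forall>i. 0 \<le> u i" "\<forall>i. 0 \<le> w i" for u w
  proof
    fix l
    show "u l = w l"
    proof (cases "l \<in> {1..n}")
      case True
      have "nat (u l) = nat (w l)" using le[of n u l] le[of n w l] that(1) True by simp
      thus ?thesis using that(4,5) by (metis int_nat_eq)
    next
      case False
      thus ?thesis using that(2,3) by (simp add: exponents_def)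
    qed
  qed
  show ?thesis unfolding quantum_alg_independent_def lin_indep_over_def
  proof (intro allI impI, elim conjE)
    fix A c
    assume A: "finite A" "A \<subseteq> {u \<in> exponents n. \<forall>i. 0 \<le> u i}" "\<forall>i\<in>A. c i \<in> base_ring 0 s"
      and s0: "(\<Sum>i\<in>A. c i * ordered_monomial n variable i) = 0"
    have "\<exists>z. c i = of_int z" if "i \<in> A" for i
    proof -
      have "c i \<in> span_over \<int> (ordered_monomial 0 s) (exponents 0)"
        using A(3) that unfolding base_ring_def by blast
      then obtain C d where "finite C" "\<forall>i\<in>C. d i \<in> \<int>" "c i = (\<Sum>i\<in>C. d i * ordered_monomial 0 s i)"
        unfolding span_over_def by blast
      hence "c i \<in> \<int>" by (auto intro: Ints_sum)
      thus ?thesis by (auto elim: Ints_cases)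
    qed
    then obtain z where z: "\<And>i. i \<in> A \<Longrightarrow> c i = of_int (z i)" by metis
    let ?m = "\<lambda>u. Poly_Mapping.single (e n u) (1 :: int)"
    have "(\<Sum>i\<in>A. c i * ordered_monomial n variable i) = (\<Sum>i\<in>A. embed (of_int (z i) * ?m i))"
      by (rule sum.cong[OF refl]) (use A(2) z om in \<open>auto simp: embed_simps embed_of_int\<close>)
    hence "embed (\<Sum>i\<in>A. of_int (z i) * ?m i) = 0" using s0 by (simp only: embed_sum)
    hence p0: "(\<Sum>i\<in>A. of_int (z i) * ?m i) = 0" by (simp only: embed_simps(6))
    have l0: "(\<Sum>i\<in>A. z i * Poly_Mapping.lookup (?m i) q) = 0" for q
      using arg_cong[OF p0, of "\<lambda>p. Poly_Mapping.lookup p q"]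
      by (simp only: lookup_sum lookup_of_int_mult lookup_zero)
    show "\<forall>i\<in>A. c i = 0"
    proof
      fix u assume u: "u \<in> A"
      have "(\<Sum>i\<in>A. z i * Poly_Mapping.lookup (?m i) (e n u)) = (\<Sum>i\<in>A. if i = u then z i else 0)"
      proof (rule sum.cong[OF refl])
        fix i assume "i \<in> A"
        hence "e n i = e n u \<longleftrightarrow> i = u" using A(2) u e_inj[of i u] by blast
        thus "z i * Poly_Mapping.lookup (?m i) (e n u) = (if i = u then z i else 0)"
          by (auto simp: lookup_single when_def)
      qed
      hence "z u = 0" using l0 A(1) u by simp
      thus "c u = 0" using z[OF u] by simp
    qed
  qed
qed

lemma classical_seed_ok:
  assumes mn: "m \<le> n" and sk: "\<And>i j. i \<in> {1..m} \<Longrightarrow> j \<in> {1..m} \<Longrightarrow> B i j = - B j i"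
  shows "seed_ok 0 s n m (classical_initial_seed B)"
proof -
  have "z = 0" if "of_int z = (0 :: rational_function)" for z
    using that by (simp add: embed_of_int[symmetric] embed_simps)
  then interpret scalars 0 s by (rule scalars_0I)
  let ?L = "\<lambda>_ _ _. 0 :: int"
  interpret quasi_torus 0 s n variable ?L
    by unfold_locales
      (use alg_independent_nonzero[OF variable_alg_independent] in \<open>auto simp: quasi_commute_def t_monomial_def\<close>)
  interpret quantum_frame 0 s n variable ?L
    by unfold_locales (rule alg_independent_imp_independent[OF variable_alg_independent])
  \<comment> \<open>With \<open>r = 0\<close> no index \<open>a\<close> is left, so the
    compatibility conditions hold vacuously, even for the zero diagonal.\<close>
  have "seed_frame 0 s n variable ?L m B (\<lambda>_ _. 0)"
  proof
    show "B i j = - B j i" if "i \<in> {1..m}" "j \<in> {1..m}" for i j using that by (rule sk)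
  qed (use mn in auto)
  thus ?thesis unfolding seed_ok_def classical_initial_seed_def by auto
qed

section \<open>Unlabelled seeds and exchange graphs\<close>

lemma seed_equiv_refl: "seed_equiv m n U U"
  unfolding seed_equiv_iff by (rule exI[of _ id]) (simp add: permutes_id)

lemma seed_equiv_sym:
  assumes "seed_equiv m n U W"
  shows "seed_equiv m n W U"
proof -
  obtain \<sigma> where \<sigma>: "\<sigma> permutes {1..n}" "\<sigma> ` {1..m} = {1..m}" "\<And>i. i \<in> {1..n} \<Longrightarrow> fst W (\<sigma> i) = fst U i"
    "\<And>i j. i \<in> {1..n} \<Longrightarrow> j \<in> {1..m} \<Longrightarrow> snd W (\<sigma> i) (\<sigma> j) = snd U i j"
    using assms unfolding seed_equiv_iff by blast
  let ?\<tau> = "inv \<sigma>"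
  have \<tau>: "?\<tau> permutes {1..n}" by (rule permutes_inv[OF \<sigma>(1)])
  have im: "?\<tau> ` {1..m} = {1..m}"
    by (metis \<sigma>(2) image_inv_f_f permutes_inj[OF \<sigma>(1)])
  have inv: "\<sigma> (?\<tau> i) = i" for i by (rule permutes_inverses(1)[OF \<sigma>(1)])
  have in_n: "?\<tau> i \<in> {1..n}" if "i \<in> {1..n}" for i using permutes_in_image[OF \<tau>, of i] that by blast
  have in_m: "?\<tau> i \<in> {1..m}" if "i \<in> {1..m}" for i using im that by blast
  have "fst U (?\<tau> i) = fst W i" if "i \<in> {1..n}" for i using \<sigma>(3)[OF in_n[OF that]] by (simp only: inv)
  moreover have "snd U (?\<tau> i) (?\<tau> j) = snd W i j" if "i \<in> {1..n}" "j \<in> {1..m}" for i j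
    using \<sigma>(4)[OF in_n[OF that(1)] in_m[OF that(2)]] by (simp only: inv)
  ultimately show ?thesis unfolding seed_equiv_iff using \<tau> im by blast
qed

lemma seed_equiv_trans:
  assumes "seed_equiv m n U W" "seed_equiv m n W Z"
  shows "seed_equiv m n U Z"
proof -
  obtain \<sigma> where \<sigma>: "\<sigma> permutes {1..n}" "\<sigma> ` {1..m} = {1..m}" "\<And>i. i \<in> {1..n} \<Longrightarrow> fst W (\<sigma> i) = fst U i"
    "\<And>i j. i \<in> {1..n} \<Longrightarrow> j \<in> {1..m} \<Longrightarrow> snd W (\<sigma> i) (\<sigma> j) = snd U i j"
    using assms(1) unfolding seed_equiv_iff by blast
  obtain \<tau> where \<tau>: "\<tau> permutes {1..n}" "\<tau> ` {1..m} = {1..m}" "\<And>i. i \<in> {1..n} \<Longrightarrow> fst Z (\<tau> i) = fst W i"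
    "\<And>i j. i \<in> {1..n} \<Longrightarrow> j \<in> {1..m} \<Longrightarrow> snd Z (\<tau> i) (\<tau> j) = snd W i j"
    using assms(2) unfolding seed_equiv_iff by blast
  have in_n: "\<sigma> i \<in> {1..n}" if "i \<in> {1..n}" for i using permutes_in_image[OF \<sigma>(1), of i] that by blast
  have in_m: "\<sigma> i \<in> {1..m}" if "i \<in> {1..m}" for i using \<sigma>(2) that by blast
  show ?thesis unfolding seed_equiv_iff
  proof (intro exI[of _ "\<tau> \<circ> \<sigma>"] conjI ballI)
    show "\<tau> \<circ> \<sigma> permutes {1..n}" by (rule permutes_compose[OF \<sigma>(1) \<tau>(1)])
    show "(\<tau> \<circ> \<sigma>) ` {1..m} = {1..m}" by (simp only: image_comp[symmetric] \<sigma>(2) \<tau>(2))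
    show "fst Z ((\<tau> \<circ> \<sigma>) i) = fst U i" if "i \<in> {1..n}" for i
      unfolding o_def \<tau>(3)[OF in_n[OF that]] by (rule \<sigma>(3)[OF that])
    show "snd Z ((\<tau> \<circ> \<sigma>) i) ((\<tau> \<circ> \<sigma>) j) = snd U i j" if "i \<in> {1..n}" "j \<in> {1..m}" for i j
      unfolding o_def \<tau>(4)[OF in_n[OF that(1)] in_m[OF that(2)]] by (rule \<sigma>(4)[OF that])
  qed
qed

lemma unlabelled_seed_eq_iff: "unlabelled_seed m n U = unlabelled_seed m n W \<longleftrightarrow> seed_equiv m n U W"
proof
  assume eq: "unlabelled_seed m n U = unlabelled_seed m n W"
  have "W \<in> unlabelled_seed m n W" by (simp add: unlabelled_seed_def seed_equiv_refl)
  thus "seed_equiv m n U W" unfolding eq[symmetric] by (simp add: unlabelled_seed_def)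
next
  assume "seed_equiv m n U W"
  thus "unlabelled_seed m n U = unlabelled_seed m n W"
    unfolding unlabelled_seed_def by (auto intro: seed_equiv_trans seed_equiv_sym)
qed

text \<open>Vertices on both sides are indexed by mutation sequences, and the assumption says that
  the two indexings identify the same sequences. Edges join the ends of \<open>ks\<close> and
  \<open>ks @ [k]\<close>, so they correspond too.\<close>

lemma exchange_graph_isomorphism:
  fixes \<mu> :: "nat \<Rightarrow> 'a seed \<Rightarrow> 'a seed" and \<nu> :: "nat \<Rightarrow> 'b seed \<Rightarrow> 'b seed"
  assumes same: "\<And>ks ls. set ks \<subseteq> {1..m} \<Longrightarrow> set ls \<subseteq> {1..m} \<Longrightarrow>
    seed_equiv m n (mutate_along \<mu> ks X) (mutate_along \<mu> ls X) \<longleftrightarrow>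
    seed_equiv m n (mutate_along \<nu> ks C) (mutate_along \<nu> ls C)"
  shows "\<exists>\<phi>. (\<forall>ks. set ks \<subseteq> {1..m} \<longrightarrow>
      \<phi> (unlabelled_seed m n (mutate_along \<mu> ks X)) = unlabelled_seed m n (mutate_along \<nu> ks C)) \<and>
    graph_isomorphism \<phi> (exchange_graph m n \<mu> X) (exchange_graph m n \<nu> C)"
proof -
  let ?K = "{ks. set ks \<subseteq> {1..m}}"
  let ?p = "\<lambda>ks. unlabelled_seed m n (mutate_along \<mu> ks X)"
  let ?q = "\<lambda>ks. unlabelled_seed m n (mutate_along \<nu> ks C)"
  have pq: "?p ks = ?p ls \<longleftrightarrow> ?q ks = ?q ls" if "ks \<in> ?K" "ls \<in> ?K" for ks ls
    unfolding unlabelled_seed_eq_iff using same that by blast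
  define \<phi> where "\<phi> v = ?q (SOME ks. ks \<in> ?K \<and> ?p ks = v)" for v
  have \<phi>: "\<phi> (?p ks) = ?q ks" if "ks \<in> ?K" for ks
  proof -
    have "(SOME ls. ls \<in> ?K \<and> ?p ls = ?p ks) \<in> ?K \<and> ?p (SOME ls. ls \<in> ?K \<and> ?p ls = ?p ks) = ?p ks"
      by (rule someI[of "\<lambda>ls. ls \<in> ?K \<and> ?p ls = ?p ks" ks]) (use that in simp)
    thus ?thesis unfolding \<phi>_def using pq that by blast
  qed
  have vert: "fst (exchange_graph m n \<mu> X) = ?p ` ?K" "fst (exchange_graph m n \<nu> C) = ?q ` ?K"
    unfolding exchange_graph_def mutation_class_def by auto
  have edge: "snd (exchange_graph m n \<mu> X) = {{?p ks, ?p (ks @ [k])} | ks k. ks \<in> ?K \<and> k \<in> {1..m}}"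
    "snd (exchange_graph m n \<nu> C) = {{?q ks, ?q (ks @ [k])} | ks k. ks \<in> ?K \<and> k \<in> {1..m}}"
    unfolding exchange_graph_def mutation_class_def mutate_along_snoc snd_conv by blast+
  have inj: "inj_on \<phi> (?p ` ?K)"
  proof (rule inj_onI)
    fix v w assume "v \<in> ?p ` ?K" "w \<in> ?p ` ?K" and eq: "\<phi> v = \<phi> w"
    then obtain ks ls where v: "v = ?p ks" "ks \<in> ?K" and w: "w = ?p ls" "ls \<in> ?K" by blast
    have "?q ks = ?q ls" using eq unfolding v(1) w(1) \<phi>[OF v(2)] \<phi>[OF w(2)] .
    thus "v = w" unfolding v(1) w(1) using pq[OF v(2) w(2)] by blast
  qed
  have img: "\<phi> ` {?p ks, ?p (ks @ [k])} = {?q ks, ?q (ks @ [k])}" if "ks \<in> ?K" "k \<in> {1..m}" for ks k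
  proof -
    have "ks @ [k] \<in> ?K" using that by simp
    from \<phi>[OF that(1)] \<phi>[OF this] show ?thesis by (simp only: image_insert image_empty)
  qed
  have "graph_isomorphism \<phi> (exchange_graph m n \<mu> X) (exchange_graph m n \<nu> C)"
    unfolding graph_isomorphism_def vert
  proof (intro conjI ballI)
    have "\<phi> ` (?p ` ?K) = ?q ` ?K" unfolding image_image using \<phi> by (rule image_cong[OF refl])
    thus "bij_betw \<phi> (?p ` ?K) (?q ` ?K)" using inj by (simp add: bij_betw_def)
    fix v w assume vw: "v \<in> ?p ` ?K" "w \<in> ?p ` ?K"
    show "{v, w} \<in> snd (exchange_graph m n \<mu> X) \<longleftrightarrow> {\<phi> v, \<phi> w} \<in> snd (exchange_graph m n \<nu> C)"
    proof
      assume "{v, w} \<in> snd (exchange_graph m n \<mu> X)"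
      then obtain ks k where ks: "ks \<in> ?K" "k \<in> {1..m}" "{v, w} = {?p ks, ?p (ks @ [k])}" unfolding edge by blast
      have "{\<phi> v, \<phi> w} = \<phi> ` {v, w}" by simp
      also have "\<dots> = {?q ks, ?q (ks @ [k])}" unfolding ks(3) by (rule img[OF ks(1,2)])
      finally show "{\<phi> v, \<phi> w} \<in> snd (exchange_graph m n \<nu> C)" unfolding edge using ks(1,2) by blast
    next
      assume "{\<phi> v, \<phi> w} \<in> snd (exchange_graph m n \<nu> C)"
      then obtain ks k where ks: "ks \<in> ?K" "k \<in> {1..m}" "{\<phi> v, \<phi> w} = {?q ks, ?q (ks @ [k])}" unfolding edge by blast
      \<comment> \<open>An edge is the set of its end points, so injectivity on the vertices
        recovers it from its image.\<close>
      have eq: "\<phi> ` {v, w} = \<phi> ` {?p ks, ?p (ks @ [k])}" unfolding img[OF ks(1,2)] ks(3)[symmetric] by simp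
      have sub: "{v, w} \<subseteq> ?p ` ?K" using vw by blast
      have "ks @ [k] \<in> ?K" using ks(1,2) by simp
      hence sub': "{?p ks, ?p (ks @ [k])} \<subseteq> ?p ` ?K" using ks(1) by blast
      have "{v, w} = {?p ks, ?p (ks @ [k])}" using eq unfolding inj_on_image_eq_iff[OF inj sub sub'] .
      thus "{v, w} \<in> snd (exchange_graph m n \<mu> X)" unfolding edge using ks(1,2) by blast
    qed
  qed
  thus ?thesis using \<phi> by blast
qed

theorem theorem2p8:
  fixes r m n :: nat
    and \<Lambda> :: "nat \<Rightarrow> nat \<Rightarrow> nat \<Rightarrow> int"
    and s X Y :: "nat \<Rightarrow> 'f::{division_ring, ring_char_0}"
    and B :: "nat \<Rightarrow> nat \<Rightarrow> int"
  assumes "1 \<le> m" and "m \<le> n" and "1 \<le> r"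
    and "\<forall>a\<in>{1..r}. \<forall>i\<in>{1..n}. \<forall>j\<in>{1..n}. \<Lambda> a i j = - \<Lambda> a j i"
    and "torus_fraction_field r n \<Lambda> s X"
    and "toroidal_seed r m n s (Y, B)"
  shows "\<exists>\<phi>. (\<forall>ks. set ks \<subseteq> {1..m} \<longrightarrow>
              \<phi> (unlabelled_seed m n (mutate_along (toroidal_mutation r n s) ks (Y, B))) =
              unlabelled_seed m n (mutate_along (classical_mutation n) ks (classical_initial_seed B))) \<and>
            graph_isomorphism \<phi>
              (exchange_graph m n (toroidal_mutation r n s) (Y, B))
              (exchange_graph m n (classical_mutation n) (classical_initial_seed B))"
proof (rule exchange_graph_isomorphism)
  fix ks ls assume ks: "set ks \<subseteq> {1..m}" "set ls \<subseteq> {1..m}"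
  \<comment> \<open>A default value: with \<open>r = 0\<close> the index range of the square roots
    is empty.\<close>
  let ?s = "\<lambda>_. 1 :: rational_function"
  have X: "seed_ok r s n m (Y, B)"
    by (rule toroidal_seed_imp_seed_ok[OF torus_fraction_field_imp_scalars[OF assms(5)] assms(2,6)])
  have C: "seed_ok 0 ?s n m (classical_initial_seed B)"
    by (rule classical_seed_ok[OF assms(2)]) (use assms(6)[unfolded toroidal_seed.simps] in blast)
  show "seed_equiv m n (mutate_along (toroidal_mutation r n s) ks (Y, B))
        (mutate_along (toroidal_mutation r n s) ls (Y, B)) \<longleftrightarrow>
      seed_equiv m n (mutate_along (classical_mutation n) ks (classical_initial_seed B))
        (mutate_along (classical_mutation n) ls (classical_initial_seed B))"
    unfolding classical_mutate_along_eq_toroidal[OF C ks(1)] classical_mutate_along_eq_toroidal[OF C ks(2)]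
    by (rule seed_equiv_mutate_along_iff[OF assms(3) X C _ ks]) (simp add: classical_initial_seed_def)
qed

end
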